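(* Let $r\ge 1$ and $n\ge 1$ be integers. Then for each $i\in\{0,1,2\}$ and every integer $d\ge r-1$, the spline space $S_{d,i}$ is an optimal $n$-dimensional space for the set $A^r_i$; that is, $S_{d,i}$ is $n$-dimensional and $E(A^r_i,S_{d,i})=d_n(A^r_i)$.
   Context: Let $L^2=L^2(0,1)$ be the space of real-valued square integrable functions with norm $\|f\|^2=\int_0^1 f(t)^2\,dt$, and let $H^r=H^r(0,1)=\{u\in L^2: u^{(\alpha)}\in L^2,\ \alpha=1,\ldots,r\}$ be the usual Sobolev space (weak derivatives; the values $u^{(k)}(0),u^{(k)}(1)$ for $k<r$ are those of the continuous representatives). Function classes: $H^r_0=\{u\in H^r: u^{(k)}(0)=u^{(k)}(1)=0 \text{ for all even } k,\ 0\le k<r\}$, $H^r_1=\{u\in H^r: u^{(k)}(0)=u^{(k)}(1)=0 \text{ for all odd } k,\ 0\le k<r\}$, $H^r_2=\{u\in H^r: u^{(k)}(0)=0 \text{ for all even } k,\ 0\le k<r,\ \text{and } u^{(l)}(1)=0 \text{ for all odd } l,\ 0\le l<r\}$, and $A^r_i=\{u\in H^r_i:\|u^{(r)}\|\le 1\}$ for $i=0,1,2$. Widths: for a subset $A\subset L^2$ and a finite-dimensional subspace $X_n\subset L^2$, $E(A,X_n)=\sup_{u\in A}\inf_{v\in X_n}\|u-v\|$. The Kolmogorov $L^2$ $n$-width of $A$ is $d_n(A)=\inf_{X_n}E(A,X_n)$, the infimum being over all $n$-dimensional subspaces $X_n$ of $L^2$. A subspace $X_n$ is optimal for $A$ if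 $E(A,X_n)=d_n(A)$. Splines: for a knot vector $\boldsymbol\tau=(\tau_1,\ldots,\tau_m)$ with $0<\tau_1<\cdots<\tau_m<1$ (possibly empty, $m=0$), let $I_0=[0,\tau_1)$, $I_j=[\tau_j,\tau_{j+1})$ for $1\le j\le m-1$, $I_m=[\tau_m,1]$ (and $I_0=[0,1]$ if $m=0$). For $d\ge 0$ let $\Pi_d$ be the polynomials of degree at most $d$ and $S_{d,\boldsymbol\tau}=\{s\in C^{d-1}[0,1]: s|_{I_j}\in\Pi_d,\ j=0,\ldots,m\}$ (for $d=0$ no continuity is required). Derivatives of splines at $0$ and $1$ are those of the polynomial pieces on $I_0$ and $I_m$, respectively. Define $S_{d,0}=\{s\in S_{d,\boldsymbol\tau_0}: s^{(k)}(0)=s^{(k)}(1)=0,\ 0\le k\le d,\ k\text{ even}\}$, $S_{d,1}=\{s\in S_{d,\boldsymbol\tau_1}: s^{(k)}(0)=s^{(k)}(1)=0,\ 0\le k\le d,\ k\text{ odd}\}$, $S_{d,2}=\{s\in S_{d,\boldsymbol\tau_2}: s^{(k)}(0)=s^{(l)}(1)=0,\ 0\le k,l\le d,\ k\text{ even},\ l\text{ odd}\}$, where the knot vectors (depending on $n$ and on the parity of $d$) are $\boldsymbol\tau_0=\left(\frac{1}{n+1},\frac{2}{n+1},\ldots,\frac{n}{n+1}\right)$ for $d$ odd and $\left(\frac{1/2}{n+1},\frac{3/2}{n+1},\ldots,\frac{n+1/2}{n+1}\right)$ for $d$ even; $\boldsymbol\tau_1=\left(\frac{1/2}{n},\frac{3/2}{n},\ldots,\frac{n-1/2}{n}\right)$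 for $d$ odd and $\left(\frac1n,\frac2n,\ldots,\frac{n-1}{n}\right)$ for $d$ even; $\boldsymbol\tau_2=\left(\frac{1}{2n+1},\frac{3}{2n+1},\ldots,\frac{2n-1}{2n+1}\right)$ for $d$ even and $\left(\frac{2}{2n+1},\frac{4}{2n+1},\ldots,\frac{2n}{2n+1}\right)$ for $d$ odd. *)

theory Defs
  imports "HOL-Analysis.Analysis" "HOL-Computational_Algebra.Polynomial"
begin

text \<open>The end points form a null set, so the closed interval gives the same space
  as the open one.\<close>

abbreviation lebesgue01 :: "real measure"
  where "lebesgue01 \<equiv> lebesgue_on {0..1}"

definition square_integrable :: "(real \<Rightarrow> real) \<Rightarrow> bool"
  where "square_integrable f \<longleftrightarrow>
    f \<in> borel_measurable lebesgue01 \<and> integrable lebesgue01 (\<lambda>t. (f t)\<^sup>2)"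

definition l2_rel :: "(real \<Rightarrow> real) \<Rightarrow> (real \<Rightarrow> real) \<Rightarrow> bool"
  where "l2_rel f g \<longleftrightarrow>
    square_integrable f \<and> square_integrable g \<and> (AE t in lebesgue01. f t = g t)"

lemma square_integrable_mult:
  assumes "square_integrable f" "square_integrable g"
  shows "integrable lebesgue01 (\<lambda>t. f t * g t)"
proof (rule Bochner_Integration.integrable_bound)
  show "integrable lebesgue01 (\<lambda>t. (f t)\<^sup>2 + (g t)\<^sup>2)"
    using assms by (simp add: square_integrable_def)
  show "(\<lambda>t. f t * g t) \<in> borel_measurable lebesgue01"
    using assms by (simp add: square_integrable_def borel_measurable_times)
  show "AE t in lebesgue01. norm (f t * g t) \<le> norm ((f t)\<^sup>2 + (g t)\<^sup>2)"
  proof (rule AE_I2)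
    fix t
    have "2 * (\<bar>f t\<bar> * \<bar>g t\<bar>) \<le> (f t)\<^sup>2 + (g t)\<^sup>2"
      using sum_squares_bound[of "\<bar>f t\<bar>" "\<bar>g t\<bar>"] by (simp add: mult.assoc)
    moreover have "0 \<le> \<bar>f t\<bar> * \<bar>g t\<bar>" by simp
    ultimately have "\<bar>f t\<bar> * \<bar>g t\<bar> \<le> (f t)\<^sup>2 + (g t)\<^sup>2" by linarith
    then show "norm (f t * g t) \<le> norm ((f t)\<^sup>2 + (g t)\<^sup>2)"
      by (simp add: abs_mult)
  qed
qed

lemma square_integrable_0: "square_integrable (\<lambda>_. 0)"
  by (simp add: square_integrable_def)

lemma square_integrable_add:
  assumes "square_integrable f" "square_integrable g"
  shows "square_integrable (\<lambda>t. f t + g t)"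
  using assms square_integrable_mult[OF assms]
  by (simp add: square_integrable_def power2_sum borel_measurable_add mult.assoc)

lemma square_integrable_scale:
  assumes "square_integrable f"
  shows "square_integrable (\<lambda>t. c * f t)"
  using assms by (simp add: square_integrable_def power_mult_distrib borel_measurable_times)

lemma part_equivp_l2_rel: "part_equivp l2_rel"
proof (rule part_equivpI)
  show "\<exists>f. l2_rel f f"
    using square_integrable_0 by (auto simp: l2_rel_def intro!: exI[of _ "\<lambda>_. 0"])
  show "symp l2_rel"
    by (auto simp: symp_def l2_rel_def elim: AE_mp)
  show "transp l2_rel"
    unfolding transp_def l2_rel_def by (auto elim: AE_mp)
qed

text \<open>For square integrable \<open>f\<close>, \<open>abs_l2 f\<close> is the class of \<open>f\<close> modulo equality almost
  everywhere.\<close>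

quotient_type l2 = "real \<Rightarrow> real" / partial: l2_rel
  by (rule part_equivp_l2_rel)

instantiation l2 :: real_inner
begin

lift_definition zero_l2 :: l2 is "\<lambda>_. 0"
  by (simp add: l2_rel_def square_integrable_0)

lift_definition plus_l2 :: "l2 \<Rightarrow> l2 \<Rightarrow> l2" is "\<lambda>f g t. f t + g t"
  by (auto simp: l2_rel_def square_integrable_add elim: AE_mp)

lift_definition uminus_l2 :: "l2 \<Rightarrow> l2" is "\<lambda>f t. - f t"
  using square_integrable_scale[of _ "-1"] by (auto simp: l2_rel_def elim: AE_mp)

definition minus_l2 :: "l2 \<Rightarrow> l2 \<Rightarrow> l2" where "minus_l2 u v = u + - v"

lift_definition scaleR_l2 :: "real \<Rightarrow> l2 \<Rightarrow> l2" is "\<lambda>c f t. c * f t"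
  by (auto simp: l2_rel_def square_integrable_scale elim: AE_mp)

lift_definition inner_l2 :: "l2 \<Rightarrow> l2 \<Rightarrow> real" is "\<lambda>f g. LINT t|lebesgue01. f t * g t"
  by (rule integral_cong_AE)
    (auto simp: l2_rel_def square_integrable_def borel_measurable_times elim: AE_mp)

lift_definition norm_l2 :: "l2 \<Rightarrow> real" is "\<lambda>f. sqrt (LINT t|lebesgue01. (f t)\<^sup>2)"
  by (rule arg_cong[where f = sqrt], rule integral_cong_AE)
    (auto simp: l2_rel_def square_integrable_def elim: AE_mp)

definition dist_l2 :: "l2 \<Rightarrow> l2 \<Rightarrow> real" where "dist_l2 u v = norm (u - v)"
definition sgn_l2 :: "l2 \<Rightarrow> l2" where "sgn_l2 u = inverse (norm u) *\<^sub>R u"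
definition uniformity_l2 :: "(l2 \<times> l2) filter"
  where "uniformity_l2 = (INF e\<in>{0<..}. principal {(u, v). dist u v < e})"
definition open_l2 :: "l2 set \<Rightarrow> bool"
  where "open_l2 U \<longleftrightarrow> (\<forall>u\<in>U. \<forall>\<^sub>F (u', v) in uniformity. u' = u \<longrightarrow> v \<in> U)"

instance
proof
  fix u v w :: l2 and a b :: real
  show "u + v + w = u + (v + w)"
    by transfer (auto simp: l2_rel_def square_integrable_add add.assoc)
  show "u + v = v + u"
    by transfer (auto simp: l2_rel_def square_integrable_add add.commute)
  show "0 + u = u"
    by transfer (auto simp: l2_rel_def)
  show "- u + u = 0"
    by transfer (auto simp: l2_rel_def square_integrable_0)
  show "u - v = u + - v"
    by (fact minus_l2_def)
  show "a *\<^sub>R (u + v) = a *\<^sub>R u + a *\<^sub>R v"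
    by transfer (auto simp: l2_rel_def square_integrable_add square_integrable_scale
        distrib_left)
  show "(a + b) *\<^sub>R u = a *\<^sub>R u + b *\<^sub>R u"
    by transfer (auto simp: l2_rel_def square_integrable_add square_integrable_scale
        distrib_right)
  show "a *\<^sub>R b *\<^sub>R u = (a * b) *\<^sub>R u"
    by transfer (auto simp: l2_rel_def square_integrable_scale[of _ "_ * _", simplified mult.assoc]
        mult.assoc)
  show "1 *\<^sub>R u = u"
    by transfer (auto simp: l2_rel_def)
  show "dist u v = norm (u - v)"
    by (fact dist_l2_def)
  show "sgn u = inverse (norm u) *\<^sub>R u"
    by (fact sgn_l2_def)
  show "uniformity = (INF e\<in>{0<..}. principal {(u :: l2, v). dist u v < e})"
    by (fact uniformity_l2_def)
  show "open U \<longleftrightarrow> (\<forall>u\<in>U. \<forall>\<^sub>F (u', v) in uniformity. u' = u \<longrightarrow> v \<in> U)" for U :: "l2 set"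
    by (fact open_l2_def)
  show "inner u v = inner v u"
    by transfer (simp add: mult.commute)
  show "inner (u + v) w = inner u w + inner v w"
    by transfer (simp add: l2_rel_def distrib_right square_integrable_mult)
  show "inner (a *\<^sub>R u) v = a * inner u v"
    by transfer (simp add: l2_rel_def mult.assoc)
  show "0 \<le> inner u u"
    by transfer simp
  show "inner u u = 0 \<longleftrightarrow> u = 0"
  proof transfer
    fix f assume f: "l2_rel f f"
    then have "(LINT t|lebesgue01. f t * f t) = 0 \<longleftrightarrow> (AE t in lebesgue01. f t * f t = 0)"
      by (intro integral_nonneg_eq_0_iff_AE) (auto simp: l2_rel_def square_integrable_mult)
    also have "\<dots> \<longleftrightarrow> l2_rel f (\<lambda>_. 0)"
      using f by (simp add: l2_rel_def square_integrable_0)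
    finally show "(LINT t|lebesgue01. f t * f t) = 0 \<longleftrightarrow> l2_rel f (\<lambda>_. 0)" .
  qed
  show "norm u = sqrt (inner u u)"
    by transfer (simp add: power2_eq_square)
qed

end

text \<open>The finite spanning set is needed because \<open>dim\<close> is 0 on infinite-dimensional spaces.\<close>

definition subspaces_of_dim :: "nat \<Rightarrow> l2 set set"
  where "subspaces_of_dim n = {X. subspace X \<and> (\<exists>B. finite B \<and> span B = X) \<and> dim X = n}"

text \<open>The values are extended reals because the deviation may be infinite: the second
  function class below contains all constants.\<close>

definition deviation :: "l2 set \<Rightarrow> l2 set \<Rightarrow> ennreal"
  where "deviation A X = (SUP u\<in>A. INF v\<in>X. ennreal (norm (u - v)))"

definition kolmogorov_width :: "nat \<Rightarrow> l2 set \<Rightarrow> ennreal"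
  where "kolmogorov_width n A = (INF X\<in>subspaces_of_dim n. deviation A X)"

definition optimal_subspace :: "nat \<Rightarrow> l2 set \<Rightarrow> l2 set \<Rightarrow> bool"
  where "optimal_subspace n A X \<longleftrightarrow>
    X \<in> subspaces_of_dim n \<and> deviation A X = kolmogorov_width n A"

definition test_function :: "(real \<Rightarrow> real) \<Rightarrow> bool"
  where "test_function \<phi> \<longleftrightarrow>
    (\<forall>k. (deriv ^^ k) \<phi> differentiable_on UNIV) \<and>
    (\<exists>a b. 0 < a \<and> b < 1 \<and> (\<forall>x. x \<notin> {a..b} \<longrightarrow> \<phi> x = 0))"

lemma test_function_deriv_measurable:
  assumes "test_function \<phi>"
  shows "(deriv ^^ k) \<phi> \<in> borel_measurable lebesgue01"
proof -
  have "continuous_on {0..1} ((deriv ^^ k) \<phi>)"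
    using assms unfolding test_function_def
    by (meson continuous_on_subset differentiable_imp_continuous_on subset_UNIV)
  then show ?thesis
    by (intro continuous_imp_measurable_on_sets_lebesgue) auto
qed

lift_definition has_weak_deriv :: "nat \<Rightarrow> l2 \<Rightarrow> l2 \<Rightarrow> bool"
  is "\<lambda>k f g. \<forall>\<phi>. test_function \<phi> \<longrightarrow>
    (LINT t|lebesgue01. f t * (deriv ^^ k) \<phi> t) = (-1) ^ k * (LINT t|lebesgue01. g t * \<phi> t)"
proof -
  fix k and f f' g g' :: "real \<Rightarrow> real"
  assume ff': "l2_rel f f'" and gg': "l2_rel g g'"
  have eq: "(LINT t|lebesgue01. h t * (deriv ^^ j) \<phi> t) = (LINT t|lebesgue01. h' t * (deriv ^^ j) \<phi> t)"
    if "l2_rel h h'" "test_function \<phi>" for h h' \<phi> j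
    using that test_function_deriv_measurable[OF that(2), of j]
    by (intro integral_cong_AE)
      (auto simp: l2_rel_def square_integrable_def borel_measurable_times elim: AE_mp)
  show "(\<forall>\<phi>. test_function \<phi> \<longrightarrow> (LINT t|lebesgue01. f t * (deriv ^^ k) \<phi> t)
          = (-1) ^ k * (LINT t|lebesgue01. g t * \<phi> t)) \<longleftrightarrow>
        (\<forall>\<phi>. test_function \<phi> \<longrightarrow> (LINT t|lebesgue01. f' t * (deriv ^^ k) \<phi> t)
          = (-1) ^ k * (LINT t|lebesgue01. g' t * \<phi> t))"
    using eq[OF ff', of _ k] eq[OF gg', of _ 0] by simp
qed

definition weak_deriv :: "nat \<Rightarrow> l2 \<Rightarrow> l2"
  where "weak_deriv k u = (THE v. has_weak_deriv k u v)"

definition sobolev :: "nat \<Rightarrow> l2 set"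
  where "sobolev r = {u. \<forall>\<alpha>\<in>{1..r}. \<exists>v. has_weak_deriv \<alpha> u v}"

definition continuous_rep :: "l2 \<Rightarrow> real \<Rightarrow> real"
  where "continuous_rep u = (SOME g. continuous_on {0..1} g \<and> abs_l2 g = u)"

text \<open>Orders of the derivatives that have to vanish at 0 and at 1, for the boundary
  conditions of type \<open>i = 0, 1, 2\<close>.\<close>

definition left_order :: "nat \<Rightarrow> nat \<Rightarrow> bool"
  where "left_order i k \<longleftrightarrow> (if i = 1 then odd k else even k)"

definition right_order :: "nat \<Rightarrow> nat \<Rightarrow> bool"
  where "right_order i k \<longleftrightarrow> (if i = 0 then even k else odd k)"

definition sobolev_bc :: "nat \<Rightarrow> nat \<Rightarrow> l2 set"
  where "sobolev_bc r i = {u \<in> sobolev r.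
    (\<forall>k<r. left_order i k \<longrightarrow> continuous_rep (weak_deriv k u) 0 = 0) \<and>
    (\<forall>k<r. right_order i k \<longrightarrow> continuous_rep (weak_deriv k u) 1 = 0)}"

definition fun_class :: "nat \<Rightarrow> nat \<Rightarrow> l2 set"
  where "fun_class r i = {u \<in> sobolev_bc r i. norm (weak_deriv r u) \<le> 1}"

definition knot_interval :: "real list \<Rightarrow> nat \<Rightarrow> real set"
  where "knot_interval \<tau> j =
    (if j = length \<tau> then {(0 # \<tau>) ! j..1} else {(0 # \<tau>) ! j..<\<tau> ! j})"

definition C_k_on :: "nat \<Rightarrow> real set \<Rightarrow> (real \<Rightarrow> real) \<Rightarrow> bool"
  where "C_k_on k S s \<longleftrightarrow> (\<exists>D :: nat \<Rightarrow> real \<Rightarrow> real.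
    (\<forall>x\<in>S. D 0 x = s x) \<and>
    (\<forall>i<k. \<forall>x\<in>S. (D i has_real_derivative D (Suc i) x) (at x within S)) \<and>
    continuous_on S (D k))"

text \<open>\<open>p j\<close> is the polynomial piece of \<open>s\<close> on the \<open>j\<close>-th knot interval; it is
  unique since these intervals are infinite for strictly increasing knots in (0,1).\<close>

definition spline_with_pieces ::
    "nat \<Rightarrow> real list \<Rightarrow> (real \<Rightarrow> real) \<Rightarrow> (nat \<Rightarrow> real poly) \<Rightarrow> bool"
  where "spline_with_pieces d \<tau> s p \<longleftrightarrow>
    (d > 0 \<longrightarrow> C_k_on (d - 1) {0..1} s) \<and>
    (\<forall>j\<le>length \<tau>. degree (p j) \<le> d \<and> (\<forall>x\<in>knot_interval \<tau> j. s x = poly (p j) x))"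

definition knots :: "nat \<Rightarrow> nat \<Rightarrow> nat \<Rightarrow> real list"
  where "knots n d i =
    (if i = 0 then
       if odd d then map (\<lambda>j. real j / (real n + 1)) [1..<n + 1]
       else map (\<lambda>j. (real j + 1 / 2) / (real n + 1)) [0..<n + 1]
     else if i = 1 then
       if odd d then map (\<lambda>j. (real j + 1 / 2) / real n) [0..<n]
       else map (\<lambda>j. real j / real n) [1..<n]
     else
       if even d then map (\<lambda>j. (2 * real j + 1) / (2 * real n + 1)) [0..<n]
       else map (\<lambda>j. 2 * real j / (2 * real n + 1)) [1..<n + 1])"

definition spline_space :: "nat \<Rightarrow> nat \<Rightarrow> nat \<Rightarrow> l2 set"
  where "spline_space n d i = {abs_l2 s | s p. spline_with_pieces d (knots n d i) s p \<and>
    (\<forall>k\<le>d. left_order i k \<longrightarrow> poly ((pderiv ^^ k) (p 0)) 0 = 0) \<and>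
    (\<forall>k\<le>d. right_order i k \<longrightarrow> poly ((pderiv ^^ k) (p (length (knots n d i)))) 1 = 0)}"

end

theory Submission
  imports Defs
begin

text \<open>Write \<open>\<sigma> = 2 / (m \<pi>)\<close>, where \<open>m = 2 n + 2\<close>, \<open>2 n\<close>, \<open>2 n + 1\<close> for the three types of boundary
  conditions; the knots are the multiples of \<open>1/m\<close> of one parity. Differentiation swaps even and odd
  conditions at each end and preserves \<open>m\<close>, and the splines of degree \<open>d + 1\<close> are exactly the primitives, with
  the right boundary conditions, of the splines of degree \<open>d\<close> of the swapped type.

  The lower bound \<open>\<sigma>\<^sup>r\<close> for the width holds because \<open>n + 1\<close> sine or cosine modes of frequency at most \<open>1 / \<sigma>\<close>
  span a function that is orthogonal to a given \<open>n\<close>-dimensional space. For the upper bound, piecewise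
  constants approximate with error \<open>\<sigma> \<parallel>u'\<parallel>\<close> by the Wirtinger inequality. If splines
  of degree \<open>d\<close> do so for the swapped type, then integrating the orthogonal projection of \<open>u'\<close> shows by duality
  that splines of degree \<open>d + 1\<close> do so as well; the same step gains one factor \<open>\<sigma>\<close> for every further
  derivative.\<close>

subsection \<open>Primitives and the Poincare inequality\<close>

text \<open>Both bounds meet because of a quarter wave. The highest of the modes is
  \<open>sin((m x + N) pi/2)\<close>; it vanishes at all interpolation points of the piecewise
  constants, and on a cell of length \<open>1/m\<close> it runs from a zero to an extremum, which is
  the equality case of the Wirtinger inequality with one end fixed.

  The obstacle in the induction on the degree is the constants. If \<open>u\<close> vanishes at both
  ends, its derivative has mean zero, and the projection of the derivative must keep this mean;
  hence the constants have to lie in the space of the swapped type. If \<open>u\<close> is free at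
  both ends, the constant of integration is free too and is used to give the error mean zero, so
  that the dual primitive can vanish at both ends.

  Weak derivatives and boundary values are removed before this: \<open>f\<close> is the weak
  derivative of \<open>u\<close> iff \<open>u\<close> is \<open>c\<close> times
  \<open>one_l2\<close> plus \<open>prim_l2 f\<close>, and then \<open>c\<close> and
  \<open>c + inner one_l2 f\<close> are the boundary values. What remains is linear algebra in
  \<open>l2\<close> with one integration by parts formula, \<open>prim_l2_parts\<close>.\<close>

lemma AE_zero_if_integrals_zero:
  fixes f :: "real \<Rightarrow> real"
  assumes f: "f absolutely_integrable_on {a..b}"
    and zero: "\<And>c d. a \<le> c \<Longrightarrow> c \<le> d \<Longrightarrow> d \<le> b \<Longrightarrow> integral {c..d} f = 0"
  shows "AE x in lebesgue_on {a..b}. f x = 0"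
proof -
  have fi: "f integrable_on cbox a b" and ai: "(\<lambda>x. \<bar>f x\<bar>) integrable_on cbox a b"
    using f by (auto simp: absolutely_integrable_on_def)
  define I where "I = integral (cbox a b) (\<lambda>x. \<bar>f x\<bar>)"
  have "I \<le> 0 + e" if "e > 0" for e
  proof -
    from that have e2: "e / 2 > 0" by simp
    \<comment> \<open>Since the integrals over all subintervals vanish, the sum in the Henstock
      lemma is a Riemann sum of \<open>\<bar>f\<bar>\<close>; so the integral of
      \<open>\<bar>f\<bar>\<close> is arbitrarily small.\<close>
    obtain \<gamma>1 where g1: "gauge \<gamma>1" and h1: "\<And>p. \<lbrakk>p tagged_partial_division_of (cbox a b); \<gamma>1 fine p\<rbrakk> \<Longrightarrow>
             sum (\<lambda>(x,k). norm(measure lborel k *\<^sub>R f x - integral k f)) p < e / 2"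
      by (rule Henstock_lemma[OF fi e2]) blast
    have hi: "((\<lambda>x. \<bar>f x\<bar>) has_integral I) (cbox a b)"
      unfolding I_def using ai by (rule integrable_integral)
    obtain \<gamma>2 where g2: "gauge \<gamma>2" and h2: "\<And>p. \<lbrakk>p tagged_division_of (cbox a b); \<gamma>2 fine p\<rbrakk> \<Longrightarrow>
             norm ((\<Sum>(x,k)\<in>p. measure lborel k *\<^sub>R \<bar>f x\<bar>) - I) < e / 2"
      using hi e2 unfolding has_integral by metis
    obtain p where p: "p tagged_division_of (cbox a b)" "(\<lambda>x. \<gamma>1 x \<inter> \<gamma>2 x) fine p"
      using fine_division_exists[OF gauge_Int[OF g1 g2]] by metis
    then have f12: "\<gamma>1 fine p" "\<gamma>2 fine p" by (auto simp: fine_Int)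
    have "(\<Sum>(x,k)\<in>p. measure lborel k *\<^sub>R \<bar>f x\<bar>) = sum (\<lambda>(x,k). norm(measure lborel k *\<^sub>R f x - integral k f)) p"
    proof (rule sum.cong, simp, clarify)
      fix x k assume xk: "(x, k) \<in> p"
      obtain c d where k: "k = cbox c d" using tagged_division_ofD(4)[OF p(1) xk] by blast
      have sub: "k \<subseteq> cbox a b" "x \<in> k"
        using tagged_division_ofD(2,3)[OF p(1) xk] by auto
      then have "integral k f = 0" using zero[of c d] k by auto
      then show "measure lborel k *\<^sub>R \<bar>f x\<bar> = norm (measure lborel k *\<^sub>R f x - integral k f)"
        by (simp add: abs_mult)
    qed
    also have "\<dots> < e / 2" using h1[of p] f12 p(1) by (simp add: tagged_division_of_def)
    finally show ?thesis using h2[OF p(1) f12(2)] by (simp add: abs_if split: if_splits)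
  qed
  then have "I \<le> 0" by (rule field_le_epsilon)
  moreover have "I \<ge> 0" unfolding I_def by (rule integral_nonneg[OF ai]) simp
  ultimately have I0: "I = 0" by simp
  have int: "integrable (lebesgue_on {a..b}) (\<lambda>x. \<bar>f x\<bar>)"
    using f by (simp add: absolutely_integrable_measurable_real)
  have "integral\<^sup>L (lebesgue_on {a..b}) (\<lambda>x. \<bar>f x\<bar>) = 0"
    using lebesgue_integral_eq_integral[OF int] I0 unfolding I_def by simp
  then have "AE x in lebesgue_on {a..b}. \<bar>f x\<bar> = 0"
    using integral_nonneg_eq_0_iff_AE[OF int] by simp
  then show ?thesis by simp
qed

text \<open>Absolute continuity in integral form, with \<open>f\<close> as density; no derivative
  almost everywhere has to be taken.\<close>

definition primitive_on :: "real \<Rightarrow> real \<Rightarrow> (real \<Rightarrow> real) \<Rightarrow> (real \<Rightarrow> real) \<Rightarrow> bool" where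
  "primitive_on a b F f \<longleftrightarrow> f absolutely_integrable_on {a..b} \<and> (\<forall>x\<in>{a..b}. F x = F a + integral {a..x} f)"

lemma primitive_onD:
  assumes "primitive_on a b F f"
  shows "f absolutely_integrable_on {a..b}" "x \<in> {a..b} \<Longrightarrow> F x = F a + integral {a..x} f"
  using assms unfolding primitive_on_def by blast+

lemma primitive_on_integrable:
  assumes "primitive_on a b F f" "a \<le> x" "y \<le> b"
  shows "f absolutely_integrable_on {x..y}"
  using assms absolutely_integrable_on_subinterval[OF primitive_onD(1)[OF assms(1)], of x y] by auto

lemma absolutely_integrable_imp_integrable:
  fixes f :: "real \<Rightarrow> real"
  shows "f absolutely_integrable_on S \<Longrightarrow> f integrable_on S"
  by (simp add: absolutely_integrable_on_def)

lemma primitive_on_diff: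
  assumes "primitive_on a b F f" "a \<le> x" "x \<le> y" "y \<le> b"
  shows "integral {x..y} f = F y - F x"
proof -
  have "integral {a..x} f + integral {x..y} f = integral {a..y} f"
    using assms(2-4) primitive_on_integrable[OF assms(1) order_refl assms(4)]
    by (intro Henstock_Kurzweil_Integration.integral_combine absolutely_integrable_imp_integrable)
  moreover have "F x = F a + integral {a..x} f" "F y = F a + integral {a..y} f"
    by (rule primitive_onD(2)[OF assms(1)]; use assms(2-4) in simp)+
  ultimately show ?thesis by simp
qed

lemma primitive_on_subinterval:
  assumes "primitive_on a b F f" "a \<le> c" "d \<le> b"
  shows "primitive_on c d F f"
proof -
  have "F x = F c + integral {c..x} f" if "x \<in> {c..d}" for x
    using primitive_on_diff[OF assms(1,2), of x] that assms(3) by simp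
  then show ?thesis
    using primitive_on_integrable[OF assms] unfolding primitive_on_def by blast
qed

lemma primitive_on_continuous:
  assumes "primitive_on a b F f"
  shows "continuous_on {a..b} F"
proof -
  have "continuous_on {a..b} (\<lambda>x. F a + integral {a..x} f)"
    by (intro continuous_intros indefinite_integral_continuous_1 absolutely_integrable_imp_integrable
        primitive_on_integrable[OF assms] order_refl)
  moreover have "F x = F a + integral {a..x} f" if "x \<in> {a..b}" for x
    using primitive_onD(2)[OF assms that] .
  ultimately show ?thesis using continuous_on_eq by (metis (no_types, lifting))
qed

lemma absolutely_integrable_continuous_mult:
  fixes f g :: "real \<Rightarrow> real"
  assumes "continuous_on {a..b} g" "f absolutely_integrable_on {a..b}"
  shows "(\<lambda>x. g x * f x) absolutely_integrable_on {a..b}" "(\<lambda>x. f x * g x) absolutely_integrable_on {a..b}"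
proof -
  show "(\<lambda>x. g x * f x) absolutely_integrable_on {a..b}"
    using assms
    by (intro absolutely_integrable_bounded_measurable_product_real)
       (auto intro!: compact_imp_bounded compact_continuous_image continuous_imp_measurable_on_sets_lebesgue)
  then show "(\<lambda>x. f x * g x) absolutely_integrable_on {a..b}" by (simp add: mult.commute)
qed

text \<open>Over a short interval the defect in the product rule is the integral of \<open>f\<close> and \<open>g\<close> against
  oscillations of the continuous functions \<open>F\<close> and \<open>G\<close>, so it is at most \<open>\<epsilon>\<close> times the integral
  of \<open>\<bar>f\<bar> + \<bar>g\<bar>\<close>, and this bound adds up.\<close>

lemma primitive_on_mult:
  assumes F: "primitive_on a b F f" and G: "primitive_on a b G g"
  shows "primitive_on a b (\<lambda>x. F x * G x) (\<lambda>x. f x * G x + F x * g x)"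
proof -
  define h where "h x = f x * G x + F x * g x" for x
  define k where "k x = \<bar>f x\<bar> + \<bar>g x\<bar>" for x
  have fa: "f absolutely_integrable_on {a..b}" and ga: "g absolutely_integrable_on {a..b}"
    using F G by (auto intro: primitive_onD)
  have Fc: "continuous_on {a..b} F" and Gc: "continuous_on {a..b} G"
    using F G by (auto intro: primitive_on_continuous)
  have ha: "h absolutely_integrable_on {a..b}"
    unfolding h_def using absolutely_integrable_continuous_mult[OF Gc fa]
      absolutely_integrable_continuous_mult[OF Fc ga] by (intro set_integral_add(1))
  have ka: "k absolutely_integrable_on {a..b}"
    unfolding k_def using fa ga by (intro set_integral_add(1)) (auto intro: set_integrable_abs)
  have ha': "h integrable_on {x..y}" and ka': "k integrable_on {x..y}" if "a \<le> x" "y \<le> b" for x y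
    using absolutely_integrable_on_subinterval[OF ha] absolutely_integrable_on_subinterval[OF ka] that
    by (force intro: absolutely_integrable_imp_integrable)+
  define D where "D x y = F y * G y - F x * G x - integral {x..y} h" for x y
  have bound: "\<bar>D a t\<bar> \<le> 2 * e * integral {a..t} k" if t: "a \<le> t" "t \<le> b" and e: "e > 0" for t e
  proof -
    define P where "P x y \<longleftrightarrow> (a \<le> x \<and> x \<le> y \<and> y \<le> b \<longrightarrow> \<bar>D x y\<bar> \<le> 2 * e * integral {x..y} k)" for x y
    have "P a t"
    proof (induction rule: Bolzano[OF t(1)])
      case (1 x y z)
      show ?case unfolding P_def
      proof (intro impI)
        assume c: "a \<le> x \<and> x \<le> z \<and> z \<le> b"
        have "integral {x..y} h + integral {y..z} h = integral {x..z} h"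
             "integral {x..y} k + integral {y..z} k = integral {x..z} k"
          using 1 c by (auto intro!: Henstock_Kurzweil_Integration.integral_combine ha' ka')
        moreover from this(1) have "D x z = D x y + D y z" by (simp add: D_def)
        moreover have "\<bar>D x y\<bar> \<le> 2 * e * integral {x..y} k" "\<bar>D y z\<bar> \<le> 2 * e * integral {y..z} k"
          using 1 c by (auto simp: P_def)
        ultimately show "\<bar>D x z\<bar> \<le> 2 * e * integral {x..z} k"
          using abs_triangle_ineq[of "D x y" "D y z"] by (smt (verit) distrib_left)
      qed
    next
      case (2 x)
      then have xab: "x \<in> {a..b}" using t by auto
      obtain d1 where d1: "d1 > 0" "\<And>y. y \<in> {a..b} \<Longrightarrow> \<bar>y - x\<bar> < d1 \<Longrightarrow> \<bar>F y - F x\<bar> < e"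
        using Fc xab e unfolding continuous_on_iff dist_real_def by meson
      obtain d2 where d2: "d2 > 0" "\<And>y. y \<in> {a..b} \<Longrightarrow> \<bar>y - x\<bar> < d2 \<Longrightarrow> \<bar>G y - G x\<bar> < e"
        using Gc xab e unfolding continuous_on_iff dist_real_def by meson
      show ?case
      proof (intro exI[of _ "min d1 d2"] conjI allI impI)
        show "0 < min d1 d2" using d1 d2 by simp
        fix s u assume su: "s \<le> x \<and> x \<le> u \<and> u - s < min d1 d2"
        show "P s u" unfolding P_def
        proof (intro impI)
          assume c: "a \<le> s \<and> s \<le> u \<and> u \<le> b"
          have fs: "f absolutely_integrable_on {s..u}" and gs: "g absolutely_integrable_on {s..u}"
            using c primitive_on_integrable[OF F, of s u] primitive_on_integrable[OF G, of s u] by auto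
          have Fs: "continuous_on {s..u} F" and Gs: "continuous_on {s..u} G"
            using Fc Gc c by (auto elim: continuous_on_subset)
          have i1: "(\<lambda>x. (F u - F x) * g x) integrable_on {s..u}"
           and i2: "(\<lambda>x. f x * (G s - G x)) integrable_on {s..u}"
            by (intro absolutely_integrable_imp_integrable absolutely_integrable_continuous_mult
                continuous_intros fs gs Fs Gs)+
          \<comment> \<open>Freezing \<open>F\<close> at the right end and \<open>G\<close> at the
            left end turns both increments into integrals of the densities.\<close>
          have "D s u = F u * (G u - G s) + (F u - F s) * G s - integral {s..u} h"
            by (simp add: D_def algebra_simps)
          also have "\<dots> = F u * integral {s..u} g + integral {s..u} f * G s - integral {s..u} h"
            using primitive_on_diff[OF F, of s u] primitive_on_diff[OF G, of s u] c by simp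
          also have "\<dots> = integral {s..u} (\<lambda>x. F u * g x + f x * G s - h x)"
            using absolutely_integrable_imp_integrable[OF fs] absolutely_integrable_imp_integrable[OF gs]
              ha'[of s u] c
            by (subst integral_diff, auto intro!: integrable_add integrable_on_mult_right integrable_on_mult_left)
               (subst integral_add, auto intro!: integrable_on_mult_right integrable_on_mult_left)
          also have "\<dots> = integral {s..u} (\<lambda>x. (F u - F x) * g x + f x * (G s - G x))"
            by (simp add: h_def algebra_simps)
          finally have "norm (D s u) \<le> integral {s..u} (\<lambda>x. 2 * e * k x)"
          proof (simp only:, intro integral_norm_bound_integral)
            show "(\<lambda>x. (F u - F x) * g x + f x * (G s - G x)) integrable_on {s..u}"
              using i1 i2 by (rule integrable_add)
            show "(\<lambda>x. 2 * e * k x) integrable_on {s..u}"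
              using ka'[of s u] c by (auto intro: integrable_on_mult_right)
            fix y assume y: "y \<in> {s..u}"
            have "\<bar>F u - F x\<bar> < e" "\<bar>F y - F x\<bar> < e" "\<bar>G s - G x\<bar> < e" "\<bar>G y - G x\<bar> < e"
              using y su c by (auto intro!: d1 d2)
            \<comment> \<open>Closeness is known only to the values at \<open>x\<close>, hence the
              factor 2 for two points of \<open>{s..u}\<close>.\<close>
            then have "\<bar>F u - F y\<bar> \<le> 2 * e" "\<bar>G s - G y\<bar> \<le> 2 * e" by linarith+
            then have "\<bar>F u - F y\<bar> * \<bar>g y\<bar> + \<bar>f y\<bar> * \<bar>G s - G y\<bar> \<le> 2 * e * \<bar>g y\<bar> + \<bar>f y\<bar> * (2 * e)"
              by (intro add_mono mult_mono) auto
            then show "norm ((F u - F y) * g y + f y * (G s - G y)) \<le> 2 * e * k y"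
              unfolding k_def real_norm_def using abs_triangle_ineq[of "(F u - F y) * g y" "f y * (G s - G y)"]
              by (simp only: abs_mult distrib_left) (simp add: mult.commute)
          qed
          then show "\<bar>D s u\<bar> \<le> 2 * e * integral {s..u} k" by simp
        qed
      qed
    qed
    then show ?thesis using t by (simp add: P_def)
  qed
  have "D a t = 0" if t: "a \<le> t" "t \<le> b" for t
  proof (rule ccontr)
    define K where "K = integral {a..t} k"
    assume nz: "D a t \<noteq> 0"
    have "K \<ge> 0" unfolding K_def using ka'[of a t] t by (intro integral_nonneg) (auto simp: k_def)
    \<comment> \<open>\<open>K + 1\<close> because \<open>K\<close> may be 0; the factor 4 beats the
      factor 2 of the bound.\<close>
    define e where "e = \<bar>D a t\<bar> / (4 * (K + 1))"
    have "e > 0" using nz \<open>K \<ge> 0\<close> by (simp add: e_def)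
    have "\<bar>D a t\<bar> \<le> 2 * e * K" using bound[OF t \<open>e > 0\<close>] by (simp add: K_def)
    also have "\<dots> < 4 * e * (K + 1)" using \<open>e > 0\<close> \<open>K \<ge> 0\<close> by (simp add: algebra_simps add_pos_nonneg)
    also have "\<dots> = \<bar>D a t\<bar>" using \<open>K \<ge> 0\<close> by (simp add: e_def add_eq_0_iff field_simps)
    finally show False by simp
  qed
  then have "F t * G t = F a * G a + integral {a..t} h" if "t \<in> {a..b}" for t
    using that unfolding D_def by force
  then show ?thesis using ha unfolding primitive_on_def h_def by blast
qed

lemma primitive_on_derivative:
  assumes "\<And>x. x \<in> {a..b} \<Longrightarrow> (F has_real_derivative f x) (at x within {a..b})" "continuous_on {a..b} f"
  shows "primitive_on a b F f"
  unfolding primitive_on_def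
proof (intro conjI ballI)
  show "f absolutely_integrable_on {a..b}"
    using assms(2) by (rule absolutely_integrable_continuous_real)
  fix x assume x: "x \<in> {a..b}"
  have "(f has_integral F x - F a) {a..x}"
  proof (rule fundamental_theorem_of_calculus)
    show "a \<le> x" using x by simp
    fix y assume y: "y \<in> {a..x}"
    show "(F has_vector_derivative f y) (at y within {a..x})"
      using assms(1)[of y] x y unfolding has_real_derivative_iff_has_vector_derivative
      by (auto elim!: has_vector_derivative_within_subset)
  qed
  then show "F x = F a + integral {a..x} f" by (simp add: integral_unique)
qed

text \<open>The sharp constant comes from completing the square in \<open>f\<^sup>2 - \<omega>\<^sup>2 u\<^sup>2\<close> with a solution \<open>q\<close> of the
  Riccati equation \<open>q' = - (\<omega>\<^sup>2 + q\<^sup>2)\<close>, where \<open>u\<^sup>2 q\<close> vanishes at both ends; the phase keeps \<open>q\<close>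
  regular for every \<open>\<omega>\<close> below the critical frequency.\<close>

lemma poincare_half:
  fixes u f :: "real \<Rightarrow> real"
  assumes u: "primitive_on \<alpha> \<beta> u f" and f2: "(\<lambda>x. (f x)\<^sup>2) integrable_on {\<alpha>..\<beta>}"
    and ab: "\<alpha> < \<beta>" and zero: "u \<alpha> = 0 \<or> u \<beta> = 0"
  shows "integral {\<alpha>..\<beta>} (\<lambda>x. (u x)\<^sup>2) \<le> (2 * (\<beta> - \<alpha>) / pi)\<^sup>2 * integral {\<alpha>..\<beta>} (\<lambda>x. (f x)\<^sup>2)"
proof -
  define A where "A = integral {\<alpha>..\<beta>} (\<lambda>x. (u x)\<^sup>2)"
  define B where "B = integral {\<alpha>..\<beta>} (\<lambda>x. (f x)\<^sup>2)"
  define \<omega>0 where "\<omega>0 = pi / (2 * (\<beta> - \<alpha>))"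
  have \<omega>0: "\<omega>0 > 0" using ab by (simp add: \<omega>0_def)
  have uc: "continuous_on {\<alpha>..\<beta>} u" using u by (rule primitive_on_continuous)
  have ui: "(\<lambda>x. (u x)\<^sup>2) integrable_on {\<alpha>..\<beta>}"
    by (intro integrable_continuous_real continuous_intros uc)
  have key: "\<omega>\<^sup>2 * A \<le> B" if w: "0 < \<omega>" "\<omega> < \<omega>0" for \<omega>
  proof -
    \<comment> \<open>The phase puts the zero of the cotangent at the end where \<open>u\<close>
      need not vanish.\<close>
    define \<delta> where "\<delta> = (if u \<alpha> = 0 then pi / 2 - \<omega> * (\<beta> - \<alpha>) else pi / 2)"
    define q where "q x = \<omega> * cot (\<omega> * (x - \<alpha>) + \<delta>)" for x
    have wl: "\<omega> * (\<beta> - \<alpha>) < pi / 2"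
      using w ab by (simp add: \<omega>0_def field_simps)
    have sin: "sin (\<omega> * (x - \<alpha>) + \<delta>) > 0" if x: "x \<in> {\<alpha>..\<beta>}" for x
    proof (rule sin_gt_zero)
      have le: "0 \<le> \<omega> * (x - \<alpha>)" "\<omega> * (x - \<alpha>) \<le> \<omega> * (\<beta> - \<alpha>)"
        using x w by (auto intro: mult_left_mono)
      have "0 < \<delta>" using wl by (auto simp: \<delta>_def)
      then show "0 < \<omega> * (x - \<alpha>) + \<delta>" using le by linarith
      show "\<omega> * (x - \<alpha>) + \<delta> < pi" using le wl pi_gt_zero by (auto simp: \<delta>_def)
    qed
    have dq: "(q has_real_derivative - (\<omega>\<^sup>2 + (q x)\<^sup>2)) (at x within {\<alpha>..\<beta>})" if "x \<in> {\<alpha>..\<beta>}" for x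
    proof -
      define y where "y = \<omega> * (x - \<alpha>) + \<delta>"
      have s: "sin y \<noteq> 0" using sin[OF that] by (simp add: y_def)
      have "(q has_real_derivative \<omega> * (- inverse ((sin y)\<^sup>2) * \<omega>)) (at x within {\<alpha>..\<beta>})"
      proof -
        have "((\<lambda>x. cot (\<omega> * (x - \<alpha>) + \<delta>)) has_real_derivative - inverse ((sin y)\<^sup>2) * \<omega>) (at x within {\<alpha>..\<beta>})"
          unfolding y_def
          by (rule DERIV_chain2[where f = cot and g = "\<lambda>x. \<omega> * (x - \<alpha>) + \<delta>"])
            (use s[unfolded y_def] in \<open>auto intro!: derivative_eq_intros\<close>)
        then show ?thesis unfolding q_def[abs_def] by (rule DERIV_cmult)
      qed
      moreover have "\<omega> * (- inverse ((sin y)\<^sup>2) * \<omega>) = - (\<omega>\<^sup>2 + (q x)\<^sup>2)"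
      proof -
        have "\<omega>\<^sup>2 + (q x)\<^sup>2 = \<omega>\<^sup>2 * ((sin y)\<^sup>2 + (cos y)\<^sup>2) / (sin y)\<^sup>2"
        proof -
          have "q x = \<omega> * (cos y / sin y)" by (simp add: q_def y_def cot_def)
          then show ?thesis
            using s by (simp only: power_mult_distrib power_divide) (simp add: field_simps del: sin_cos_squared_add sin_cos_squared_add2)
        qed
        then have "\<omega>\<^sup>2 + (q x)\<^sup>2 = \<omega>\<^sup>2 / (sin y)\<^sup>2" by (simp only: sin_cos_squared_add mult_1_right)
        then show ?thesis by (simp add: power2_eq_square divide_inverse)
      qed
      ultimately show ?thesis by simp
    qed
    have qc: "continuous_on {\<alpha>..\<beta>} q"
      using dq by (meson DERIV_continuous continuous_on_eq_continuous_within)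
    have qp: "primitive_on \<alpha> \<beta> q (\<lambda>x. - (\<omega>\<^sup>2 + (q x)\<^sup>2))"
      by (intro primitive_on_derivative dq continuous_intros qc)
    define p where "p x = (f x * u x + u x * f x) * q x + u x * u x * - (\<omega>\<^sup>2 + (q x)\<^sup>2)" for x
    have pp: "primitive_on \<alpha> \<beta> (\<lambda>x. u x * u x * q x) p"
      unfolding p_def using primitive_on_mult[OF primitive_on_mult[OF u u] qp] .
    have "\<delta> + \<omega> * (\<beta> - \<alpha>) = pi / 2 \<or> u \<beta> = 0" "\<delta> = pi / 2 \<or> u \<alpha> = 0"
      using zero by (auto simp: \<delta>_def)
    then have "cos (\<delta> + \<omega> * (\<beta> - \<alpha>)) = 0 \<or> u \<beta> = 0" "cos \<delta> = 0 \<or> u \<alpha> = 0"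
      by (metis cos_pi_half)+
    then have "u \<beta> * u \<beta> * q \<beta> = 0" "u \<alpha> * u \<alpha> * q \<alpha> = 0"
      by (auto simp: q_def cot_def add.commute)
    then have p0: "integral {\<alpha>..\<beta>} p = 0"
      using primitive_on_diff[OF pp, of \<alpha> \<beta>] ab by (simp only: less_imp_le order_refl diff_self)
    have pi: "p integrable_on {\<alpha>..\<beta>}"
      using pp by (intro absolutely_integrable_imp_integrable primitive_onD)
    have "0 \<le> integral {\<alpha>..\<beta>} (\<lambda>x. ((f x)\<^sup>2 - \<omega>\<^sup>2 * (u x)\<^sup>2) - p x)"
    proof (rule integral_nonneg)
      show "(\<lambda>x. ((f x)\<^sup>2 - \<omega>\<^sup>2 * (u x)\<^sup>2) - p x) integrable_on {\<alpha>..\<beta>}"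
        by (intro integrable_diff f2 pi integrable_on_mult_right ui)
      fix x
      have "((f x)\<^sup>2 - \<omega>\<^sup>2 * (u x)\<^sup>2) - p x = (f x - q x * u x)\<^sup>2"
        by (simp add: p_def power2_eq_square algebra_simps)
      then show "0 \<le> ((f x)\<^sup>2 - \<omega>\<^sup>2 * (u x)\<^sup>2) - p x" by simp
    qed
    also have "\<dots> = B - \<omega>\<^sup>2 * A - 0"
      unfolding A_def B_def p0[symmetric] using f2 ui pi
      by (simp add: integral_diff integrable_diff integrable_on_mult_right)
    finally show ?thesis by simp
  qed
  \<comment> \<open>At \<open>\<omega>0\<close> itself the cotangent has a pole at the end where
    \<open>u\<close> vanishes, so the sharp constant is reached only as a limit.\<close>
  have "((\<lambda>\<omega>. \<omega>\<^sup>2 * A) \<longlongrightarrow> \<omega>0\<^sup>2 * A) (at_left \<omega>0)"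
    by (intro tendsto_intros)
  moreover have "eventually (\<lambda>\<omega>. \<omega>\<^sup>2 * A \<le> B) (at_left \<omega>0)"
    using eventually_at_left_real[OF \<omega>0] by eventually_elim (use key in auto)
  ultimately have "\<omega>0\<^sup>2 * A \<le> B"
    by (rule tendsto_upperbound) simp
  then have "A \<le> B / \<omega>0\<^sup>2" using \<omega>0 by (simp add: field_simps)
  then show ?thesis by (simp add: A_def B_def \<omega>0_def power_divide field_simps)
qed

subsection \<open>Primitives in \<open>L\<^sup>2\<close>\<close>

lemma l2_rel_refl: "l2_rel f f \<longleftrightarrow> square_integrable f"
  by (auto simp: l2_rel_def)

lemma l2_cases: obtains f where "square_integrable f" "u = abs_l2 f"
  using l2.abs_induct[of "\<lambda>u. \<exists>f. square_integrable f \<and> u = abs_l2 f" u]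
  by (auto simp: l2_rel_refl)

lemma abs_l2_eq_iff:
  assumes "square_integrable f" "square_integrable g"
  shows "abs_l2 f = abs_l2 g \<longleftrightarrow> (AE t in lebesgue01. f t = g t)"
  using Quotient_rel[OF Quotient_l2, of f g] assms by (auto simp: l2_rel_def)

lemma square_integrable_cong:
  assumes "square_integrable f" "\<And>x. x \<in> {0..1} \<Longrightarrow> f x = g x"
  shows "square_integrable g"
proof -
  have "f \<in> borel_measurable lebesgue01 \<longleftrightarrow> g \<in> borel_measurable lebesgue01"
    using assms(2) by (intro measurable_cong) (auto simp: space_restrict_space)
  moreover have "integrable lebesgue01 (\<lambda>t. (f t)\<^sup>2) \<longleftrightarrow> integrable lebesgue01 (\<lambda>t. (g t)\<^sup>2)"
    using assms(2) by (intro Bochner_Integration.integrable_cong) (auto simp: space_restrict_space)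
  ultimately show ?thesis using assms(1) by (simp add: square_integrable_def)
qed

lemma abs_l2_cong:
  assumes "square_integrable f" "\<And>x. x \<in> {0..1} \<Longrightarrow> f x = g x"
  shows "abs_l2 f = abs_l2 g"
proof -
  have "AE t in lebesgue01. f t = g t"
    using assms(2) by (intro AE_I2) (auto simp: space_restrict_space)
  then show ?thesis
    using abs_l2_eq_iff[OF assms(1) square_integrable_cong[OF assms]] by simp
qed

lemma abs_l2_add:
  "square_integrable f \<Longrightarrow> square_integrable g \<Longrightarrow> abs_l2 f + abs_l2 g = abs_l2 (\<lambda>t. f t + g t)"
  by (simp add: plus_l2.abs_eq l2_rel_refl)

lemma abs_l2_scaleR: "square_integrable f \<Longrightarrow> c *\<^sub>R abs_l2 f = abs_l2 (\<lambda>t. c * f t)"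
  by (simp add: scaleR_l2.abs_eq l2_rel_refl)

lemma square_integrable_diff:
  "square_integrable f \<Longrightarrow> square_integrable g \<Longrightarrow> square_integrable (\<lambda>t. f t - g t)"
  using square_integrable_add[OF _ square_integrable_scale[of g "-1"], of f] by simp

lemma abs_l2_diff:
  assumes "square_integrable f" "square_integrable g"
  shows "abs_l2 f - abs_l2 g = abs_l2 (\<lambda>t. f t - g t)"
proof -
  have "abs_l2 f - abs_l2 g = abs_l2 f + (-1) *\<^sub>R abs_l2 g" by simp
  also have "\<dots> = abs_l2 (\<lambda>t. f t + (-1) * g t)"
    using assms by (simp only: abs_l2_scaleR abs_l2_add square_integrable_scale)
  finally show ?thesis by simp
qed

lemma square_integrable_continuous:
  assumes "continuous_on {0..1} f"
  shows "square_integrable f"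
  using assms unfolding square_integrable_def
  by (auto intro!: continuous_imp_measurable_on_sets_lebesgue continuous_imp_integrable_real continuous_intros)

lemma square_integrable_const: "square_integrable (\<lambda>_. c)"
  by (intro square_integrable_continuous continuous_intros)

lemma square_integrable_mult_absolutely_integrable:
  assumes "square_integrable f" "square_integrable g"
  shows "(\<lambda>t. f t * g t) absolutely_integrable_on {0..1}"
proof -
  have "integrable lebesgue01 (\<lambda>t. \<bar>f t * g t\<bar>)"
    using square_integrable_mult[OF assms] by (rule integrable_abs)
  then show ?thesis
    using borel_measurable_integrable[OF square_integrable_mult[OF assms]]
    by (simp add: absolutely_integrable_measurable_real)
qed

lemma square_integrable_absolutely_integrable:
  "square_integrable f \<Longrightarrow> f absolutely_integrable_on {0..1}"
  using square_integrable_mult_absolutely_integrable[of f "\<lambda>_. 1"] by (simp add: square_integrable_const)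

lemma square_integrable_square:
  "square_integrable f \<Longrightarrow> (\<lambda>t. (f t)\<^sup>2) integrable_on {0..1}"
  using absolutely_integrable_imp_integrable[OF square_integrable_mult_absolutely_integrable[of f f]]
  by (simp add: power2_eq_square)

lemma inner_abs_l2:
  assumes "square_integrable f" "square_integrable g"
  shows "inner (abs_l2 f) (abs_l2 g) = integral {0..1} (\<lambda>t. f t * g t)"
  using lebesgue_integral_eq_integral[OF square_integrable_mult[OF assms]] assms
  by (simp add: inner_l2.abs_eq l2_rel_refl)

lemma norm_abs_l2:
  "square_integrable f \<Longrightarrow> (norm (abs_l2 f))\<^sup>2 = integral {0..1} (\<lambda>t. (f t)\<^sup>2)"
  unfolding power2_norm_eq_inner by (simp add: inner_abs_l2 power2_eq_square)

definition one_l2 :: l2 where "one_l2 = abs_l2 (\<lambda>_. 1)"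

lemma scaleR_one_l2: "c *\<^sub>R one_l2 = abs_l2 (\<lambda>_. c)"
  by (simp add: one_l2_def abs_l2_scaleR square_integrable_const)

lemma inner_one_l2: "square_integrable f \<Longrightarrow> inner one_l2 (abs_l2 f) = integral {0..1} f"
  by (simp add: one_l2_def inner_abs_l2 square_integrable_const)

lemma inner_one_one: "inner one_l2 one_l2 = 1"
  by (simp add: one_l2_def inner_abs_l2 square_integrable_const)

lemma square_integrable_primitive:
  assumes "square_integrable f"
  shows "square_integrable (\<lambda>x. integral {0..x} f)"
  using absolutely_integrable_imp_integrable[OF square_integrable_absolutely_integrable[OF assms]]
  by (intro square_integrable_continuous indefinite_integral_continuous_1)

text \<open>The Volterra operator. It respects classes because changing the integrand on a null set
  changes no integral.\<close>

lift_definition prim_l2 :: "l2 \<Rightarrow> l2" is "\<lambda>f x. integral {0..x} f"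
proof -
  fix f g assume fg: "l2_rel f g"
  then have "AE t in lebesgue01. f t = g t" by (simp add: l2_rel_def)
  then obtain N where N: "{t \<in> space lebesgue. \<not> (t \<in> {0..1} \<longrightarrow> f t = g t)} \<subseteq> N" "N \<in> null_sets lebesgue"
    by (subst (asm) AE_restrict_space_iff) (auto simp: eventually_ae_filter)
  have "integral {0..x} f = integral {0..x} g" if "x \<in> {0..1}" for x
  proof (rule integral_spike)
    show "negligible N" using N by (simp add: negligible_iff_null_sets)
    show "\<And>t. t \<in> {0..x} - N \<Longrightarrow> g t = f t" using N that by fastforce
  qed
  then have "AE t in lebesgue01. integral {0..t} f = integral {0..t} g"
    by (intro AE_I2) (auto simp: space_restrict_space)
  then show "l2_rel (\<lambda>x. integral {0..x} f) (\<lambda>x. integral {0..x} g)"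
    using fg by (auto simp: l2_rel_def square_integrable_primitive)
qed

lemma prim_l2_abs: "square_integrable f \<Longrightarrow> prim_l2 (abs_l2 f) = abs_l2 (\<lambda>x. integral {0..x} f)"
  by (simp add: prim_l2.abs_eq l2_rel_refl)

lemma square_integrable_integrable_on:
  assumes "square_integrable f" "x \<le> 1"
  shows "f integrable_on {0..x}"
  using absolutely_integrable_imp_integrable[OF square_integrable_absolutely_integrable[OF assms(1)]] assms(2)
  by (rule_tac integrable_on_subinterval) auto

lemma linear_prim_l2: "linear prim_l2"
proof (rule linearI)
  fix u v :: l2 and c
  obtain f g where f: "square_integrable f" "u = abs_l2 f" and g: "square_integrable g" "v = abs_l2 g"
    by (metis l2_cases)
  show "prim_l2 (u + v) = prim_l2 u + prim_l2 v"
    using f g unfolding f g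
    by (auto simp: abs_l2_add prim_l2_abs square_integrable_add square_integrable_primitive
      square_integrable_integrable_on
      intro!: abs_l2_cong Henstock_Kurzweil_Integration.integral_add)
  show "prim_l2 (c *\<^sub>R u) = c *\<^sub>R prim_l2 u"
    using f unfolding f
    by (simp add: abs_l2_scaleR prim_l2_abs square_integrable_scale square_integrable_primitive)
qed

text \<open>The bridge from absolutely continuous functions to classes: an identity between elements
  of \<open>l2\<close> still remembers the value \<open>F 0\<close>.\<close>

lemma primitive_on_abs_l2:
  assumes "square_integrable f" "\<And>x. x \<in> {0..1} \<Longrightarrow> F x = F 0 + integral {0..x} f"
  shows "abs_l2 F = F 0 *\<^sub>R one_l2 + prim_l2 (abs_l2 f)" "primitive_on 0 1 F f" "square_integrable F"
proof -
  show p: "primitive_on 0 1 F f"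
    unfolding primitive_on_def
    using assms by (blast intro: square_integrable_absolutely_integrable)
  show F: "square_integrable F"
    using primitive_on_continuous[OF p] by (rule square_integrable_continuous)
  have "F 0 *\<^sub>R one_l2 + prim_l2 (abs_l2 f) = abs_l2 (\<lambda>x. F 0 + integral {0..x} f)"
    by (simp add: scaleR_one_l2 prim_l2_abs assms(1) abs_l2_add square_integrable_const square_integrable_primitive)
  also have "\<dots> = abs_l2 F"
    by (intro abs_l2_cong square_integrable_add square_integrable_const square_integrable_primitive assms(1))
       (metis assms(2))
  finally show "abs_l2 F = F 0 *\<^sub>R one_l2 + prim_l2 (abs_l2 f)" ..
qed

text \<open>Integration by parts: \<open>c\<close> and \<open>e\<close> are the values of the two
  primitives at 0, the sums with \<open>inner one_l2\<close> their values at 1. All boundary terms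
  below come from this identity.\<close>

lemma prim_l2_parts:
  "inner (c *\<^sub>R one_l2 + prim_l2 f) g + inner f (e *\<^sub>R one_l2 + prim_l2 g)
    = (c + inner one_l2 f) * (e + inner one_l2 g) - c * e"
proof -
  obtain f' g' where f: "square_integrable f'" "f = abs_l2 f'" and g: "square_integrable g'" "g = abs_l2 g'"
    by (metis l2_cases)
  define F where "F x = c + integral {0..x} f'" for x
  define G where "G x = e + integral {0..x} g'" for x
  have F0: "F 0 = c" "G 0 = e" by (simp_all add: F_def G_def)
  have F1: "F 1 = c + inner one_l2 f" "G 1 = e + inner one_l2 g"
    using f g by (simp_all add: F_def G_def inner_one_l2)
  have F: "abs_l2 F = c *\<^sub>R one_l2 + prim_l2 f" "primitive_on 0 1 F f'" "square_integrable F"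
    using primitive_on_abs_l2[OF f(1), of F] F0 f by (simp_all add: F_def)
  have G: "abs_l2 G = e *\<^sub>R one_l2 + prim_l2 g" "primitive_on 0 1 G g'" "square_integrable G"
    using primitive_on_abs_l2[OF g(1), of G] F0 g by (simp_all add: G_def)
  note fi = square_integrable_mult_absolutely_integrable[THEN absolutely_integrable_imp_integrable]
  have "inner (c *\<^sub>R one_l2 + prim_l2 f) g + inner f (e *\<^sub>R one_l2 + prim_l2 g)
    = integral {0..1} (\<lambda>x. F x * g' x) + integral {0..1} (\<lambda>x. f' x * G x)"
    unfolding F(1)[symmetric] G(1)[symmetric]
    unfolding f(2) g(2) by (simp add: inner_abs_l2 F(3) G(3) f(1) g(1))
  also have "\<dots> = integral {0..1} (\<lambda>x. f' x * G x + F x * g' x)"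
    by (subst Henstock_Kurzweil_Integration.integral_add) (auto intro!: fi F G f(1) g(1))
  also have "\<dots> = F 1 * G 1 - F 0 * G 0"
    using primitive_on_diff[OF primitive_on_mult[OF F(2) G(2)], of 0 1] by (simp only: order_refl zero_le_one)
  finally show ?thesis by (simp only: F0 F1)
qed

subsection \<open>Test functions\<close>

definition smooth :: "(real \<Rightarrow> real) \<Rightarrow> bool"
  where "smooth \<phi> \<longleftrightarrow> (\<forall>k. (deriv ^^ k) \<phi> differentiable_on UNIV)"

lemma smooth_DERIV: "smooth \<phi> \<Longrightarrow> (\<phi> has_real_derivative deriv \<phi> x) (at x)"
  unfolding smooth_def
  by (metis DERIV_deriv_iff_real_differentiable UNIV_I differentiable_on_def funpow_0)

text \<open>Spares formulas for higher derivatives: it is enough to exhibit a class of functions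
  closed under a single differentiation.\<close>

lemma smooth_coinduct:
  assumes "\<phi> \<in> C" "\<And>g. g \<in> C \<Longrightarrow> \<exists>g'\<in>C. \<forall>x. (g has_real_derivative g' x) (at x)"
  shows "smooth \<phi>"
proof -
  have der: "deriv g \<in> C \<and> g differentiable_on UNIV" if gC: "g \<in> C" for g
  proof -
    obtain g' where g': "g' \<in> C" "\<And>x. (g has_real_derivative g' x) (at x)"
      using assms(2)[OF gC] by blast
    then have "deriv g = g'" by (auto simp: DERIV_imp_deriv)
    then show ?thesis using g' by (auto simp: differentiable_on_def real_differentiable_def)
  qed
  have "(deriv ^^ k) \<phi> \<in> C" for k
    by (induction k) (auto simp: assms(1) der)
  then show ?thesis using der by (auto simp: smooth_def)
qed

lemma smooth_deriv: "smooth \<phi> \<Longrightarrow> smooth (deriv \<phi>)"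
  unfolding smooth_def by (metis funpow_Suc_right o_apply)

lemma smooth_primitive:
  assumes "smooth \<phi>" "\<And>x. (\<psi> has_real_derivative \<phi> x) (at x)"
  shows "smooth \<psi>"
proof (rule smooth_coinduct[where C = "insert \<psi> {g. smooth g}"])
  fix g assume "g \<in> insert \<psi> {g. smooth g}"
  then show "\<exists>g'\<in>insert \<psi> {g. smooth g}. \<forall>x. (g has_real_derivative g' x) (at x)"
    using assms smooth_DERIV smooth_deriv by blast
qed simp

lemma smooth_add_cmult:
  assumes "smooth \<phi>" "smooth \<psi>"
  shows "smooth (\<lambda>x. \<phi> x + c * \<psi> x)"
proof (rule smooth_coinduct[where C = "{\<lambda>x. \<phi> x + c * \<psi> x |\<phi> \<psi>. smooth \<phi> \<and> smooth \<psi>}"])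
  fix g assume "g \<in> {\<lambda>x. \<phi> x + c * \<psi> x |\<phi> \<psi>. smooth \<phi> \<and> smooth \<psi>}"
  then obtain \<phi> \<psi> where g: "g = (\<lambda>x. \<phi> x + c * \<psi> x)" "smooth \<phi>" "smooth \<psi>" by blast
  then have "(g has_real_derivative deriv \<phi> x + c * deriv \<psi> x) (at x)" for x
    by (auto intro!: derivative_eq_intros smooth_DERIV)
  moreover have "(\<lambda>x. deriv \<phi> x + c * deriv \<psi> x) \<in> {\<lambda>x. \<phi> x + c * \<psi> x |\<phi> \<psi>. smooth \<phi> \<and> smooth \<psi>}"
    using smooth_deriv[OF g(2)] smooth_deriv[OF g(3)] by auto
  ultimately show "\<exists>g'\<in>{\<lambda>x. \<phi> x + c * \<psi> x |\<phi> \<psi>. smooth \<phi> \<and> smooth \<psi>}. \<forall>x. (g has_real_derivative g' x) (at x)"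
    by (intro bexI[of _ "\<lambda>x. deriv \<phi> x + c * deriv \<psi> x"] allI)
next
  show "(\<lambda>x. \<phi> x + c * \<psi> x) \<in> {\<lambda>x. \<phi> x + c * \<psi> x |\<phi> \<psi>. smooth \<phi> \<and> smooth \<psi>}"
    using assms by auto
qed

lemma test_function_iff:
  "test_function \<phi> \<longleftrightarrow> smooth \<phi> \<and> (\<exists>a b. 0 < a \<and> b < 1 \<and> (\<forall>x. x \<notin> {a..b} \<longrightarrow> \<phi> x = 0))"
  by (simp add: test_function_def smooth_def)

lemma test_functionI:
  assumes "smooth \<phi>" "0 < a" "b < 1" "\<And>x. x \<notin> {a..b} \<Longrightarrow> \<phi> x = 0"
  shows "test_function \<phi>"
  unfolding test_function_iff using assms by blast

lemma test_function_deriv: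
  assumes "test_function \<phi>"
  shows "test_function (deriv \<phi>)"
proof -
  obtain a b where ab: "0 < a" "b < 1" "\<And>x. x \<notin> {a..b} \<Longrightarrow> \<phi> x = 0" and s: "smooth \<phi>"
    using assms by (auto simp: test_function_iff)
  have "deriv \<phi> x = 0" if x: "x \<notin> {a..b}" for x
  proof -
    have "(\<phi> has_real_derivative 0) (at x)"
    proof (rule has_field_derivative_transform_within_open[of "\<lambda>_. 0"])
      show "open (- {a..b})" by (intro open_Compl closed_real_atLeastAtMost)
      show "\<And>y. y \<in> - {a..b} \<Longrightarrow> 0 = \<phi> y" using ab by simp
    qed (use x in auto)
    then show ?thesis by (rule DERIV_imp_deriv)
  qed
  then show ?thesis using ab s smooth_deriv by (auto simp: test_function_iff)
qed

lemma test_function_deriv_pow: "test_function \<phi> \<Longrightarrow> test_function ((deriv ^^ k) \<phi>)"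
  by (induction k) (auto simp: test_function_deriv)

lemma test_function_add_cmult:
  assumes "test_function \<phi>" "test_function \<psi>"
  shows "test_function (\<lambda>x. \<phi> x + c * \<psi> x)"
proof -
  obtain a b a' b' where ab: "0 < a" "b < 1" "\<And>x. x \<notin> {a..b} \<Longrightarrow> \<phi> x = 0"
      "0 < a'" "b' < 1" "\<And>x. x \<notin> {a'..b'} \<Longrightarrow> \<psi> x = 0" and s: "smooth \<phi>" "smooth \<psi>"
    using assms by (auto simp: test_function_iff)
  have "\<phi> x + c * \<psi> x = 0" if "x \<notin> {min a a'..max b b'}" for x
  proof -
    have "x \<notin> {a..b}" "x \<notin> {a'..b'}" using that by auto
    then show ?thesis using ab(3)[of x] ab(6)[of x] by (simp del: atLeastAtMost_iff)
  qed
  moreover have "0 < min a a'" "max b b' < 1" using ab by auto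
  ultimately show ?thesis using smooth_add_cmult[OF s] test_functionI by blast
qed

lemma test_function_continuous: "test_function \<phi> \<Longrightarrow> continuous_on S \<phi>"
  using smooth_DERIV by (meson DERIV_isCont continuous_at_imp_continuous_on test_function_iff)

lemma test_function_square_integrable: "test_function \<phi> \<Longrightarrow> square_integrable \<phi>"
  by (intro square_integrable_continuous test_function_continuous)

text \<open>The integral is the only obstruction: the primitive is 0 to the left of the support and
  is 0 again to its right.\<close>

lemma test_function_primitive:
  assumes t: "test_function \<phi>" and zero: "integral {0..1} \<phi> = 0"
  obtains \<psi> where "test_function \<psi>" "deriv \<psi> = \<phi>"
proof -
  obtain a b where ab: "0 < a" "b < 1" "\<And>x. x \<notin> {a..b} \<Longrightarrow> \<phi> x = 0" and s: "smooth \<phi>"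
    using t by (auto simp: test_function_iff)
  have c: "continuous_on S \<phi>" for S using t by (rule test_function_continuous)
  \<comment> \<open>The base point is left of 0, so that the derivative of the integral is two-sided
    at every \<open>x\<close> from 0 on.\<close>
  define \<psi> where "\<psi> x = integral {-1..x} \<phi>" for x
  have z0: "\<psi> x = 0" if "x < a" for x
  proof -
    have "\<psi> x = integral {-1..x} (\<lambda>_. 0)"
      unfolding \<psi>_def using ab(3) that by (intro Henstock_Kurzweil_Integration.integral_cong) auto
    then show ?thesis by simp
  qed
  have z1: "\<psi> x = 0" if "x > b" for x
  proof (cases "x < 0")
    case True then show ?thesis using z0 ab by simp
  next
    case False
    \<comment> \<open>The end point \<open>max x 1\<close> treats \<open>x\<close> to the left and
      to the right of 1 together; between \<open>b\<close> and it there is nothing to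
      integrate.\<close>
    have spl: "\<psi> (max x 1) = \<psi> y + integral {y..max x 1} \<phi>" if "0 \<le> y" "y \<le> max x 1" for y
      unfolding \<psi>_def using that
      by (intro Henstock_Kurzweil_Integration.integral_combine[symmetric] integrable_continuous_real c) auto
    have "\<psi> 1 = \<psi> 0 + integral {0..1} \<phi>"
      unfolding \<psi>_def
      by (intro Henstock_Kurzweil_Integration.integral_combine[symmetric] integrable_continuous_real c) auto
    then have p1: "\<psi> 1 = 0" using zero z0[of 0] ab by simp
    have zi: "integral {y..max x 1} \<phi> = 0" if "y > b" for y
    proof -
      have "integral {y..max x 1} \<phi> = integral {y..max x 1} (\<lambda>_. 0)"
        using ab(3) that by (intro Henstock_Kurzweil_Integration.integral_cong) auto
      then show ?thesis by simp
    qed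
    show ?thesis using spl[of x] spl[of 1] zi[of x] zi[of 1] p1 ab that False by simp
  qed
  have d: "(\<psi> has_real_derivative \<phi> x) (at x)" for x
  proof (cases "x < 0")
    case True
    have "(\<psi> has_real_derivative 0) (at x)"
      by (rule has_field_derivative_transform_within_open[of "\<lambda>_. 0" _ _ "{..<a}"]) (use z0 True ab in auto)
    then show ?thesis using ab True by simp
  next
    case False
    have "(\<psi> has_real_derivative \<phi> x) (at x within {-1..x+1})"
      unfolding \<psi>_def using False by (intro integral_has_real_derivative c) auto
    moreover have "at x within {-1..x+1} = at x"
      using False by (intro at_within_interior) auto
    ultimately show ?thesis by simp
  qed
  have "test_function \<psi>"
  proof (rule test_functionI)
    show "smooth \<psi>" using smooth_primitive[OF s d] .
    fix x assume "x \<notin> {a..b}"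
    then show "\<psi> x = 0" using z0[of x] z1[of x] by auto
  qed (use ab in auto)
  moreover have "deriv \<psi> = \<phi>" using d by (auto simp: DERIV_imp_deriv)
  ultimately show thesis using that by blast
qed

text \<open>All derivatives of \<open>exp (-1/x)\<close> on \<open>x > 0\<close> are of this form.\<close>

definition flat_exp :: "real poly \<Rightarrow> real \<Rightarrow> real"
  where "flat_exp p x = (if x > 0 then poly p (1 / x) * exp (- (1 / x)) else 0)"

lemma poly_exp_decay: "((\<lambda>y. poly p y * exp (- y)) \<longlongrightarrow> 0) at_top" for p :: "real poly"
proof -
  have "((\<lambda>y. \<Sum>i\<le>degree p. coeff p i * (y ^ i / exp y)) \<longlongrightarrow> (\<Sum>i\<le>degree p. coeff p i * 0)) at_top"
    by (intro tendsto_intros tendsto_power_div_exp_0)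
  moreover have "(\<Sum>i\<le>degree p. coeff p i * (y ^ i / exp y)) = poly p y * exp (- y)" for y
    by (simp add: poly_altdef sum_distrib_right exp_minus divide_inverse mult.assoc)
  ultimately show ?thesis by simp
qed

text \<open>With \<open>y = 1/x\<close> the derivative of \<open>p(y) exp(-y)\<close> is
  \<open>y^2 (p - p')(y) exp(-y)\<close>. At 0 the difference quotient from the right is
  \<open>y p(y) exp(-y)\<close>, which tends to 0 as \<open>y\<close> grows.\<close>

lemma flat_exp_DERIV:
  "(flat_exp p has_real_derivative flat_exp ([:0, 0, 1:] * (p - pderiv p)) x) (at x)"
proof (cases x "0 :: real" rule: linorder_cases)
  case less
  have "(flat_exp p has_real_derivative 0) (at x)"
    by (rule has_field_derivative_transform_within_open[of "\<lambda>_. 0" _ _ "{..<0}"]) (use less in \<open>auto simp: flat_exp_def\<close>)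
  then show ?thesis using less by (simp add: flat_exp_def)
next
  case greater
  have "((\<lambda>x. poly p (1 / x) * exp (- (1 / x))) has_real_derivative
      poly ([:0, 0, 1:] * (p - pderiv p)) (1 / x) * exp (- (1 / x))) (at x)"
    using greater by (auto intro!: derivative_eq_intros DERIV_chain2[OF poly_DERIV] simp: field_simps power2_eq_square)
  then have "(flat_exp p has_real_derivative
      poly ([:0, 0, 1:] * (p - pderiv p)) (1 / x) * exp (- (1 / x))) (at x)"
    by (rule has_field_derivative_transform_within_open[of _ _ _ "{0<..}"]) (use greater in \<open>auto simp: flat_exp_def\<close>)
  then show ?thesis using greater by (simp add: flat_exp_def)
next
  case equal
  have "((\<lambda>y. poly ([:0, 1:] * p) y * exp (- y)) \<longlongrightarrow> 0) at_top"
    by (rule poly_exp_decay)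
  then have "((\<lambda>h. poly ([:0, 1:] * p) (inverse h) * exp (- inverse h)) \<longlongrightarrow> 0) (at_right 0)"
    by (rule filterlim_compose) (rule filterlim_inverse_at_top_right)
  then have "((\<lambda>h. (flat_exp p (0 + h) - flat_exp p 0) / h) \<longlongrightarrow> 0) (at_right 0)"
    by (rule Lim_transform_eventually) (auto simp: eventually_at_filter flat_exp_def divide_inverse)
  moreover have "((\<lambda>h. (flat_exp p (0 + h) - flat_exp p 0) / h) \<longlongrightarrow> 0) (at_left 0)"
    by (rule Lim_transform_eventually[OF tendsto_const]) (auto simp: eventually_at_filter flat_exp_def)
  ultimately have "((\<lambda>h. (flat_exp p (0 + h) - flat_exp p 0) / h) \<longlongrightarrow> 0) (at 0)"
    by (simp add: filterlim_split_at)
  then show ?thesis using equal by (simp add: DERIV_def flat_exp_def)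
qed

text \<open>The class for \<open>smooth_coinduct\<close>. The product rule leads from one product to
  a combination of two, so combinations are included.\<close>

inductive_set flat_exp_products :: "real \<Rightarrow> real \<Rightarrow> real \<Rightarrow> (real \<Rightarrow> real) set" for n a b
  where prod: "(\<lambda>x. flat_exp p (n * (x - a)) * flat_exp q (n * (b - x))) \<in> flat_exp_products n a b"
  | add: "f \<in> flat_exp_products n a b \<Longrightarrow> g \<in> flat_exp_products n a b \<Longrightarrow> (\<lambda>x. f x + c * g x) \<in> flat_exp_products n a b"

lemma test_function_cutoff:
  assumes "0 < a" "b < 1" "n \<ge> 0"
  shows "test_function (\<lambda>x. flat_exp 1 (n * (x - a)) * flat_exp 1 (n * (b - x)))"
proof (rule test_functionI)
  show "smooth (\<lambda>x. flat_exp 1 (n * (x - a)) * flat_exp 1 (n * (b - x)))"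
  proof (rule smooth_coinduct[where C = "flat_exp_products n a b"])
    fix g assume "g \<in> flat_exp_products n a b"
    then show "\<exists>g'\<in>flat_exp_products n a b. \<forall>x. (g has_real_derivative g' x) (at x)"
    proof induction
      case (prod p q)
      define d where "d p = [:0, 0, 1:] * (p - pderiv p)" for p :: "real poly"
      \<comment> \<open>One inner derivative, \<open>n\<close>, is absorbed into the polynomial, the
        other, \<open>- n\<close>, becomes the coefficient in the form
        \<open>f x + c * g x\<close>.\<close>
      define A B where "A = (\<lambda>x. flat_exp (smult n (d p)) (n * (x - a)) * flat_exp q (n * (b - x)))"
        and "B = (\<lambda>x. flat_exp p (n * (x - a)) * flat_exp (d q) (n * (b - x)))"
      have "((\<lambda>x. flat_exp p (n * (x - a)) * flat_exp q (n * (b - x))) has_real_derivative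
         (A x + (- n) * B x)) (at x)" for x
        unfolding A_def B_def d_def
        by (rule derivative_eq_intros DERIV_chain2[OF flat_exp_DERIV] refl)+
           (simp add: flat_exp_def)
      moreover have "(\<lambda>x. A x + (- n) * B x) \<in> flat_exp_products n a b"
        unfolding A_def B_def by (intro flat_exp_products.intros)
      ultimately show ?case by (intro bexI[of _ "\<lambda>x. A x + (- n) * B x"] allI)
    next
      case (add f g c)
      then obtain f' g' where fg: "f' \<in> flat_exp_products n a b" "g' \<in> flat_exp_products n a b"
        "\<And>x. (f has_real_derivative f' x) (at x)" "\<And>x. (g has_real_derivative g' x) (at x)" by blast
      then have "((\<lambda>x. f x + c * g x) has_real_derivative f' x + c * g' x) (at x)" for x
        by (auto intro!: derivative_eq_intros)
      then show ?case
        using flat_exp_products.add[OF fg(1,2), of c]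
        by (intro bexI[of _ "\<lambda>x. f' x + c * g' x"] allI)
    qed
  qed (rule flat_exp_products.prod)
  fix x assume "x \<notin> {a..b}"
  then have "n * (x - a) \<le> 0 \<or> n * (b - x) \<le> 0"
    using assms(3) by (auto simp: mult_le_0_iff)
  then show "flat_exp 1 (n * (x - a)) * flat_exp 1 (n * (b - x)) = 0"
    by (auto simp: flat_exp_def)
qed (use assms in auto)

lemma flat_exp_one_bounds: "0 \<le> flat_exp 1 x" "flat_exp 1 x \<le> 1"
  by (auto simp: flat_exp_def)

text \<open>For \<open>y > 0\<close> the value is \<open>exp(-1/(n y))\<close>. Hence the cutoff
  functions tend boundedly to the indicator of an open interval.\<close>

lemma flat_exp_one_limit:
  "(\<lambda>n. flat_exp 1 (real n * y)) \<longlonglongrightarrow> (if y > 0 then 1 else 0)"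
proof (cases "y > 0")
  case True
  have "(\<lambda>n. exp (- (1 / y) * inverse (real n))) \<longlonglongrightarrow> exp (- (1 / y) * 0)"
    by (intro tendsto_intros lim_inverse_n)
  then have "(\<lambda>n. flat_exp 1 (real n * y)) \<longlonglongrightarrow> exp (- (1 / y) * 0)"
    by (rule Lim_transform_eventually)
       (use eventually_gt_at_top[of 0] in \<open>eventually_elim, use True in \<open>auto simp: flat_exp_def divide_inverse\<close>\<close>)
  then show ?thesis using True by simp
next
  case False
  then have "flat_exp 1 (real n * y) = 0" for n by (auto simp: flat_exp_def zero_less_mult_iff)
  then show ?thesis using False by simp
qed

text \<open>By dominated convergence along the cutoff functions, \<open>f\<close> has integral 0
  over every interval inside the open unit interval. Its primitive is thus constant there, by
  continuity also on the closed interval, and \<open>AE_zero_if_integrals_zero\<close>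
  applies.\<close>

lemma test_functions_separate:
  assumes "\<And>\<phi>. test_function \<phi> \<Longrightarrow> inner u (abs_l2 \<phi>) = 0"
  shows "u = 0"
proof -
  obtain f where f: "square_integrable f" "u = abs_l2 f" by (rule l2_cases)
  have fa: "f absolutely_integrable_on {0..1}" by (rule square_integrable_absolutely_integrable[OF f(1)])
  have zero: "integral {c..d} f = 0" if cd: "0 < c" "c \<le> d" "d < 1" for c d
  proof -
    define \<phi> where "\<phi> n x = flat_exp 1 (real n * (x - c)) * flat_exp 1 (real n * (d - x))" for n x
    have tf: "test_function (\<phi> n)" for n
      unfolding \<phi>_def[abs_def] by (rule test_function_cutoff) (use cd in auto)
    have int0: "integral {0..1} (\<lambda>x. f x * \<phi> n x) = 0" for n
      using assms[OF tf, of n] f by (simp add: inner_abs_l2 test_function_square_integrable[OF tf])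
    have "(\<lambda>n. integral {0..1} (\<lambda>x. f x * \<phi> n x)) \<longlonglongrightarrow> integral {0..1} (\<lambda>x. if x \<in> {c<..<d} then f x else 0)"
    proof (rule dominated_convergence(2))
      show "(\<lambda>x. f x * \<phi> n x) integrable_on {0..1}" for n
        by (intro absolutely_integrable_imp_integrable square_integrable_mult_absolutely_integrable f
            test_function_square_integrable tf)
      show "(\<lambda>x. \<bar>f x\<bar>) integrable_on {0..1}"
        by (intro absolutely_integrable_imp_integrable set_integrable_abs fa)
      show "norm (f x * \<phi> n x) \<le> \<bar>f x\<bar>" for n x
        using flat_exp_one_bounds unfolding \<phi>_def
        by (auto simp: abs_mult intro!: mult_left_le mult_le_one)
      show "(\<lambda>n. f x * \<phi> n x) \<longlonglongrightarrow> (if x \<in> {c<..<d} then f x else 0)" for x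
      proof -
        have "(\<lambda>n. f x * \<phi> n x) \<longlonglongrightarrow> f x * ((if x - c > 0 then 1 else 0) * (if d - x > 0 then 1 else 0))"
          unfolding \<phi>_def by (intro tendsto_intros flat_exp_one_limit)
        then show ?thesis by (auto split: if_splits)
      qed
    qed
    then have "integral {0..1} (\<lambda>x. if x \<in> {c<..<d} then f x else 0) = 0"
      by (simp add: int0 LIMSEQ_const_iff)
    moreover have "{c<..<d} \<inter> {0..1} = {c<..<d}" using cd by auto
    ultimately show ?thesis
      by (simp only: Henstock_Kurzweil_Integration.integral_restrict_Int integral_open_interval_real)
  qed
  define F where "F x = integral {0..x} f" for x
  have F: "primitive_on 0 1 F f" "continuous_on {0..1} F"
  proof -
    show "primitive_on 0 1 F f"
      by (rule primitive_on_abs_l2(2)[OF f(1)]) (simp add: F_def)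
    then show "continuous_on {0..1} F" by (rule primitive_on_continuous)
  qed
  have const: "F x = F (1/2)" if "x \<in> {0<..<1}" for x
  proof (cases "x \<le> 1/2")
    case True
    then show ?thesis using primitive_on_diff[OF F(1), of x "1/2"] zero[of x "1/2"] that by simp
  next
    case False
    then show ?thesis using primitive_on_diff[OF F(1), of "1/2" x] zero[of "1/2" x] that by simp
  qed
  have const': "F x = F (1/2)" if "x \<in> {0..1}" for x
  proof (rule continuous_constant_on_closure[of "{0<..<1}" F])
    show "continuous_on (closure {0<..<1}) F" "x \<in> closure {0<..<1}" using F(2) that by simp_all
  qed (rule const)
  have "AE x in lebesgue01. f x = 0"
  proof (rule AE_zero_if_integrals_zero[OF fa])
    fix c d :: real assume "0 \<le> c" "c \<le> d" "d \<le> 1"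
    then show "integral {c..d} f = 0"
      using primitive_on_diff[OF F(1), of c d] const'[of c] const'[of d] by simp
  qed
  then show ?thesis
    unfolding f(2) zero_l2.abs_eq by (simp add: abs_l2_eq_iff f(1) square_integrable_0)
qed

subsection \<open>Weak derivatives\<close>

lemma has_weak_deriv_iff:
  "has_weak_deriv k u v \<longleftrightarrow> (\<forall>\<phi>. test_function \<phi> \<longrightarrow>
     inner u (abs_l2 ((deriv ^^ k) \<phi>)) = (-1) ^ k * inner v (abs_l2 \<phi>))"
proof -
  obtain f g where f: "square_integrable f" "u = abs_l2 f" and g: "square_integrable g" "v = abs_l2 g"
    by (metis l2_cases)
  have eq: "inner (abs_l2 h) (abs_l2 \<phi>) = (LINT t|lebesgue01. h t * \<phi> t)"
    if "square_integrable h" "test_function \<phi>" for h \<phi>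
    using that by (simp add: inner_l2.abs_eq l2_rel_refl test_function_square_integrable)
  show ?thesis
    using f(1) g(1) unfolding f(2) g(2)
    by (simp add: has_weak_deriv.abs_eq l2_rel_refl eq test_function_deriv_pow)
qed

lemma has_weak_deriv_unique:
  assumes "has_weak_deriv k u v" "has_weak_deriv k u w"
  shows "v = w"
proof -
  have "v - w = 0"
    by (rule test_functions_separate) (use assms in \<open>auto simp: has_weak_deriv_iff inner_diff_left\<close>)
  then show ?thesis by simp
qed

lemma weak_deriv_eq: "has_weak_deriv k u v \<Longrightarrow> weak_deriv k u = v"
  unfolding weak_deriv_def by (blast intro: has_weak_deriv_unique)

lemma has_weak_deriv_0: "has_weak_deriv 0 u u"
  by (simp add: has_weak_deriv_iff)

lemma has_weak_deriv_Suc: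
  assumes "has_weak_deriv k u v" "has_weak_deriv 1 v w"
  shows "has_weak_deriv (Suc k) u w"
  using assms unfolding has_weak_deriv_iff
  by (auto simp: funpow_Suc_right test_function_deriv simp del: funpow.simps)

text \<open>\<open>sobolev\<close> supplies the derivatives of each order separately; testing the
  lower one with \<open>deriv \<phi>\<close> links neighbours by a derivative of first
  order.\<close>

lemma has_weak_deriv_1_if_Suc:
  assumes "has_weak_deriv k u v" "has_weak_deriv (Suc k) u w"
  shows "has_weak_deriv 1 v w"
  unfolding has_weak_deriv_iff
proof (intro allI impI)
  fix \<phi> assume t: "test_function \<phi>"
  have "(-1) ^ k * inner v (abs_l2 (deriv \<phi>)) = inner u (abs_l2 ((deriv ^^ Suc k) \<phi>))"
    using assms(1) test_function_deriv[OF t] by (simp add: has_weak_deriv_iff funpow_Suc_right del: funpow.simps)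
  also have "\<dots> = (-1) ^ Suc k * inner w (abs_l2 \<phi>)"
    using assms(2) t by (simp add: has_weak_deriv_iff)
  finally show "inner v (abs_l2 ((deriv ^^ 1) \<phi>)) = (-1) ^ 1 * inner w (abs_l2 \<phi>)"
    by (cases "even k") auto
qed

lemma test_function_prim_l2:
  assumes "test_function \<phi>"
  shows "abs_l2 \<phi> = 0 *\<^sub>R one_l2 + prim_l2 (abs_l2 (deriv \<phi>))" "inner one_l2 (abs_l2 (deriv \<phi>)) = 0"
proof -
  have s: "smooth \<phi>" and z: "\<phi> 0 = 0" "\<phi> 1 = 0"
    using assms by (auto simp: test_function_iff)
  have d: "test_function (deriv \<phi>)" using assms by (rule test_function_deriv)
  have p: "primitive_on 0 1 \<phi> (deriv \<phi>)"
    using smooth_DERIV[OF s] test_function_continuous[OF d]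
    by (intro primitive_on_derivative) (auto intro: has_field_derivative_at_within)
  show "abs_l2 \<phi> = 0 *\<^sub>R one_l2 + prim_l2 (abs_l2 (deriv \<phi>))"
    using primitive_on_abs_l2(1)[OF test_function_square_integrable[OF d] primitive_onD(2)[OF p]] z by simp
  show "inner one_l2 (abs_l2 (deriv \<phi>)) = 0"
    using primitive_on_diff[OF p, of 0 1] z by (simp add: inner_one_l2 test_function_square_integrable[OF d])
qed

text \<open>A test function is a primitive with value 0 at both ends, so integration by parts leaves
  no boundary term.\<close>

lemma has_weak_deriv_prim_l2: "has_weak_deriv 1 (c *\<^sub>R one_l2 + prim_l2 v) v"
  unfolding has_weak_deriv_iff
proof (intro allI impI)
  fix \<phi> assume "test_function \<phi>"
  then show "inner (c *\<^sub>R one_l2 + prim_l2 v) (abs_l2 ((deriv ^^ 1) \<phi>)) = (- 1) ^ 1 * inner v (abs_l2 \<phi>)"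
    using prim_l2_parts[of c v "abs_l2 (deriv \<phi>)" 0] test_function_prim_l2[of \<phi>] by simp
qed

text \<open>The du Bois-Reymond lemma: subtracting a multiple of a fixed test function of integral
  one turns every test function into the derivative of a test function.\<close>

lemma has_weak_deriv_imp_prim_l2:
  assumes "has_weak_deriv 1 u v"
  shows "\<exists>c. u = c *\<^sub>R one_l2 + prim_l2 v"
proof -
  have "one_l2 \<noteq> 0"
  proof
    assume "one_l2 = 0"
    then show False using inner_one_one by simp
  qed
  \<comment> \<open>Test functions separate \<open>one_l2\<close> from 0, which yields one of
    nonzero integral; testing with it then fixes the constant \<open>c\<close>.\<close>
  then obtain \<eta> where \<eta>: "test_function \<eta>" "inner one_l2 (abs_l2 \<eta>) \<noteq> 0"
    using test_functions_separate by blast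
  define h where "h = u - prim_l2 v"
  define c where "c = inner h (abs_l2 \<eta>) / inner one_l2 (abs_l2 \<eta>)"
  have hd: "inner h (abs_l2 (deriv \<psi>)) = 0" if "test_function \<psi>" for \<psi>
    using assms has_weak_deriv_prim_l2[of 0 v] that by (auto simp: h_def has_weak_deriv_iff inner_diff_left)
  have "h - c *\<^sub>R one_l2 = 0"
  proof (rule test_functions_separate)
    fix \<phi> assume \<phi>: "test_function \<phi>"
    define k where "k = - (inner one_l2 (abs_l2 \<phi>) / inner one_l2 (abs_l2 \<eta>))"
    have t: "test_function (\<lambda>x. \<phi> x + k * \<eta> x)" by (intro test_function_add_cmult \<phi> \<eta>)
    have e: "abs_l2 (\<lambda>x. \<phi> x + k * \<eta> x) = abs_l2 \<phi> + k *\<^sub>R abs_l2 \<eta>"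
      using \<phi> \<eta>(1) by (simp add: abs_l2_scaleR abs_l2_add test_function_square_integrable square_integrable_scale)
    have "integral {0..1} (\<lambda>x. \<phi> x + k * \<eta> x) = inner one_l2 (abs_l2 (\<lambda>x. \<phi> x + k * \<eta> x))"
      by (simp add: inner_one_l2 test_function_square_integrable[OF t])
    also have "\<dots> = 0" using \<eta>(2) unfolding e by (simp add: inner_diff_right k_def)
    finally obtain \<psi> where \<psi>: "test_function \<psi>" "deriv \<psi> = (\<lambda>x. \<phi> x + k * \<eta> x)"
      by (rule test_function_primitive[OF t])
    have "inner h (abs_l2 \<phi> + k *\<^sub>R abs_l2 \<eta>) = 0" using hd[OF \<psi>(1)] \<psi>(2) e by simp
    then show "inner (h - c *\<^sub>R one_l2) (abs_l2 \<phi>) = 0"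
      using \<eta>(2) by (simp add: inner_diff_right inner_diff_left k_def c_def field_simps)
  qed
  then have "u = c *\<^sub>R one_l2 + prim_l2 v" by (simp add: h_def algebra_simps)
  then show ?thesis ..
qed

text \<open>Makes the choice in \<open>continuous_rep\<close> harmless: two continuous
  representatives differ by a continuous function whose square has integral 0.\<close>

lemma continuous_rep_eq:
  assumes g: "continuous_on {0..1} g" and x: "x \<in> {0..1}"
  shows "continuous_rep (abs_l2 g) x = g x"
proof -
  define h where "h = continuous_rep (abs_l2 g)"
  have h: "continuous_on {0..1} h \<and> abs_l2 h = abs_l2 g"
    unfolding h_def continuous_rep_def by (rule someI[where x = g]) (use g in simp)
  have s: "square_integrable (\<lambda>t. h t - g t)"
    by (intro square_integrable_continuous continuous_intros) (use g h in auto)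
  have "abs_l2 (\<lambda>t. h t - g t) = abs_l2 h - abs_l2 g"
    using abs_l2_diff[of h g] g h by (simp only: square_integrable_continuous)
  then have "abs_l2 (\<lambda>t. h t - g t) = 0" using h by simp
  then have "integral {0..1} (\<lambda>t. (h t - g t)\<^sup>2) = 0"
    using norm_abs_l2[OF s] by simp
  moreover have "continuous_on {0..1} (\<lambda>t. (h t - g t)\<^sup>2)"
    using g h by (intro continuous_intros) auto
  ultimately have "(h x - g x)\<^sup>2 = 0"
    using integral_eq_0_iff[of 0 1 "\<lambda>t. (h t - g t)\<^sup>2"] x by simp
  then show ?thesis by (simp add: h_def)
qed

lemma continuous_rep_prim_l2:
  "continuous_rep (c *\<^sub>R one_l2 + prim_l2 v) 0 = c"
  "continuous_rep (c *\<^sub>R one_l2 + prim_l2 v) 1 = c + inner one_l2 v"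
proof -
  obtain f where f: "square_integrable f" "v = abs_l2 f" by (rule l2_cases)
  define F where "F x = c + integral {0..x} f" for x
  have F: "abs_l2 F = c *\<^sub>R one_l2 + prim_l2 v" "primitive_on 0 1 F f"
    using primitive_on_abs_l2(1,2)[OF f(1), of F] by (simp_all add: F_def f)
  show "continuous_rep (c *\<^sub>R one_l2 + prim_l2 v) 0 = c"
    "continuous_rep (c *\<^sub>R one_l2 + prim_l2 v) 1 = c + inner one_l2 v"
    using continuous_rep_eq[OF primitive_on_continuous[OF F(2)], of 0]
      continuous_rep_eq[OF primitive_on_continuous[OF F(2)], of 1]
    unfolding F(1)[symmetric] by (simp_all add: F_def inner_one_l2 f)
qed


subsection \<open>Boundary conditions\<close>

text \<open>With \<open>a\<close> (resp.\ \<open>b\<close>) the derivatives of even order vanish at 0 (resp.\ 1), otherwise those of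
  odd order. Differentiation negates both flags.\<close>

definition bc_deriv :: "bool \<Rightarrow> bool \<Rightarrow> l2 \<Rightarrow> l2 \<Rightarrow> bool"
  where "bc_deriv a b u f \<longleftrightarrow>
    (\<exists>c. u = c *\<^sub>R one_l2 + prim_l2 f \<and> (a \<longrightarrow> c = 0) \<and> (b \<longrightarrow> c + inner one_l2 f = 0))"

text \<open>\<open>U\<close> is the chain of successive derivatives;
  \<open>a \<longleftrightarrow> even k\<close> is the flag \<open>a\<close> after \<open>k\<close>
  negations.\<close>

definition bc_derivs :: "nat \<Rightarrow> bool \<Rightarrow> bool \<Rightarrow> l2 \<Rightarrow> l2 \<Rightarrow> bool"
  where "bc_derivs r a b u g \<longleftrightarrow> (\<exists>U :: nat \<Rightarrow> l2. U 0 = u \<and> U r = g \<and>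
    (\<forall>k<r. bc_deriv (a \<longleftrightarrow> even k) (b \<longleftrightarrow> even k) (U k) (U (Suc k))))"

lemma bc_derivs_0: "bc_derivs 0 a b u g \<longleftrightarrow> u = g"
  by (auto simp: bc_derivs_def)

text \<open>Peels off the lowest derivative, so that an induction on the order continues with the
  swapped type of boundary conditions.\<close>

lemma bc_derivs_Suc: "bc_derivs (Suc r) a b u g \<longleftrightarrow> (\<exists>f. bc_deriv a b u f \<and> bc_derivs r (\<not> a) (\<not> b) f g)"
proof
  assume "bc_derivs (Suc r) a b u g"
  then obtain U where U: "U 0 = u" "U (Suc r) = g"
    "\<And>k. k < Suc r \<Longrightarrow> bc_deriv (a \<longleftrightarrow> even k) (b \<longleftrightarrow> even k) (U k) (U (Suc k))"
    unfolding bc_derivs_def by blast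
  have "bc_derivs r (\<not> a) (\<not> b) (U 1) g"
    unfolding bc_derivs_def
  proof (intro exI[of _ "\<lambda>k. U (Suc k)"] conjI allI impI)
    fix k assume "k < r"
    then show "bc_deriv ((\<not> a) \<longleftrightarrow> even k) ((\<not> b) \<longleftrightarrow> even k) (U (Suc k)) (U (Suc (Suc k)))"
      using U(3)[of "Suc k"] by (cases a; cases b) auto
  qed (use U in simp_all)
  then show "\<exists>f. bc_deriv a b u f \<and> bc_derivs r (\<not> a) (\<not> b) f g"
    using U(1) U(3)[of 0] by auto
next
  assume "\<exists>f. bc_deriv a b u f \<and> bc_derivs r (\<not> a) (\<not> b) f g"
  then obtain f U where f: "bc_deriv a b u f" and U: "U 0 = f" "U r = g"
    "\<And>k. k < r \<Longrightarrow> bc_deriv ((\<not> a) \<longleftrightarrow> even k) ((\<not> b) \<longleftrightarrow> even k) (U k) (U (Suc k))"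
    unfolding bc_derivs_def by blast
  show "bc_derivs (Suc r) a b u g"
    unfolding bc_derivs_def
  proof (intro exI[of _ "case_nat u U"] conjI allI impI)
    fix k assume "k < Suc r"
    then show "bc_deriv (a \<longleftrightarrow> even k) (b \<longleftrightarrow> even k) (case_nat u U k) (case_nat u U (Suc k))"
      using f U(1) U(3)[of "k - 1"] by (cases k; cases a; cases b) auto
  qed (use U in simp_all)
qed

lemma bc_derivs_add_scaleR:
  assumes "bc_derivs r a b u g" "bc_derivs r a b v h"
  shows "bc_derivs r a b (u + c *\<^sub>R v) (g + c *\<^sub>R h)"
proof -
  obtain U V where U: "U 0 = u" "U r = g"
      "\<And>k. k < r \<Longrightarrow> bc_deriv (a \<longleftrightarrow> even k) (b \<longleftrightarrow> even k) (U k) (U (Suc k))"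
    and V: "V 0 = v" "V r = h"
      "\<And>k. k < r \<Longrightarrow> bc_deriv (a \<longleftrightarrow> even k) (b \<longleftrightarrow> even k) (V k) (V (Suc k))"
    using assms unfolding bc_derivs_def by blast
  have lin: "bc_deriv a b (u + c *\<^sub>R v) (g + c *\<^sub>R h)" if uv: "bc_deriv a b u g" "bc_deriv a b v h" for a b u g v h
  proof -
    obtain x y where "u = x *\<^sub>R one_l2 + prim_l2 g" "a \<longrightarrow> x = 0" "b \<longrightarrow> x + inner one_l2 g = 0"
      "v = y *\<^sub>R one_l2 + prim_l2 h" "a \<longrightarrow> y = 0" "b \<longrightarrow> y + inner one_l2 h = 0"
      using uv unfolding bc_deriv_def by blast
    moreover have "b \<longrightarrow> x + c * y + (inner one_l2 g + c * inner one_l2 h)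
        = (x + inner one_l2 g) + c * (y + inner one_l2 h)"
      by (simp add: algebra_simps)
    ultimately show ?thesis
      unfolding bc_deriv_def
      by (intro exI[of _ "x + c * y"])
         (auto simp: linear_add[OF linear_prim_l2] linear_scale[OF linear_prim_l2] inner_add_right algebra_simps)
  qed
  show ?thesis
    unfolding bc_derivs_def
    using U V lin by (intro exI[of _ "\<lambda>k. U k + c *\<^sub>R V k"]) auto
qed

lemma left_order_iff: "left_order i k \<longleftrightarrow> ((i \<noteq> 1) \<longleftrightarrow> even k)"
  by (auto simp: left_order_def)

lemma right_order_iff: "right_order i k \<longleftrightarrow> ((i = 0) \<longleftrightarrow> even k)"
  by (auto simp: right_order_def)

text \<open>From here on weak derivatives and continuous representatives are gone: by du
  Bois-Reymond each derivative in the chain is a constant plus the primitive of the next one, and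
  its boundary values can be read off.\<close>

lemma sobolev_bc_iff:
  "u \<in> sobolev_bc r i \<and> weak_deriv r u = g \<longleftrightarrow> bc_derivs r (i \<noteq> 1) (i = 0) u g"
proof
  assume "u \<in> sobolev_bc r i \<and> weak_deriv r u = g"
  then have s: "u \<in> sobolev r" and g: "weak_deriv r u = g"
    and bc0: "\<And>k. k < r \<Longrightarrow> left_order i k \<Longrightarrow> continuous_rep (weak_deriv k u) 0 = 0"
    and bc1: "\<And>k. k < r \<Longrightarrow> right_order i k \<Longrightarrow> continuous_rep (weak_deriv k u) 1 = 0"
    by (auto simp: sobolev_bc_def)
  have w: "has_weak_deriv k u (weak_deriv k u)" if k: "k \<le> r" for k
  proof (cases k)
    case 0 then show ?thesis using weak_deriv_eq[OF has_weak_deriv_0] has_weak_deriv_0 by simp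
  next
    case (Suc j)
    then obtain v where "has_weak_deriv k u v" using s k by (fastforce simp: sobolev_def)
    then show ?thesis using weak_deriv_eq by auto
  qed
  show "bc_derivs r (i \<noteq> 1) (i = 0) u g"
    unfolding bc_derivs_def
  proof (intro exI[of _ "\<lambda>k. weak_deriv k u"] conjI allI impI)
    show "weak_deriv 0 u = u" by (rule weak_deriv_eq[OF has_weak_deriv_0])
    show "weak_deriv r u = g" by fact
    fix k assume k: "k < r"
    have "has_weak_deriv 1 (weak_deriv k u) (weak_deriv (Suc k) u)"
      using has_weak_deriv_1_if_Suc[OF w w] k by simp
    then obtain c where c: "weak_deriv k u = c *\<^sub>R one_l2 + prim_l2 (weak_deriv (Suc k) u)"
      using has_weak_deriv_imp_prim_l2 by blast
    show "bc_deriv ((i \<noteq> 1) \<longleftrightarrow> even k) ((i = 0) \<longleftrightarrow> even k) (weak_deriv k u) (weak_deriv (Suc k) u)"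
      unfolding bc_deriv_def using c bc0[OF k] bc1[OF k] continuous_rep_prim_l2[of c "weak_deriv (Suc k) u"]
      by (intro exI[of _ c]) (simp add: left_order_iff right_order_iff)
  qed
next
  assume "bc_derivs r (i \<noteq> 1) (i = 0) u g"
  then obtain U where U: "U 0 = u" "U r = g"
      "\<And>k. k < r \<Longrightarrow> bc_deriv ((i \<noteq> 1) \<longleftrightarrow> even k) ((i = 0) \<longleftrightarrow> even k) (U k) (U (Suc k))"
    unfolding bc_derivs_def by blast
  have w: "has_weak_deriv k u (U k)" if "k \<le> r" for k
    using that
  proof (induction k)
    case 0 then show ?case by (simp add: U has_weak_deriv_0)
  next
    case (Suc k)
    then obtain c where "U k = c *\<^sub>R one_l2 + prim_l2 (U (Suc k))"
      using U(3)[of k] by (auto simp: bc_deriv_def)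
    then have "has_weak_deriv 1 (U k) (U (Suc k))" using has_weak_deriv_prim_l2 by metis
    then show ?case using Suc has_weak_deriv_Suc by simp
  qed
  have wd: "weak_deriv k u = U k" if "k \<le> r" for k using weak_deriv_eq[OF w[OF that]] .
  have "continuous_rep (U k) 0 = 0" if "k < r" "left_order i k" for k
    using U(3)[OF that(1)] that(2) continuous_rep_prim_l2(1)
    unfolding bc_deriv_def left_order_iff by metis
  moreover have "continuous_rep (U k) 1 = 0" if "k < r" "right_order i k" for k
    using U(3)[OF that(1)] that(2) continuous_rep_prim_l2(2)
    unfolding bc_deriv_def right_order_iff by metis
  moreover have "u \<in> sobolev r" unfolding sobolev_def using w by fastforce
  ultimately show "u \<in> sobolev_bc r i \<and> weak_deriv r u = g"
    using wd U(2) by (simp add: sobolev_bc_def)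
qed

lemma fun_class_iff:
  "u \<in> fun_class r i \<longleftrightarrow> (\<exists>g. bc_derivs r (i \<noteq> 1) (i = 0) u g \<and> norm g \<le> 1)"
  unfolding fun_class_def mem_Collect_eq by (metis sobolev_bc_iff)

section \<open>Orthogonal projection and the duality step\<close>

lemma finite_span_projection:
  fixes B :: "'a::real_inner set"
  assumes "finite B"
  obtains P where "linear P" "\<And>x. P x \<in> span B" "\<And>x y. y \<in> span B \<Longrightarrow> inner (x - P x) y = 0"
proof -
  obtain C where C: "finite C" "span C = span B" "pairwise orthogonal C"
    using basis_orthogonal[OF assms] by blast
  \<comment> \<open>A zero vector in \<open>C\<close> does no harm: its coefficient is a division by
    zero, hence 0.\<close>
  define P where "P x = (\<Sum>c\<in>C. (inner x c / inner c c) *\<^sub>R c)" for x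
  have "linear P"
    by (rule linearI)
       (simp_all add: P_def inner_add_left add_divide_distrib scaleR_add_left sum.distrib scaleR_sum_right)
  moreover have "P x \<in> span B" for x
    unfolding P_def C(2)[symmetric] by (intro span_sum span_scale span_base)
  moreover have "inner (x - P x) y = 0" if "y \<in> span B" for x y
  proof -
    have "y \<in> span C" using that C by simp
    then show ?thesis
    proof (induction rule: span_induct_alt)
      case (step a c y)
      have "inner (P x) c = (\<Sum>d\<in>C. if d = c then inner x c else 0)"
        unfolding P_def inner_sum_left
      proof (rule sum.cong[OF refl])
        fix d assume "d \<in> C"
        then show "inner ((inner x d / inner d d) *\<^sub>R d) c = (if d = c then inner x c else 0)"
          using C(3) step(1) by (auto simp: pairwise_def orthogonal_def)
      qed
      also have "\<dots> = inner x c" using C(1) step(1) by simp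
      finally show ?case using step by (simp add: inner_add_right inner_diff_left)
    qed simp
  qed
  ultimately show thesis using that by blast
qed

text \<open>The error \<open>w = u - t\<close> of the primitive \<open>t\<close> of the orthogonal projection of \<open>u'\<close> onto \<open>T\<close> satisfies
  \<open>\<parallel>w\<parallel>\<^sup>2 = - \<langle>w', W\<rangle>\<close> for a primitive \<open>W\<close> of \<open>w\<close> with the dual boundary conditions, and
  \<open>w'\<close> is orthogonal to \<open>T\<close>, so \<open>W\<close> may be replaced by its distance to \<open>T\<close>.\<close>

lemma bc_deriv_approximation:
  fixes \<sigma> :: real
  assumes B: "finite B" and one: "a \<Longrightarrow> b \<Longrightarrow> one_l2 \<in> span B"
    and approx: "\<And>w g. bc_deriv (\<not> a) (\<not> b) w g \<Longrightarrow> \<exists>y\<in>span B. norm (w - y) \<le> \<sigma> * norm g"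
    and \<sigma>: "\<sigma> \<ge> 0" and u: "bc_deriv a b u f" and y0: "y0 \<in> span B"
  shows "\<exists>t. (\<exists>p\<in>span B. bc_deriv a b t p) \<and> norm (u - t) \<le> \<sigma> * norm (f - y0)"
proof -
  obtain P where P: "linear P" "\<And>x. P x \<in> span B" "\<And>x y. y \<in> span B \<Longrightarrow> inner (x - P x) y = 0"
    by (rule finite_span_projection[OF B]) blast
  define g where "g = f - P f"
  have orth: "inner g y = 0" if "y \<in> span B" for y
    using P(3)[OF that] by (simp add: g_def)
  have g_le: "norm g \<le> norm (f - y0)"
  proof -
    have "inner g g = inner g (f - y0)"
      using orth[OF P(2)] orth[OF y0] by (simp add: g_def inner_diff_right)
    also have "\<dots> \<le> norm g * norm (f - y0)" by (rule norm_cauchy_schwarz)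
    finally have "norm g * norm g \<le> norm g * norm (f - y0)"
      by (simp add: power2_norm_eq_inner[symmetric] power2_eq_square)
    then show ?thesis by (cases "norm g = 0") auto
  qed
  obtain c where c: "u = c *\<^sub>R one_l2 + prim_l2 f" "a \<longrightarrow> c = 0" "b \<longrightarrow> c + inner one_l2 f = 0"
    using u unfolding bc_deriv_def by blast
  have split: "inner one_l2 f = inner one_l2 (P f) + inner one_l2 g" by (simp add: g_def inner_diff_right)
  \<comment> \<open>The constant of integration of \<open>t\<close>. Under two conditions it must be
    0, and the right end works because the projection keeps the mean of \<open>f\<close>,
    \<open>one_l2\<close> being in the span. One condition determines it. Under none it is free and
    is spent on making the error have mean zero.\<close>
  have "\<exists>e. (a \<longrightarrow> e = 0) \<and> (b \<longrightarrow> e + inner one_l2 (P f) = 0) \<and>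
      (\<not> a \<longrightarrow> \<not> b \<longrightarrow> inner one_l2 (u - (e *\<^sub>R one_l2 + prim_l2 (P f))) = 0)"
  proof (cases a; cases b)
    assume ab: a b
    then have "inner g one_l2 = 0" using orth[OF one] by simp
    then show ?thesis using ab c split by (intro exI[of _ 0]) (simp add: inner_commute)
  next
    assume "\<not> a" "\<not> b"
    then show ?thesis
      by (intro exI[of _ "inner one_l2 u - inner one_l2 (prim_l2 (P f))"])
         (simp add: inner_diff_right inner_add_right inner_one_one)
  qed (auto intro: exI[of _ 0] exI[of _ "- inner one_l2 (P f)"])
  then obtain e where e: "a \<longrightarrow> e = 0" "b \<longrightarrow> e + inner one_l2 (P f) = 0"
      "\<not> a \<Longrightarrow> \<not> b \<Longrightarrow> inner one_l2 (u - (e *\<^sub>R one_l2 + prim_l2 (P f))) = 0" by blast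
  define t where "t = e *\<^sub>R one_l2 + prim_l2 (P f)"
  define w where "w = u - t"
  have w: "w = (c - e) *\<^sub>R one_l2 + prim_l2 g"
    by (simp add: w_def t_def c g_def linear_diff[OF linear_prim_l2] algebra_simps)
  \<comment> \<open>\<open>W\<close> has to vanish at 0 unless \<open>a\<close> and at 1 unless
    \<open>b\<close>. If neither flag holds, both requirements are compatible only because the mean
    of \<open>w\<close> is zero; if both hold, any constant would do.\<close>
  define k where "k = (if a then - inner one_l2 w else 0)"
  define k' where "k' = (if a \<and> b then 0 else k)"
  define W where "W = k' *\<^sub>R one_l2 + prim_l2 w"
  have W0: "a \<or> k' = 0" by (simp add: k'_def k_def)
  have W1: "b \<or> k' + inner one_l2 w = 0"
    using e(3) by (auto simp: k'_def k_def w_def t_def)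
  have bcW: "bc_deriv (\<not> a) (\<not> b) W w"
    unfolding bc_deriv_def W_def using W0 W1 by blast
  \<comment> \<open>At each end \<open>w\<close> or \<open>W\<close> vanishes, so both boundary
    products are 0.\<close>
  have "inner w w + inner g W
      = (c - e + inner one_l2 g) * (k' + inner one_l2 w) - (c - e) * k'"
    using prim_l2_parts[of "c - e" g w k'] by (simp add: w[symmetric] W_def)
  also have "\<dots> = 0"
    using W0 W1 c e split by auto
  finally have ww: "inner w w = - inner g W" by simp
  obtain y where y: "y \<in> span B" "norm (W - y) \<le> \<sigma> * norm w" using approx[OF bcW] by blast
  have "norm w * norm w = - inner g (W - y)"
    using ww orth[OF y(1)] by (simp add: inner_diff_right power2_norm_eq_inner[symmetric] power2_eq_square)
  also have "\<dots> \<le> norm g * norm (W - y)"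
    using norm_cauchy_schwarz[of "- g" "W - y"] by simp
  also have "\<dots> \<le> norm g * (\<sigma> * norm w)" using y(2) by (rule mult_left_mono) simp
  finally have "norm w * norm w \<le> norm w * (\<sigma> * norm g)" by (simp add: mult_ac)
  then have "norm w \<le> \<sigma> * norm g" using \<sigma> by (cases "norm w = 0") auto
  also have "\<dots> \<le> \<sigma> * norm (f - y0)" using g_le \<sigma> by (rule mult_left_mono)
  finally have "norm (u - t) \<le> \<sigma> * norm (f - y0)" by (simp add: w_def)
  moreover have "bc_deriv a b t (P f)" unfolding bc_deriv_def t_def using e by blast
  ultimately show ?thesis using P(2) by blast
qed


subsection \<open>Splines\<close>

definition breakpoint :: "real list \<Rightarrow> nat \<Rightarrow> real"
  where "breakpoint \<tau> j = (0 # \<tau> @ [1]) ! j"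

definition valid_knots :: "real list \<Rightarrow> bool"
  where "valid_knots \<tau> \<longleftrightarrow> sorted_wrt (<) (0 # \<tau> @ [1])"

lemma breakpoint_less:
  "valid_knots \<tau> \<Longrightarrow> i < j \<Longrightarrow> j \<le> Suc (length \<tau>) \<Longrightarrow> breakpoint \<tau> i < breakpoint \<tau> j"
  unfolding valid_knots_def breakpoint_def by (rule sorted_wrt_nth_less) auto

lemma breakpoint_le:
  "valid_knots \<tau> \<Longrightarrow> i \<le> j \<Longrightarrow> j \<le> Suc (length \<tau>) \<Longrightarrow> breakpoint \<tau> i \<le> breakpoint \<tau> j"
  using breakpoint_less[of \<tau> i j] by (cases "i = j") auto

lemma breakpoint_0: "breakpoint \<tau> 0 = 0" and breakpoint_end: "breakpoint \<tau> (Suc (length \<tau>)) = 1"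
  by (simp_all add: breakpoint_def nth_append)

lemma breakpoint_Suc: "j < length \<tau> \<Longrightarrow> breakpoint \<tau> (Suc j) = \<tau> ! j"
  by (simp add: breakpoint_def nth_append)

lemma knot_interval_eq:
  assumes "j \<le> length \<tau>"
  shows "knot_interval \<tau> j = (if j = length \<tau> then {breakpoint \<tau> j..1} else {breakpoint \<tau> j..<breakpoint \<tau> (Suc j)})"
proof -
  have "(0 # \<tau>) ! j = breakpoint \<tau> j"
    using assms nth_append[of "0 # \<tau>" "[1]" j] by (simp add: breakpoint_def)
  then show ?thesis using assms unfolding knot_interval_def by (auto simp only: breakpoint_Suc split: if_splits)
qed

lemma knot_interval_subset:
  assumes "valid_knots \<tau>" "j \<le> length \<tau>"
  shows "knot_interval \<tau> j \<subseteq> {0..1}"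
  using breakpoint_le[OF assms(1), of 0 j] breakpoint_le[OF assms(1), of "Suc j" "Suc (length \<tau>)"] assms(2)
  by (auto simp: knot_interval_eq breakpoint_0 breakpoint_end split: if_splits)

lemma knot_interval_ex:
  assumes "valid_knots \<tau>" "x \<in> {0..1}"
  obtains j where "j \<le> length \<tau>" "x \<in> knot_interval \<tau> j"
proof -
  define J where "J = {j. j \<le> length \<tau> \<and> breakpoint \<tau> j \<le> x}"
  have fin: "finite J" and ne: "0 \<in> J" using assms by (auto simp: J_def breakpoint_0)
  define j where "j = Max J"
  have j: "j \<in> J" unfolding j_def using fin ne by (intro Max_in) auto
  have "Suc j \<notin> J" using Max_ge[OF fin, of "Suc j"] by (auto simp: j_def)
  then have "x \<in> knot_interval \<tau> j"
    using j assms(2) by (auto simp: J_def knot_interval_eq)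
  then show thesis using j that by (auto simp: J_def)
qed

lemma knot_interval_disjoint:
  assumes "valid_knots \<tau>" "i \<le> length \<tau>" "j \<le> length \<tau>" "x \<in> knot_interval \<tau> i" "x \<in> knot_interval \<tau> j"
  shows "i = j"
proof (rule ccontr)
  assume "i \<noteq> j"
  have False if "i < j" "j \<le> length \<tau>" "x \<in> knot_interval \<tau> i" "x \<in> knot_interval \<tau> j" for i j
    using that breakpoint_le[OF assms(1), of "Suc i" j] by (auto simp: knot_interval_eq split: if_splits)
  then show False using assms(2-) \<open>i \<noteq> j\<close> by (metis linorder_neqE_nat)
qed

lemma breakpoint_in_knot_interval:
  assumes "valid_knots \<tau>" "j \<le> length \<tau>"
  shows "breakpoint \<tau> j \<in> knot_interval \<tau> j"
  using breakpoint_less[OF assms(1), of j "Suc j"] breakpoint_le[OF assms(1), of j "Suc (length \<tau>)"] assms(2)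
  by (auto simp: knot_interval_eq breakpoint_end)

lemma one_in_knot_interval:
  assumes "valid_knots \<tau>"
  shows "1 \<in> knot_interval \<tau> (length \<tau>)"
  using breakpoint_le[OF assms, of "length \<tau>" "Suc (length \<tau>)"]
  by (auto simp: knot_interval_eq breakpoint_end)

text \<open>A sum over indicators rather than a case distinction, so that integrability and linear
  combinations are treated term by term.\<close>

definition piecewise :: "real list \<Rightarrow> (nat \<Rightarrow> real poly) \<Rightarrow> real \<Rightarrow> real"
  where "piecewise \<tau> p x = (\<Sum>j\<le>length \<tau>. indicator (knot_interval \<tau> j) x * poly (p j) x)"

lemma piecewise_eq:
  assumes "valid_knots \<tau>" "j \<le> length \<tau>" "x \<in> knot_interval \<tau> j"
  shows "piecewise \<tau> p x = poly (p j) x"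
proof -
  have "piecewise \<tau> p x = (\<Sum>i\<le>length \<tau>. if i = j then poly (p j) x else 0)"
    unfolding piecewise_def
    using assms knot_interval_disjoint[OF assms(1)]
    by (intro sum.cong) (auto simp: indicator_def)
  also have "\<dots> = poly (p j) x" using assms(2) by simp
  finally show ?thesis .
qed

lemma square_integrable_indicator_mult:
  assumes "continuous_on {0..1} f" "I \<in> sets borel"
  shows "square_integrable (\<lambda>x. indicator I x * f x)"
proof -
  have f: "f \<in> borel_measurable lebesgue01" "integrable lebesgue01 (\<lambda>t. (f t)\<^sup>2)"
    using square_integrable_continuous[OF assms(1)] by (auto simp: square_integrable_def)
  have "indicator I \<in> borel_measurable lebesgue01"
    using assms(2) by (intro measurable_restrict_space1 borel_measurable_indicator) auto
  then have m: "(\<lambda>x. indicator I x * f x) \<in> borel_measurable lebesgue01"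
    using f by (intro borel_measurable_times)
  have "integrable lebesgue01 (\<lambda>t. (indicator I t * f t)\<^sup>2)"
    by (rule Bochner_Integration.integrable_bound[OF f(2)])
       (use m in \<open>auto simp: indicator_def intro!: AE_I2 borel_measurable_power\<close>)
  then show ?thesis using m by (simp add: square_integrable_def)
qed

lemma square_integrable_sum:
  "finite A \<Longrightarrow> (\<And>i. i \<in> A \<Longrightarrow> square_integrable (f i)) \<Longrightarrow> square_integrable (\<lambda>x. \<Sum>i\<in>A. f i x)"
  by (induction A rule: finite_induct) (auto simp: square_integrable_0 square_integrable_add)

lemma abs_l2_sum:
  "finite A \<Longrightarrow> (\<And>i. i \<in> A \<Longrightarrow> square_integrable (f i)) \<Longrightarrow> abs_l2 (\<lambda>x. \<Sum>i\<in>A. f i x) = (\<Sum>i\<in>A. abs_l2 (f i))"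
  by (induction A rule: finite_induct)
     (auto simp: zero_l2.abs_eq abs_l2_add[symmetric] square_integrable_sum)

lemma knot_interval_borel: "knot_interval \<tau> j \<in> sets borel"
  by (auto simp: knot_interval_def)

lemma square_integrable_piece: "square_integrable (\<lambda>x. indicator (knot_interval \<tau> j) x * poly (p j) x)"
  by (intro square_integrable_indicator_mult continuous_intros knot_interval_borel)

lemma square_integrable_piecewise: "square_integrable (piecewise \<tau> p)"
  unfolding piecewise_def[abs_def] by (intro square_integrable_sum square_integrable_piece) auto

lemma spline_eq_piecewise:
  assumes "valid_knots \<tau>" "spline_with_pieces d \<tau> s p" "x \<in> {0..1}"
  shows "s x = piecewise \<tau> p x"
proof -
  obtain j where "j \<le> length \<tau>" "x \<in> knot_interval \<tau> j" by (rule knot_interval_ex[OF assms(1,3)])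
  then show ?thesis using assms piecewise_eq[OF assms(1)] by (simp add: spline_with_pieces_def)
qed

lemma square_integrable_spline:
  assumes "valid_knots \<tau>" "spline_with_pieces d \<tau> s p"
  shows "square_integrable s"
  using square_integrable_cong[OF square_integrable_piecewise] spline_eq_piecewise[OF assms] by metis

definition splines :: "nat \<Rightarrow> real list \<Rightarrow> bool \<Rightarrow> bool \<Rightarrow> l2 set"
  where "splines d \<tau> a b = {abs_l2 s |s p. spline_with_pieces d \<tau> s p \<and>
    (\<forall>k\<le>d. (a \<longleftrightarrow> even k) \<longrightarrow> poly ((pderiv ^^ k) (p 0)) 0 = 0) \<and>
    (\<forall>k\<le>d. (b \<longleftrightarrow> even k) \<longrightarrow> poly ((pderiv ^^ k) (p (length \<tau>))) 1 = 0)}"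

lemma spline_space_eq: "spline_space n d i = splines d (knots n d i) (i \<noteq> 1) (i = 0)"
  by (simp add: spline_space_def splines_def left_order_iff right_order_iff)

lemma C_k_on_continuous: "C_k_on k S s \<Longrightarrow> continuous_on S s"
proof -
  assume "C_k_on k S s"
  then obtain D where D: "\<And>x. x \<in> S \<Longrightarrow> D 0 x = s x"
    "\<And>i x. i < k \<Longrightarrow> x \<in> S \<Longrightarrow> (D i has_real_derivative D (Suc i) x) (at x within S)" "continuous_on S (D k)"
    unfolding C_k_on_def by blast
  have "continuous_on S (D 0)"
  proof (cases "k = 0")
    case False
    then show ?thesis using D(2)[of 0] by (meson DERIV_continuous continuous_on_eq_continuous_within not_gr_zero)
  qed (use D(3) in simp)
  then show ?thesis using D(1) continuous_on_eq by metis
qed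

text \<open>Needed for the uniqueness of derivatives within a knot interval, also at its end points;
  the interval is connected and not a single point.\<close>

lemma at_within_knot_interval:
  assumes "valid_knots \<tau>" "j \<le> length \<tau>" "x \<in> knot_interval \<tau> j"
  shows "at x within knot_interval \<tau> j \<noteq> bot"
proof -
  have lt: "breakpoint \<tau> j < breakpoint \<tau> (Suc j)" using assms by (intro breakpoint_less) auto
  have "connected (knot_interval \<tau> j)" using assms(2) by (simp add: knot_interval_eq)
  moreover have "knot_interval \<tau> j \<noteq> {z}" for z
  proof -
    define y where "y = (breakpoint \<tau> j + breakpoint \<tau> (Suc j)) / 2"
    have "breakpoint \<tau> j < y" "y < breakpoint \<tau> (Suc j)" using lt by (auto simp: y_def)
    then have "y \<in> knot_interval \<tau> j" "y \<noteq> breakpoint \<tau> j"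
      using assms(2) by (auto simp: knot_interval_eq breakpoint_end)
    then show ?thesis using breakpoint_in_knot_interval[OF assms(1,2)] by auto
  qed
  ultimately have "x islimpt knot_interval \<tau> j"
    by (intro connected_imp_perfect) (use assms(3) in blast)+
  then show ?thesis by (simp add: trivial_limit_within)
qed

text \<open>If \<open>s\<close> is differentiable, its derivative agrees with that of the piece even
  at a knot, because derivatives within a knot interval are unique. For \<open>d = 0\<close> the
  derivative may jump; the fundamental theorem still applies with the knots as exceptional points,
  as \<open>s\<close> is continuous.\<close>

lemma spline_derivative:
  assumes \<tau>: "valid_knots \<tau>" and s: "spline_with_pieces (Suc d) \<tau> s p"
  shows "spline_with_pieces d \<tau> (piecewise \<tau> (\<lambda>j. pderiv (p j))) (\<lambda>j. pderiv (p j))"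
    and "\<And>x. x \<in> {0..1} \<Longrightarrow> s x = s 0 + integral {0..x} (piecewise \<tau> (\<lambda>j. pderiv (p j)))"
proof -
  define f where "f = piecewise \<tau> (\<lambda>j. pderiv (p j))"
  have C: "C_k_on d {0..1} s" and deg: "\<And>j. j \<le> length \<tau> \<Longrightarrow> degree (p j) \<le> Suc d"
    and pc: "\<And>j x. j \<le> length \<tau> \<Longrightarrow> x \<in> knot_interval \<tau> j \<Longrightarrow> s x = poly (p j) x"
    using s unfolding spline_with_pieces_def by simp_all
  have f: "f x = poly (pderiv (p j)) x" if "j \<le> length \<tau>" "x \<in> knot_interval \<tau> j" for j x
    unfolding f_def using that by (rule piecewise_eq[OF \<tau>])
  have Cf: "C_k_on (d - 1) {0..1} f" if d: "d > 0"
  proof -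
    obtain D where D: "\<And>x. x \<in> {0..1} \<Longrightarrow> D 0 x = s x"
      "\<And>i x. i < d \<Longrightarrow> x \<in> {0..1} \<Longrightarrow> (D i has_real_derivative D (Suc i) x) (at x within {0..1})"
      "continuous_on {0..1} (D d)"
      using C unfolding C_k_on_def by blast
    have "D 1 x = f x" if x: "x \<in> {0..1}" for x
    proof -
      obtain j where j: "j \<le> length \<tau>" "x \<in> knot_interval \<tau> j" by (rule knot_interval_ex[OF \<tau> x])
      note sub = knot_interval_subset[OF \<tau> j(1)]
      have "(D 0 has_real_derivative D 1 x) (at x within knot_interval \<tau> j)"
        using D(2)[OF d x] sub by (auto intro: DERIV_subset)
      then have "(poly (p j) has_real_derivative D 1 x) (at x within knot_interval \<tau> j)"
        by (rule has_field_derivative_transform_within[OF _ zero_less_one j(2)])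
           (use D(1) pc[OF j(1)] sub in force)
      moreover have "(poly (p j) has_real_derivative poly (pderiv (p j)) x) (at x within knot_interval \<tau> j)"
        by (rule has_field_derivative_at_within[OF poly_DERIV])
      ultimately have "D 1 x = poly (pderiv (p j)) x"
        using at_within_knot_interval[OF \<tau> j] has_field_derivative_unique by blast
      then show ?thesis using f[OF j] by simp
    qed
    then show ?thesis
      unfolding C_k_on_def using D d by (intro exI[of _ "\<lambda>i. D (Suc i)"]) auto
  qed
  show "spline_with_pieces d \<tau> (piecewise \<tau> (\<lambda>j. pderiv (p j))) (\<lambda>j. pderiv (p j))"
    unfolding spline_with_pieces_def f_def[symmetric]
    using Cf f deg by (fastforce simp: degree_pderiv)
  have cont: "continuous_on {0..1} s" using C by (rule C_k_on_continuous)
  show "s x = s 0 + integral {0..x} (piecewise \<tau> (\<lambda>j. pderiv (p j)))" if x: "x \<in> {0..1}" for x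
  proof -
    have "(f has_integral (s x - s 0)) {0..x}"
    proof (rule fundamental_theorem_of_calculus_interior_strong)
      show "finite (set \<tau>)" by simp
      show "0 \<le> x" using x by simp
      show "continuous_on {0..x} s" using cont x by (auto elim: continuous_on_subset)
      fix y assume y: "y \<in> {0<..<x} - set \<tau>"
      then have y01: "y \<in> {0..1}" using x by auto
      obtain j where j: "j \<le> length \<tau>" "y \<in> knot_interval \<tau> j" by (rule knot_interval_ex[OF \<tau> y01])
      have "y \<noteq> breakpoint \<tau> j"
      proof (cases j)
        case 0 then show ?thesis using y by (simp add: breakpoint_0)
      next
        case (Suc i) then show ?thesis using y j(1) by (auto simp: breakpoint_Suc)
      qed
      then have yin: "y \<in> {breakpoint \<tau> j<..<breakpoint \<tau> (Suc j)}"
        using j y x by (auto simp: knot_interval_eq breakpoint_end split: if_splits)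
      have "(s has_real_derivative poly (pderiv (p j)) y) (at y)"
      proof (rule has_field_derivative_transform_within_open[OF poly_DERIV _ yin])
        fix z assume z: "z \<in> {breakpoint \<tau> j<..<breakpoint \<tau> (Suc j)}"
        then have "z \<in> knot_interval \<tau> j"
          using j(1) by (auto simp: knot_interval_eq breakpoint_end)
        then show "poly (p j) z = s z" using pc[OF j(1)] by simp
      qed simp
      then show "(s has_vector_derivative f y) (at y)"
        using f[OF j] by (simp add: has_real_derivative_iff_has_vector_derivative)
    qed
    then show ?thesis by (simp add: f_def integral_unique)
  qed
qed

lemma poly_antiderivative:
  obtains P :: "real poly" where "pderiv P = p" "degree P \<le> Suc (degree p)"
proof -
  define P where "P = (\<Sum>i\<le>degree p. monom (coeff p i / real (Suc i)) (Suc i))"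
  have "pderiv P = (\<Sum>i\<le>degree p. pderiv (monom (coeff p i / real (Suc i)) (Suc i)))"
    unfolding P_def using higher_pderiv_sum[of 1] by simp
  also have "\<dots> = (\<Sum>i\<le>degree p. monom (coeff p i) i)"
    by (intro sum.cong) (auto simp: pderiv_monom)
  also have "\<dots> = p" by (rule poly_as_sum_of_monoms)
  finally have "pderiv P = p" .
  moreover have "degree P \<le> Suc (degree p)"
    unfolding P_def by (intro degree_sum_le) (auto intro: order_trans[OF degree_monom_le])
  ultimately show thesis using that by blast
qed

lemma spline_primitive:
  assumes \<tau>: "valid_knots \<tau>" and f: "spline_with_pieces d \<tau> f p"
  obtains q where "spline_with_pieces (Suc d) \<tau> (\<lambda>x. c + integral {0..x} f) q" "\<And>j. pderiv (q j) = p j"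
proof -
  define s where "s x = c + integral {0..x} f" for x
  have deg: "\<And>j. j \<le> length \<tau> \<Longrightarrow> degree (p j) \<le> d"
    and pc: "\<And>j x. j \<le> length \<tau> \<Longrightarrow> x \<in> knot_interval \<tau> j \<Longrightarrow> f x = poly (p j) x"
    using f unfolding spline_with_pieces_def by blast+
  have prim: "primitive_on 0 1 s f"
    by (rule primitive_on_abs_l2(2)[OF square_integrable_spline[OF \<tau> f]]) (simp add: s_def)
  have "\<exists>Q. pderiv Q = p j \<and> degree Q \<le> Suc (degree (p j))" for j
    by (rule poly_antiderivative[of "p j"]) blast
  then have "\<exists>P. \<forall>j. pderiv (P j) = p j \<and> degree (P j) \<le> Suc (degree (p j))"
    by (intro choice allI)
  then obtain P where P: "\<And>j. pderiv (P j) = p j" "\<And>j. degree (P j) \<le> Suc (degree (p j))" by blast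
  \<comment> \<open>The added constant makes each piece agree with \<open>s\<close> at the left end
    of its interval.\<close>
  define q where "q j = P j + [:s (breakpoint \<tau> j) - poly (P j) (breakpoint \<tau> j):]" for j
  have q': "pderiv (q j) = p j" for j by (simp add: q_def pderiv_add P pderiv_pCons)
  have qdeg: "degree (q j) \<le> Suc d" if "j \<le> length \<tau>" for j
    unfolding q_def using P(2)[of j] deg[OF that] by (intro degree_add_le) auto
  have sq: "s x = poly (q j) x" if j: "j \<le> length \<tau>" and x: "x \<in> knot_interval \<tau> j" for j x
  proof -
    have le: "breakpoint \<tau> j \<le> x" using j x by (auto simp: knot_interval_eq split: if_splits)
    have sub: "{breakpoint \<tau> j..x} \<subseteq> knot_interval \<tau> j"
      using j x by (auto simp: knot_interval_eq split: if_splits)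
    have b: "0 \<le> breakpoint \<tau> j" "x \<le> 1"
      using knot_interval_subset[OF \<tau> j] x breakpoint_in_knot_interval[OF \<tau> j] by auto
    have "s x - s (breakpoint \<tau> j) = integral {breakpoint \<tau> j..x} f"
      using primitive_on_diff[OF prim b(1) le b(2)] by simp
    also have "\<dots> = integral {breakpoint \<tau> j..x} (poly (p j))"
      using pc[OF j] sub by (intro Henstock_Kurzweil_Integration.integral_cong) auto
    also have "\<dots> = poly (P j) x - poly (P j) (breakpoint \<tau> j)"
    proof (rule integral_unique, rule fundamental_theorem_of_calculus[OF le])
      fix y
      show "(poly (P j) has_vector_derivative poly (p j) y) (at y within {breakpoint \<tau> j..x})"
        using poly_DERIV[of "P j" y] P(1)[of j]
        by (auto simp: has_real_derivative_iff_has_vector_derivative intro: has_vector_derivative_at_within)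
    qed
    finally show ?thesis by (simp add: q_def)
  qed
  have scont: "continuous_on {0..1} s" by (rule primitive_on_continuous[OF prim])
  have "C_k_on d {0..1} s"
  proof (cases "d = 0")
    case True
    then show ?thesis unfolding C_k_on_def using scont by (intro exI[of _ "\<lambda>_. s"]) auto
  next
    case False
    then have Cf: "C_k_on (d - 1) {0..1} f" using f by (simp add: spline_with_pieces_def)
    then obtain D where D: "\<And>x. x \<in> {0..1} \<Longrightarrow> D 0 x = f x"
      "\<And>i x. i < d - 1 \<Longrightarrow> x \<in> {0..1} \<Longrightarrow> (D i has_real_derivative D (Suc i) x) (at x within {0..1})"
      "continuous_on {0..1} (D (d - 1))"
      unfolding C_k_on_def by blast
    have s': "(s has_real_derivative f x) (at x within {0..1})" if "x \<in> {0..1}" for x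
      using DERIV_add[OF DERIV_const integral_has_real_derivative[OF C_k_on_continuous[OF Cf] that]]
      unfolding s_def[abs_def] by simp
    show ?thesis
      unfolding C_k_on_def
    proof (intro exI[of _ "case_nat s D"] conjI ballI allI impI)
      fix i x assume "i < d" "x \<in> {0..1 :: real}"
      then show "(case_nat s D i has_real_derivative case_nat s D (Suc i) x) (at x within {0..1})"
        using D(1,2) s' by (cases i) auto
    next
      show "continuous_on {0..1} (case_nat s D d)" using D(3) False by (cases d) auto
    qed simp
  qed
  then have "spline_with_pieces (Suc d) \<tau> s q"
    using qdeg sq by (auto simp: spline_with_pieces_def)
  then show thesis using that q' by (simp add: s_def[abs_def])
qed

text \<open>The condition of order 0 is the one in \<open>bc_deriv\<close>; a condition of order
  \<open>Suc k\<close> is one of order \<open>k\<close> on the derivative, where the parity is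
  reversed.\<close>

lemma splines_Suc:
  assumes \<tau>: "valid_knots \<tau>"
  shows "splines (Suc d) \<tau> a b = {u. \<exists>f\<in>splines d \<tau> (\<not> a) (\<not> b). bc_deriv a b u f}"
proof (intro set_eqI iffI)
  fix u assume "u \<in> splines (Suc d) \<tau> a b"
  then obtain s p where u: "u = abs_l2 s" and s: "spline_with_pieces (Suc d) \<tau> s p"
    and bc: "\<And>k. k \<le> Suc d \<Longrightarrow> (a \<longleftrightarrow> even k) \<Longrightarrow> poly ((pderiv ^^ k) (p 0)) 0 = 0"
      "\<And>k. k \<le> Suc d \<Longrightarrow> (b \<longleftrightarrow> even k) \<Longrightarrow> poly ((pderiv ^^ k) (p (length \<tau>))) 1 = 0"
    unfolding splines_def by blast
  define f where "f = piecewise \<tau> (\<lambda>j. pderiv (p j))"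
  note f = spline_derivative[OF \<tau> s, folded f_def]
  have fs: "square_integrable f" unfolding f_def by (rule square_integrable_piecewise)
  have "abs_l2 f \<in> splines d \<tau> (\<not> a) (\<not> b)"
    unfolding splines_def
  proof (intro CollectI exI[of _ f] exI[of _ "\<lambda>j. pderiv (p j)"] conjI allI impI refl f(1))
    fix k assume "k \<le> d" "(\<not> a) = even k"
    then show "poly ((pderiv ^^ k) (pderiv (p 0))) 0 = 0"
      using bc(1)[of "Suc k"] by (auto simp: funpow_Suc_right simp del: funpow.simps)
  next
    fix k assume "k \<le> d" "(\<not> b) = even k"
    then show "poly ((pderiv ^^ k) (pderiv (p (length \<tau>)))) 1 = 0"
      using bc(2)[of "Suc k"] by (auto simp: funpow_Suc_right simp del: funpow.simps)
  qed
  moreover have "bc_deriv a b u (abs_l2 f)"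
    unfolding bc_deriv_def
  proof (intro exI[of _ "s 0"] conjI impI)
    show "u = s 0 *\<^sub>R one_l2 + prim_l2 (abs_l2 f)"
      unfolding u using primitive_on_abs_l2(1)[OF fs f(2)] .
    have s01: "s 0 = poly (p 0) 0" "s 1 = poly (p (length \<tau>)) 1"
      using s breakpoint_in_knot_interval[OF \<tau>, of 0] one_in_knot_interval[OF \<tau>]
      by (auto simp: spline_with_pieces_def breakpoint_0)
    show "s 0 = 0" if a using bc(1)[of 0] that s01 by simp
    have "s 0 + inner one_l2 (abs_l2 f) = s 1" using f(2)[of 1] fs by (simp add: inner_one_l2)
    then show "s 0 + inner one_l2 (abs_l2 f) = 0" if b using bc(2)[of 0] that s01 by simp
  qed
  ultimately show "u \<in> {u. \<exists>f\<in>splines d \<tau> (\<not> a) (\<not> b). bc_deriv a b u f}" by blast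
next
  fix u assume "u \<in> {u. \<exists>f\<in>splines d \<tau> (\<not> a) (\<not> b). bc_deriv a b u f}"
  then obtain f p c where f: "spline_with_pieces d \<tau> f p"
    and bc: "\<And>k. k \<le> d \<Longrightarrow> (\<not> a \<longleftrightarrow> even k) \<Longrightarrow> poly ((pderiv ^^ k) (p 0)) 0 = 0"
      "\<And>k. k \<le> d \<Longrightarrow> (\<not> b \<longleftrightarrow> even k) \<Longrightarrow> poly ((pderiv ^^ k) (p (length \<tau>))) 1 = 0"
    and u: "u = c *\<^sub>R one_l2 + prim_l2 (abs_l2 f)" and c: "a \<longrightarrow> c = 0" "b \<longrightarrow> c + inner one_l2 (abs_l2 f) = 0"
    unfolding splines_def bc_deriv_def by blast
  define s where "s x = c + integral {0..x} f" for x
  obtain q where q: "spline_with_pieces (Suc d) \<tau> s q" "\<And>j. pderiv (q j) = p j"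
    using spline_primitive[OF \<tau> f, of c] unfolding s_def by blast
  have fs: "square_integrable f" by (rule square_integrable_spline[OF \<tau> f])
  have "u = abs_l2 s"
    unfolding u using primitive_on_abs_l2(1)[OF fs, of s] by (simp add: s_def)
  moreover have s01: "s 0 = poly (q 0) 0" "s 1 = poly (q (length \<tau>)) 1"
    using q(1) breakpoint_in_knot_interval[OF \<tau>, of 0] one_in_knot_interval[OF \<tau>]
    by (auto simp: spline_with_pieces_def breakpoint_0)
  have "s 0 = c" "s 1 = c + inner one_l2 (abs_l2 f)" using fs by (simp_all add: s_def inner_one_l2)
  then have z: "a \<Longrightarrow> poly (q 0) 0 = 0" "b \<Longrightarrow> poly (q (length \<tau>)) 1 = 0"
    using c s01 by auto
  have "poly ((pderiv ^^ k) (q 0)) 0 = 0" if "k \<le> Suc d" "a \<longleftrightarrow> even k" for k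
    using that z bc(1)[of "k - 1"] q(2)[of 0] by (cases k) (auto simp: funpow_Suc_right simp del: funpow.simps(2))
  moreover have "poly ((pderiv ^^ k) (q (length \<tau>))) 1 = 0" if "k \<le> Suc d" "b \<longleftrightarrow> even k" for k
    using that z bc(2)[of "k - 1"] q(2)[of "length \<tau>"] by (cases k) (auto simp: funpow_Suc_right simp del: funpow.simps(2))
  ultimately show "u \<in> splines (Suc d) \<tau> a b"
    unfolding splines_def using q(1) by blast
qed


section \<open>Equidistant knots and piecewise constant splines\<close>

definition uniform_knots :: "nat \<Rightarrow> bool \<Rightarrow> real list"
  where "uniform_knots m e = map (\<lambda>j. (2 * real j + (if e then 1 else 2)) / real m)
    [0..<(if e then m div 2 else (m - 1) div 2)]"

lemma length_uniform_knots: "length (uniform_knots m e) = (if e then m div 2 else (m - 1) div 2)"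
  by (simp add: uniform_knots_def)

text \<open>The six knot vectors are the odd or the even multiples of \<open>1/m\<close> in the open
  unit interval. With the flag \<open>a\<close> for \<open>i \<noteq> 1\<close>, the parity
  \<open>even d \<longleftrightarrow> a\<close> is unchanged when \<open>d\<close> grows by one and
  \<open>a\<close> is negated: splines and their derivatives share the same knots.\<close>

lemma knots_eq_uniform_knots:
  assumes "n \<ge> 1" "i \<in> {0, 1, 2}"
  shows "knots n d i = uniform_knots (2 * n + of_bool (i \<noteq> 1) + of_bool (i = 0)) (even d \<longleftrightarrow> i \<noteq> 1)"
proof -
  consider "i = 0" | "i = 1" | "i = 2" using assms(2) by auto
  then show ?thesis
  proof cases
    case 1
    then show ?thesis
      by (intro nth_equalityI) (auto simp: knots_def uniform_knots_def field_simps simp del: upt_Suc)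
  next
    case 2
    have "2 * n - Suc 0 = 2 * (n - 1) + 1" using assms(1) by simp
    then have "(2 * n - Suc 0) div 2 = n - 1" by simp
    then show ?thesis using 2 assms(1)
      by (intro nth_equalityI) (auto simp: knots_def uniform_knots_def field_simps)
  next
    case 3
    then show ?thesis
      by (intro nth_equalityI) (auto simp: knots_def uniform_knots_def field_simps simp del: upt_Suc)
  qed
qed

lemma nth_uniform_knots:
  "j < length (uniform_knots m e) \<Longrightarrow> uniform_knots m e ! j = (2 * real j + (if e then 1 else 2)) / real m"
  by (simp add: uniform_knots_def)

lemma uniform_knots_bounds:
  assumes "j < length (uniform_knots m e)"
  shows "0 < uniform_knots m e ! j" "uniform_knots m e ! j < 1"
proof -
  have lt: "2 * j + (if e then 1 else 2) < m"
    using assms by (auto simp: length_uniform_knots split: if_splits)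
  then have "real (2 * j + (if e then 1 else 2)) < real m" by (simp only: of_nat_less_iff)
  then show "0 < uniform_knots m e ! j" "uniform_knots m e ! j < 1"
    using lt by (auto simp: nth_uniform_knots[OF assms] field_simps split: if_splits)
qed

lemma valid_uniform_knots: "valid_knots (uniform_knots m e)"
proof -
  have "0 < x \<and> x < 1" if "x \<in> set (uniform_knots m e)" for x
    using that uniform_knots_bounds by (auto simp: in_set_conv_nth)
  moreover have "sorted_wrt (<) (uniform_knots m e)"
    unfolding sorted_wrt_iff_nth_less
  proof (intro allI impI)
    fix i j assume ij: "i < j" "j < length (uniform_knots m e)"
    then have "m > 0" by (cases m) (auto simp: length_uniform_knots split: if_splits)
    then show "uniform_knots m e ! i < uniform_knots m e ! j"
      using ij by (auto simp: nth_uniform_knots divide_strict_right_mono)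
  qed
  ultimately show ?thesis by (simp add: valid_knots_def sorted_wrt_append)
qed

lemma breakpoint_uniform_knots:
  assumes "j < length (uniform_knots m e)"
  shows "breakpoint (uniform_knots m e) (Suc j) = (2 * real j + (if e then 1 else 2)) / real m"
  using assms by (simp add: breakpoint_Suc nth_uniform_knots)

lemma splines_0_eq:
  assumes \<tau>: "valid_knots \<tau>"
  shows "splines 0 \<tau> a b = {abs_l2 (piecewise \<tau> (\<lambda>j. [:c j:])) |c. (a \<longrightarrow> c 0 = 0) \<and> (b \<longrightarrow> c (length \<tau>) = 0)}"
proof (intro set_eqI iffI)
  fix u assume "u \<in> splines 0 \<tau> a b"
  then obtain s p where u: "u = abs_l2 s" and s: "spline_with_pieces 0 \<tau> s p"
    and bc: "a \<Longrightarrow> poly (p 0) 0 = 0" "b \<Longrightarrow> poly (p (length \<tau>)) 1 = 0"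
    unfolding splines_def by auto
  define c where "c j = coeff (p j) 0" for j
  have pc: "p j = [:c j:]" if "j \<le> length \<tau>" for j
  proof -
    have "degree (p j) = 0" using s that by (simp add: spline_with_pieces_def)
    then show ?thesis unfolding c_def by (metis degree_eq_zeroE coeff_pCons_0)
  qed
  have "s x = piecewise \<tau> (\<lambda>j. [:c j:]) x" if "x \<in> {0..1}" for x
    using spline_eq_piecewise[OF \<tau> s that] pc by (simp add: piecewise_def)
  then have "u = abs_l2 (piecewise \<tau> (\<lambda>j. [:c j:]))"
    unfolding u by (rule abs_l2_cong[OF square_integrable_spline[OF \<tau> s]])
  moreover have "a \<longrightarrow> c 0 = 0" "b \<longrightarrow> c (length \<tau>) = 0"
    using bc pc[of 0] pc[of "length \<tau>"] by auto
  ultimately show "u \<in> {abs_l2 (piecewise \<tau> (\<lambda>j. [:c j:])) |c. (a \<longrightarrow> c 0 = 0) \<and> (b \<longrightarrow> c (length \<tau>) = 0)}"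
    by blast
next
  fix u assume "u \<in> {abs_l2 (piecewise \<tau> (\<lambda>j. [:c j:])) |c. (a \<longrightarrow> c 0 = 0) \<and> (b \<longrightarrow> c (length \<tau>) = 0)}"
  then obtain c where c: "u = abs_l2 (piecewise \<tau> (\<lambda>j. [:c j:]))" "a \<longrightarrow> c 0 = 0" "b \<longrightarrow> c (length \<tau>) = 0"
    by blast
  have "spline_with_pieces 0 \<tau> (piecewise \<tau> (\<lambda>j. [:c j:])) (\<lambda>j. [:c j:])"
    using piecewise_eq[OF \<tau>] by (auto simp: spline_with_pieces_def)
  then show "u \<in> splines 0 \<tau> a b"
    unfolding splines_def using c by fastforce
qed

lemma splines_0_span:
  assumes \<tau>: "valid_knots \<tau>"
  shows "splines 0 \<tau> a b = span ((\<lambda>j. abs_l2 (indicator (knot_interval \<tau> j)))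
    ` {j. j \<le> length \<tau> \<and> (a \<longrightarrow> j \<noteq> 0) \<and> (b \<longrightarrow> j \<noteq> length \<tau>)})" (is "_ = span (?\<chi> ` ?J)")
proof -
  have sq: "square_integrable (indicator (knot_interval \<tau> j))" for j
    using square_integrable_indicator_mult[of "\<lambda>_. 1" "knot_interval \<tau> j"] knot_interval_borel by simp
  have pw: "abs_l2 (piecewise \<tau> (\<lambda>j. [:c j:])) = (\<Sum>j\<le>length \<tau>. c j *\<^sub>R ?\<chi> j)" for c
  proof -
    have "abs_l2 (piecewise \<tau> (\<lambda>j. [:c j:])) = (\<Sum>j\<le>length \<tau>. abs_l2 (\<lambda>x. indicator (knot_interval \<tau> j) x * poly [:c j:] x))"
      unfolding piecewise_def[abs_def] by (intro abs_l2_sum square_integrable_piece) auto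
    also have "\<dots> = (\<Sum>j\<le>length \<tau>. c j *\<^sub>R ?\<chi> j)"
      by (simp add: abs_l2_scaleR sq mult.commute)
    finally show ?thesis .
  qed
  define X where "X = {(\<Sum>j\<le>length \<tau>. c j *\<^sub>R ?\<chi> j) |c. (a \<longrightarrow> c 0 = 0) \<and> (b \<longrightarrow> c (length \<tau>) = 0)}"
  have X: "splines 0 \<tau> a b = X" by (simp only: splines_0_eq[OF \<tau>] pw X_def)
  have sub: "subspace X"
    unfolding subspace_def
  proof (intro conjI ballI allI)
    show "0 \<in> X" unfolding X_def by (intro CollectI exI[of _ "\<lambda>_. 0"]) simp
  next
    fix u v assume "u \<in> X" "v \<in> X"
    then obtain c d where c: "u = (\<Sum>j\<le>length \<tau>. c j *\<^sub>R ?\<chi> j)" "a \<longrightarrow> c 0 = 0" "b \<longrightarrow> c (length \<tau>) = 0"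
      and d: "v = (\<Sum>j\<le>length \<tau>. d j *\<^sub>R ?\<chi> j)" "a \<longrightarrow> d 0 = 0" "b \<longrightarrow> d (length \<tau>) = 0"
      unfolding X_def by blast
    show "u + v \<in> X" unfolding X_def
      using c d by (intro CollectI exI[of _ "\<lambda>j. c j + d j"]) (auto simp: scaleR_add_left sum.distrib)
  next
    fix k u assume "u \<in> X"
    then obtain c where c: "u = (\<Sum>j\<le>length \<tau>. c j *\<^sub>R ?\<chi> j)" "a \<longrightarrow> c 0 = 0" "b \<longrightarrow> c (length \<tau>) = 0"
      unfolding X_def by blast
    show "k *\<^sub>R u \<in> X" unfolding X_def
      using c by (intro CollectI exI[of _ "\<lambda>j. k * c j"]) (auto simp: scaleR_sum_right)
  qed
  have "?\<chi> i \<in> X" if i: "i \<in> ?J" for i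
  proof -
    have "(\<Sum>j\<le>length \<tau>. of_bool (j = i) *\<^sub>R ?\<chi> j) = (\<Sum>j\<le>length \<tau>. if j = i then ?\<chi> i else 0)"
      by (intro sum.cong) auto
    also have "\<dots> = ?\<chi> i" using i by simp
    finally have e: "?\<chi> i = (\<Sum>j\<le>length \<tau>. of_bool (j = i) *\<^sub>R ?\<chi> j)" ..
    show ?thesis unfolding X_def
      by (intro CollectI exI[of _ "\<lambda>j. of_bool (j = i)"] conjI e) (use i in auto)
  qed
  then have "span (?\<chi> ` ?J) \<subseteq> X" using sub by (intro span_minimal) auto
  moreover have "X \<subseteq> span (?\<chi> ` ?J)"
  proof
    fix u assume "u \<in> X"
    then obtain c where c: "u = (\<Sum>j\<le>length \<tau>. c j *\<^sub>R ?\<chi> j)" "a \<longrightarrow> c 0 = 0" "b \<longrightarrow> c (length \<tau>) = 0"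
      unfolding X_def by blast
    have "c j *\<^sub>R ?\<chi> j \<in> span (?\<chi> ` ?J)" if "j \<in> {..length \<tau>}" for j
    proof (cases "j \<in> ?J")
      case True
      then show ?thesis by (intro span_scale span_base imageI)
    next
      case False
      then have "c j = 0" using that c by auto
      then show ?thesis by (simp add: span_zero)
    qed
    then show "u \<in> span (?\<chi> ` ?J)" unfolding c(1) by (intro span_sum)
  qed
  ultimately show ?thesis using X by blast
qed

lemma primitive_on_minus_const:
  assumes "primitive_on a b F f"
  shows "primitive_on a b (\<lambda>x. F x - k) f"
  unfolding primitive_on_def
proof (intro conjI ballI)
  fix x assume "x \<in> {a..b}"
  from primitive_onD(2)[OF assms this] show "F x - k = F a - k + integral {a..x} f" by linarith
qed (rule primitive_onD(1)[OF assms])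

lemma integral_uniform_partition:
  fixes h :: "real \<Rightarrow> real"
  assumes h: "h integrable_on {0..1}" and m: "m > 0" and k: "k \<le> m"
  shows "integral {0..real k / real m} h = (\<Sum>q<k. integral {real q / real m..real (Suc q) / real m} h)"
  using k
proof (induction k)
  case (Suc k)
  have le: "real (Suc k) / real m \<le> 1" using Suc.prems m by (simp add: field_simps del: of_nat_Suc)
  have "integral {0..real k / real m} h + integral {real k / real m..real (Suc k) / real m} h
    = integral {0..real (Suc k) / real m} h"
  proof (rule Henstock_Kurzweil_Integration.integral_combine)
    show "h integrable_on {0..real (Suc k) / real m}"
      using le by (intro integrable_on_subinterval[OF h]) auto
  qed (use m in \<open>auto simp: divide_right_mono\<close>)
  then show ?case using Suc by simp
qed simp

text \<open>For \<open>d = 0\<close> interpolate at the multiples of \<open>1/m\<close> that are not knots: on each interval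
  between consecutive multiples of \<open>1/m\<close> the error vanishes at one end.\<close>

lemma splines_0_approximation:
  assumes m: "m = 2 * n + of_bool a + of_bool b" "m \<ge> 1" and w: "bc_deriv a b w g"
  shows "\<exists>y\<in>splines 0 (uniform_knots m a) a b. norm (w - y) \<le> 2 / (real m * pi) * norm g"
proof -
  obtain c where c: "w = c *\<^sub>R one_l2 + prim_l2 g" "a \<longrightarrow> c = 0" "b \<longrightarrow> c + inner one_l2 g = 0"
    using w unfolding bc_deriv_def by blast
  obtain f where f: "square_integrable f" "g = abs_l2 f" by (rule l2_cases)
  define F where "F x = c + integral {0..x} f" for x
  have F0: "F 0 = c" "F 1 = c + inner one_l2 g" using f by (simp_all add: F_def inner_one_l2)
  have F: "abs_l2 F = w" "primitive_on 0 1 F f" "square_integrable F"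
    using primitive_on_abs_l2[OF f(1), of F] F0 f c by (simp_all add: F_def)
  define \<tau> where "\<tau> = uniform_knots m a"
  have \<tau>: "valid_knots \<tau>" by (simp add: \<tau>_def valid_uniform_knots)
  \<comment> \<open>The nodes have the parity opposite to the knots: \<open>node j / m\<close> lies
    in the interval with index \<open>j\<close>. The end 0 is a node if \<open>a\<close> and the end
    1 if \<open>b\<close>, so the interpolant inherits the boundary zeros of
    \<open>F\<close>.\<close>
  define node where "node j = 2 * j + of_bool (\<not> a)" for j :: nat
  define s where "s = piecewise \<tau> (\<lambda>j. [:F (real (node j) / real m):])"
  have s_eq: "s x = F (real (node j) / real m)" if "j \<le> length \<tau>" "x \<in> knot_interval \<tau> j" for j x
    unfolding s_def using piecewise_eq[OF \<tau> that] by simp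
  have ss: "square_integrable s" unfolding s_def by (rule square_integrable_piecewise)
  have node_end: "b \<Longrightarrow> node (length \<tau>) = m"
    using m by (cases a) (auto simp: node_def \<tau>_def length_uniform_knots)
  have "abs_l2 s \<in> splines 0 \<tau> a b"
    unfolding s_def splines_0_eq[OF \<tau>]
    using c F0 node_end m(2)
    by (intro CollectI exI[of _ "\<lambda>j. F (real (node j) / real m)"]) (auto simp: node_def)
  define h where "h x = (F x - s x)\<^sup>2" for x
  have hi: "h integrable_on {0..1}"
    unfolding h_def by (intro square_integrable_square square_integrable_diff F ss)
  have f2: "(\<lambda>x. (f x)\<^sup>2) integrable_on {0..1}" by (rule square_integrable_square[OF f(1)])
  have cell: "integral {real q / real m..real (Suc q) / real m} h
      \<le> (2 / (real m * pi))\<^sup>2 * integral {real q / real m..real (Suc q) / real m} (\<lambda>x. (f x)\<^sup>2)"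
    if q: "q < m" for q
  proof -
    define \<alpha> \<beta> where "\<alpha> = real q / real m" and "\<beta> = real (Suc q) / real m"
    have ab: "0 \<le> \<alpha>" "\<alpha> < \<beta>" "\<beta> \<le> 1" "\<beta> - \<alpha> = 1 / real m"
      using q by (auto simp: \<alpha>_def \<beta>_def field_simps)
    \<comment> \<open>Of the two ends \<open>q\<close> and \<open>Suc q\<close> of the cell, the one
      that is a node.\<close>
    define q' where "q' = (if even q = a then q else Suc q)"
    define j where "j = q' div 2"
    have q'j: "q' = node j"
      by (cases a) (auto simp: q'_def j_def node_def)
    have q'm: "q' \<le> m" using q by (simp add: q'_def)
    have j: "j \<le> length \<tau>"
      using q'm q'j by (cases a) (auto simp: node_def \<tau>_def length_uniform_knots)
    define z where "z = real q' / real m"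
    have z: "z = \<alpha> \<or> z = \<beta>" by (auto simp: z_def \<alpha>_def \<beta>_def q'_def)
    \<comment> \<open>Only inside the cell: at its right end the next piece may already be in
      force.\<close>
    have sz: "s x = F z" if x: "x \<in> {\<alpha>..\<beta>} - {\<alpha>, \<beta>}" for x
    proof -
      have x': "\<alpha> < x" "x < \<beta>" using x by auto
      have "breakpoint \<tau> j \<le> \<alpha>"
      proof (cases j)
        case 0
        then show ?thesis using ab by (simp add: breakpoint_0)
      next
        case (Suc i)
        then have "breakpoint \<tau> j = (real q' - 1) / real m"
          using j q'j breakpoint_uniform_knots[of i m a] by (cases a) (auto simp: \<tau>_def node_def)
        then show ?thesis using m(2) by (auto simp: \<alpha>_def q'_def divide_right_mono)
      qed
      moreover have "\<beta> \<le> breakpoint \<tau> (Suc j)" if "j < length \<tau>"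
      proof -
        have "breakpoint \<tau> (Suc j) = (real q' + 1) / real m"
          using that q'j breakpoint_uniform_knots[of j m a] by (cases a) (auto simp: \<tau>_def node_def)
        then show ?thesis using m(2) by (auto simp: \<beta>_def q'_def divide_right_mono)
      qed
      ultimately have "x \<in> knot_interval \<tau> j"
        using x' ab j by (auto simp: knot_interval_eq)
      then show ?thesis using s_eq[OF j] q'j by (simp add: z_def)
    qed
    have "integral {\<alpha>..\<beta>} h = integral {\<alpha>..\<beta>} (\<lambda>x. (F x - F z)\<^sup>2)"
      by (rule integral_spike[of "{\<alpha>, \<beta>}"]) (auto simp: h_def sz)
    also have "\<dots> \<le> (2 * (\<beta> - \<alpha>) / pi)\<^sup>2 * integral {\<alpha>..\<beta>} (\<lambda>x. (f x)\<^sup>2)"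
    proof (rule poincare_half)
      show "primitive_on \<alpha> \<beta> (\<lambda>x. F x - F z) f"
        using ab by (intro primitive_on_minus_const primitive_on_subinterval[OF F(2)])
      show "(\<lambda>x. (f x)\<^sup>2) integrable_on {\<alpha>..\<beta>}"
        using ab by (intro integrable_on_subinterval[OF f2]) auto
      show "F \<alpha> - F z = 0 \<or> F \<beta> - F z = 0" using z by auto
    qed (use ab in auto)
    also have "2 * (\<beta> - \<alpha>) / pi = 2 / (real m * pi)" by (simp add: ab(4))
    finally show ?thesis by (simp only: \<alpha>_def \<beta>_def)
  qed
  have "(norm (w - abs_l2 s))\<^sup>2 = integral {0..1} h"
    using norm_abs_l2[OF square_integrable_diff[OF F(3) ss]]
    by (simp add: F(1)[symmetric] abs_l2_diff F(3) ss h_def[abs_def])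
  also have "\<dots> = (\<Sum>q<m. integral {real q / real m..real (Suc q) / real m} h)"
    using integral_uniform_partition[OF hi, of m m] m(2) by simp
  also have "\<dots> \<le> (\<Sum>q<m. (2 / (real m * pi))\<^sup>2 * integral {real q / real m..real (Suc q) / real m} (\<lambda>x. (f x)\<^sup>2))"
    by (intro sum_mono cell) auto
  also have "\<dots> = (2 / (real m * pi))\<^sup>2 * integral {0..1} (\<lambda>x. (f x)\<^sup>2)"
    using integral_uniform_partition[OF f2, of m m] m(2) by (simp add: sum_distrib_left)
  also have "\<dots> = (2 / (real m * pi) * norm g)\<^sup>2"
    by (simp only: norm_abs_l2[OF f(1), symmetric] f(2) power_mult_distrib)
  finally have "norm (w - abs_l2 s) \<le> 2 / (real m * pi) * norm g"
    by (rule power2_le_imp_le) simp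
  then show ?thesis using \<open>abs_l2 s \<in> splines 0 \<tau> a b\<close> unfolding \<tau>_def by blast
qed

section \<open>Induction on the degree and on the order of differentiation\<close>

lemma span_primitives:
  assumes B: "finite B" "card B + 1 \<le> n + of_bool a + of_bool b" and one: "a \<Longrightarrow> b \<Longrightarrow> one_l2 \<in> span B"
  shows "\<exists>C. finite C \<and> card C \<le> n \<and> {u. \<exists>f\<in>span B. bc_deriv a b u f} = span C"
proof (cases a; cases b)
  \<comment> \<open>Only functions of mean zero have a primitive vanishing at both ends, which costs
    one dimension.\<close>
  assume ab: a b
  define H where "H = {f \<in> span B. inner one_l2 f = 0}"
  have H: "subspace H"
    unfolding H_def subspace_def by (auto simp: inner_add_right span_zero span_add span_scale)
  obtain C where C: "C \<subseteq> H" "independent C" "H \<subseteq> span C"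
    using maximal_independent_subset by blast
  have spC: "span C = H" using C(1,3) H span_minimal by blast
  \<comment> \<open>Adding \<open>one_l2\<close> to the basis of \<open>H\<close> stays independent
    within \<open>span B\<close>; so \<open>C\<close> has at least one element less than
    \<open>B\<close>.\<close>
  have "one_l2 \<notin> span C" unfolding spC H_def by (simp add: inner_one_one)
  then have ind: "independent (insert one_l2 C)" and notin: "one_l2 \<notin> C"
    using C(2) independent_insertI span_base by blast+
  have "insert one_l2 C \<subseteq> span B" using one[OF ab] C(1) by (auto simp: H_def)
  then have "finite (insert one_l2 C) \<and> card (insert one_l2 C) \<le> card B"
    by (rule independent_span_bound[OF B(1) ind])
  then have fin: "finite C" and "card C + 1 \<le> card B" using notin by auto
  then have "card C \<le> n" using B(2) ab by simp
  then have "card (prim_l2 ` C) \<le> n" using card_image_le[OF fin, of prim_l2] by linarith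
  moreover have "{u. \<exists>f\<in>span B. bc_deriv a b u f} = prim_l2 ` H"
    using ab by (auto simp: bc_deriv_def H_def)
  then have "{u. \<exists>f\<in>span B. bc_deriv a b u f} = span (prim_l2 ` C)"
    by (simp add: linear_span_image[OF linear_prim_l2] spC)
  ultimately show ?thesis using fin by blast
next
  \<comment> \<open>The constant of integration is free and may add one dimension.\<close>
  assume ab: "\<not> a" "\<not> b"
  define C where "C = insert one_l2 (prim_l2 ` B)"
  have "card C \<le> n"
    using B(2) ab card_image_le[OF B(1), of prim_l2] card_insert_le_m1[of n "prim_l2 ` B" one_l2]
    by (cases n) (auto simp: C_def)
  moreover have "{u. \<exists>f\<in>span B. bc_deriv a b u f} = span C"
  proof (intro set_eqI iffI)
    fix u assume "u \<in> {u. \<exists>f\<in>span B. bc_deriv a b u f}"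
    then obtain f c where "f \<in> span B" "u = c *\<^sub>R one_l2 + prim_l2 f"
      by (auto simp: bc_deriv_def)
    then show "u \<in> span C"
      unfolding C_def span_insert linear_span_image[OF linear_prim_l2]
      by (intro CollectI exI[of _ c]) auto
  next
    fix u assume "u \<in> span C"
    then obtain k f where "f \<in> span B" "u - k *\<^sub>R one_l2 = prim_l2 f"
      unfolding C_def span_insert linear_span_image[OF linear_prim_l2] by blast
    then have "f \<in> span B" "u = k *\<^sub>R one_l2 + prim_l2 f" by (auto simp: algebra_simps)
    then show "u \<in> {u. \<exists>f\<in>span B. bc_deriv a b u f}" using ab by (auto simp: bc_deriv_def)
  qed
  moreover have "finite C" using B(1) by (simp add: C_def)
  ultimately show ?thesis by (intro exI[of _ C] conjI)
next
  \<comment> \<open>A single condition determines the constant, so taking primitives is a linear map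
    and the bound on the dimension is kept.\<close>
  have *: ?thesis if ab: "a \<noteq> b"
  proof -
    define L where "L f = (if a then 0 else - inner one_l2 f) *\<^sub>R one_l2 + prim_l2 f" for f
    have L: "linear L"
      by (cases a; rule linearI)
         (simp_all add: L_def linear_add[OF linear_prim_l2] linear_scale[OF linear_prim_l2] inner_add_right
           algebra_simps)
    have "bc_deriv a b u f \<longleftrightarrow> u = L f" for u f
      using ab by (cases a) (simp_all add: bc_deriv_def L_def eq_neg_iff_add_eq_0[symmetric] conj_commute)
    then have "{u. \<exists>f\<in>span B. bc_deriv a b u f} = span (L ` B)"
      by (auto simp: linear_span_image[OF L])
    moreover have "card (L ` B) \<le> n"
      using B(2) ab card_image_le[OF B(1), of L] by (cases a; cases b) auto
    ultimately show ?thesis using B(1) by blast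
  qed
  show ?thesis if a "\<not> b" using * that by simp
  show ?thesis if "\<not> a" b using * that by simp
qed

text \<open>The claims are bundled because the step from \<open>d\<close> to \<open>Suc d\<close>
  uses all of them for the swapped type: a finite spanning set for the projection, the constants,
  and the estimate. Here the dimension is only bounded by \<open>n\<close>. The hypothesis is
  \<open>m \<ge> 1\<close> and not \<open>n \<ge> 1\<close>, since swapping may turn
  \<open>n\<close> into 0.\<close>

lemma spline_spaces:
  assumes "m = 2 * n + of_bool a + of_bool b" "m \<ge> 1"
  shows "\<exists>B. finite B \<and> card B \<le> n \<and> splines d (uniform_knots m (even d \<longleftrightarrow> a)) a b = span B \<and>
    (\<not> a \<longrightarrow> \<not> b \<longrightarrow> one_l2 \<in> span B) \<and>
    (\<forall>w g. bc_deriv a b w g \<longrightarrow> (\<exists>y\<in>span B. norm (w - y) \<le> 2 / (real m * pi) * norm g))"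
  using assms
proof (induction d arbitrary: a b n)
  case 0
  define \<tau> where "\<tau> = uniform_knots m a"
  have \<tau>: "valid_knots \<tau>" by (simp add: \<tau>_def valid_uniform_knots)
  define J where "J = {j. j \<le> length \<tau> \<and> (a \<longrightarrow> j \<noteq> 0) \<and> (b \<longrightarrow> j \<noteq> length \<tau>)}"
  define B where "B = (\<lambda>j. abs_l2 (indicator (knot_interval \<tau> j))) ` J"
  have fin: "finite J" by (rule finite_subset[of _ "{..length \<tau>}"]) (auto simp: J_def)
  have sp: "splines 0 \<tau> a b = span B"
    unfolding B_def J_def by (rule splines_0_span[OF \<tau>])
  have "J \<subseteq> {of_bool a..<Suc (length \<tau>) - of_bool b}"
    by (auto simp: J_def)
  then have "card J \<le> Suc (length \<tau>) - of_bool b - of_bool a"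
    using card_mono[of "{of_bool a..<Suc (length \<tau>) - of_bool b}" J] by simp
  also have "\<dots> \<le> n"
    using 0 by (cases a; cases b) (auto simp: \<tau>_def length_uniform_knots)
  finally have "card B \<le> n" unfolding B_def using card_image_le[OF fin] order_trans by blast
  moreover have "one_l2 \<in> span B" if "\<not> a" "\<not> b"
  proof -
    have "abs_l2 (piecewise \<tau> (\<lambda>j. [:1:])) \<in> splines 0 \<tau> a b"
      unfolding splines_0_eq[OF \<tau>] using that by (intro CollectI exI[of _ "\<lambda>_. 1"]) simp
    moreover have "piecewise \<tau> (\<lambda>j. [:1:]) x = 1" if "x \<in> {0..1}" for x
      using knot_interval_ex[OF \<tau> that] piecewise_eq[OF \<tau>] by (metis add.right_neutral mult_zero_right poly_0 poly_pCons)
    then have "abs_l2 (piecewise \<tau> (\<lambda>j. [:1:])) = one_l2"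
      unfolding one_l2_def by (rule abs_l2_cong[OF square_integrable_piecewise])
    ultimately show ?thesis using sp by simp
  qed
  moreover have "finite B" using fin by (simp add: B_def)
  moreover have "\<exists>y\<in>span B. norm (w - y) \<le> 2 / (real m * pi) * norm g" if "bc_deriv a b w g" for w g
    using splines_0_approximation[OF 0 that] sp by (simp add: \<tau>_def)
  ultimately show ?case using sp by (intro exI[of _ B]) (simp add: \<tau>_def)
next
  case (Suc d)
  \<comment> \<open>The swapped type keeps \<open>m\<close> and thereby changes \<open>n\<close>.
    The subtraction is not truncated: without flags \<open>m \<ge> 1\<close> gives
    \<open>n \<ge> 1\<close>.\<close>
  have m: "m = 2 * (n + of_bool a + of_bool b - 1) + of_bool (\<not> a) + of_bool (\<not> b)"
    using Suc.prems by (cases a; cases b) auto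
  define \<tau> where "\<tau> = uniform_knots m (even (Suc d) \<longleftrightarrow> a)"
  have \<tau>: "valid_knots \<tau>" by (simp add: \<tau>_def valid_uniform_knots)
  have par: "(even d \<longleftrightarrow> \<not> a) = (even (Suc d) \<longleftrightarrow> a)" by auto
  obtain B where B: "finite B" "card B \<le> n + of_bool a + of_bool b - 1"
      "splines d \<tau> (\<not> a) (\<not> b) = span B" and one': "\<not> \<not> a \<longrightarrow> \<not> \<not> b \<longrightarrow> one_l2 \<in> span B"
      and approx': "\<forall>w g. bc_deriv (\<not> a) (\<not> b) w g \<longrightarrow> (\<exists>y\<in>span B. norm (w - y) \<le> 2 / (real m * pi) * norm g)"
    using Suc.IH[OF m Suc.prems(2), unfolded par, folded \<tau>_def] by (elim exE conjE)
  have B4: "a \<Longrightarrow> b \<Longrightarrow> one_l2 \<in> span B" using one' by simp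
  have B5: "\<exists>y\<in>span B. norm (w - y) \<le> 2 / (real m * pi) * norm g"
    if "bc_deriv (\<not> a) (\<not> b) w g" for w g using approx' that by simp
  have cB: "card B + 1 \<le> n + of_bool a + of_bool b"
    using B(2) Suc.prems by (cases a; cases b) auto
  have "\<exists>C. finite C \<and> card C \<le> n \<and> {u. \<exists>f\<in>span B. bc_deriv a b u f} = span C"
    by (rule span_primitives[OF B(1) cB]) (rule B4)
  then obtain C where C: "finite C" "card C \<le> n" "{u. \<exists>f\<in>span B. bc_deriv a b u f} = span C"
    by (elim exE conjE)
  have sp: "splines (Suc d) \<tau> a b = span C"
    by (simp only: splines_Suc[OF \<tau>] B(3) C(3))
  have one: "one_l2 \<in> span C" if "\<not> a" "\<not> b"
  proof -
    have "bc_deriv a b one_l2 0"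
      unfolding bc_deriv_def using that by (intro exI[of _ 1]) (simp add: linear_0[OF linear_prim_l2])
    then show ?thesis unfolding C(3)[symmetric] using span_zero by blast
  qed
  have approx: "\<exists>y\<in>span C. norm (w - y) \<le> 2 / (real m * pi) * norm g" if w: "bc_deriv a b w g" for w g
  proof -
    \<comment> \<open>Comparison of the projection with 0 gives the estimate of first order.\<close>
    obtain t p where "p \<in> span B" "bc_deriv a b t p" "norm (w - t) \<le> 2 / (real m * pi) * norm (g - 0)"
      using bc_deriv_approximation[OF B(1) B4 B5 _ w span_zero] by auto
    then show ?thesis unfolding C(3)[symmetric] by auto
  qed
  show ?case using C(1,2) sp one approx unfolding \<tau>_def by blast
qed

text \<open>The error in \<open>bc_deriv_approximation\<close> is relative to the distance of the
  derivative from an arbitrary \<open>y0\<close>; with \<open>y0\<close> from the induction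
  hypothesis one further factor is gained. Each derivative uses up one degree, hence
  \<open>r \<le> Suc d\<close>.\<close>

lemma splines_approximation:
  assumes m: "m = 2 * n + of_bool a + of_bool b" "m \<ge> 1"
    and u: "bc_derivs r a b u g" and d: "r \<le> Suc d"
  shows "\<exists>y\<in>splines d (uniform_knots m (even d \<longleftrightarrow> a)) a b. norm (u - y) \<le> (2 / (real m * pi)) ^ r * norm g"
  using m u d
proof (induction r arbitrary: a b n u d)
  case 0
  obtain B where "splines d (uniform_knots m (even d \<longleftrightarrow> a)) a b = span B"
    using spline_spaces[OF 0(1,2)] by blast
  then have "0 \<in> splines d (uniform_knots m (even d \<longleftrightarrow> a)) a b" by (simp add: span_zero)
  then show ?case using 0 by (intro bexI[of _ 0]) (auto simp: bc_derivs_0)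
next
  case (Suc r)
  obtain f where f: "bc_deriv a b u f" "bc_derivs r (\<not> a) (\<not> b) f g"
    using Suc.prems(3) by (auto simp: bc_derivs_Suc)
  show ?case
  proof (cases d)
    case 0
    \<comment> \<open>Degree 0 leaves room for a single derivative, so \<open>r\<close> is 0
      here.\<close>
    then have "f = g" using f(2) Suc.prems(4) by (simp add: bc_derivs_0)
    then show ?thesis
      using spline_spaces[OF Suc.prems(1,2), of d] f(1) Suc.prems(4) 0 by auto
  next
    case (Suc e)
    have m': "m = 2 * (n + of_bool a + of_bool b - 1) + of_bool (\<not> a) + of_bool (\<not> b)"
      using Suc.prems by (cases a; cases b) auto
    define \<tau> where "\<tau> = uniform_knots m (even d \<longleftrightarrow> a)"
    have \<tau>: "valid_knots \<tau>" by (simp add: \<tau>_def valid_uniform_knots)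
    have par: "(even e \<longleftrightarrow> \<not> a) = (even d \<longleftrightarrow> a)" using Suc by auto
    obtain B where B: "finite B"
      "splines e \<tau> (\<not> a) (\<not> b) = span B" and one': "\<not> \<not> a \<longrightarrow> \<not> \<not> b \<longrightarrow> one_l2 \<in> span B"
      and approx': "\<forall>w g. bc_deriv (\<not> a) (\<not> b) w g \<longrightarrow> (\<exists>y\<in>span B. norm (w - y) \<le> 2 / (real m * pi) * norm g)"
      using spline_spaces[OF m' Suc.prems(2), of e, unfolded par, folded \<tau>_def] by (elim exE conjE)
    have B4: "a \<Longrightarrow> b \<Longrightarrow> one_l2 \<in> span B" using one' by simp
    have B5: "\<exists>y\<in>span B. norm (w - y) \<le> 2 / (real m * pi) * norm g"
      if "bc_deriv (\<not> a) (\<not> b) w g" for w g using approx' that by simp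
    obtain y where y: "y \<in> span B" "norm (f - y) \<le> (2 / (real m * pi)) ^ r * norm g"
      using Suc.IH[OF m' Suc.prems(2) f(2), of e] Suc.prems(4) Suc B(2) unfolding \<tau>_def par by auto
    obtain t p where t: "p \<in> span B" "bc_deriv a b t p" "norm (u - t) \<le> 2 / (real m * pi) * norm (f - y)"
      using bc_deriv_approximation[OF B(1) B4 B5 _ f(1) y(1)] by auto
    have "t \<in> splines d \<tau> a b"
      unfolding Suc splines_Suc[OF \<tau>] B(2) using t by blast
    moreover have "2 / (real m * pi) * norm (f - y) \<le> 2 / (real m * pi) * ((2 / (real m * pi)) ^ r * norm g)"
      using y(2) by (rule mult_left_mono) simp
    ultimately show ?thesis using t(3) unfolding \<tau>_def by (intro bexI[of _ t]) auto
  qed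
qed


subsection \<open>Eigenfunctions and the lower bound\<close>

text \<open>\<open>q\<close> counts the quarter waves on the unit interval. The phase
  \<open>N\<close> covers sine, cosine and their negatives; differentiation raises \<open>N\<close>
  by one.\<close>

definition sine_mode :: "nat \<Rightarrow> nat \<Rightarrow> l2"
  where "sine_mode q N = abs_l2 (\<lambda>x. sin ((real q * x + real N) * (pi / 2)))"

lemma sin_even_half_pi: "even N \<Longrightarrow> sin (real N * (pi / 2)) = 0"
  by (auto elim!: evenE)

lemma sine_mode_bc_deriv:
  assumes "a \<Longrightarrow> even N" "b \<Longrightarrow> even (q + N)"
  shows "bc_deriv a b (sine_mode q N) ((real q * (pi / 2)) *\<^sub>R sine_mode q (Suc N))"
proof -
  define F where "F x = sin ((real q * x + real N) * (pi / 2))" for x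
  define f where "f x = real q * (pi / 2) * sin ((real q * x + real (Suc N)) * (pi / 2))" for x
  have "(F has_real_derivative cos ((real q * x + real N) * (pi / 2)) * (real q * (pi / 2))) (at x within {0..1})" for x
    unfolding F_def[abs_def] by (auto intro!: derivative_eq_intros)
  moreover have "cos ((real q * x + real N) * (pi / 2)) * (real q * (pi / 2)) = f x" for x
  proof -
    have "(real q * x + real (Suc N)) * (pi / 2) = (real q * x + real N) * (pi / 2) + pi / 2"
      by (simp add: algebra_simps)
    then show ?thesis unfolding f_def by (simp only: sin_add) (simp add: mult.commute)
  qed
  ultimately have d: "(F has_real_derivative f x) (at x within {0..1})" for x by simp
  have fc: "continuous_on {0..1} f" unfolding f_def[abs_def] by (intro continuous_intros)
  have p: "primitive_on 0 1 F f" using d fc by (rule primitive_on_derivative)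
  have fs: "square_integrable f" by (rule square_integrable_continuous[OF fc])
  have "square_integrable (\<lambda>x. sin ((real q * x + real (Suc N)) * (pi / 2)))"
    by (intro square_integrable_continuous continuous_intros)
  then have f: "abs_l2 f = (real q * (pi / 2)) *\<^sub>R sine_mode q (Suc N)"
    unfolding sine_mode_def f_def[abs_def] by (rule abs_l2_scaleR[symmetric])
  have F: "sine_mode q N = F 0 *\<^sub>R one_l2 + prim_l2 (abs_l2 f)"
    using primitive_on_abs_l2(1)[OF fs primitive_onD(2)[OF p]] by (simp add: sine_mode_def F_def[abs_def])
  have F01: "F 0 = sin (real N * (pi / 2))" "F 1 = sin (real (q + N) * (pi / 2))"
    by (simp_all add: F_def)
  have "F 0 + inner one_l2 (abs_l2 f) = F 1"
    using primitive_on_diff[OF p, of 0 1] by (simp add: inner_one_l2[OF fs])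
  then show ?thesis
    unfolding bc_deriv_def f[symmetric]
    by (intro exI[of _ "F 0"] conjI impI F) (simp_all only: F01 sin_even_half_pi assms)
qed

lemma bc_derivs_zero: "bc_derivs r a b 0 0"
  unfolding bc_derivs_def bc_deriv_def
  by (intro exI[of _ "\<lambda>_. 0"]) (auto simp: linear_0[OF linear_prim_l2])

lemma bc_derivs_scaleR: "bc_derivs r a b v h \<Longrightarrow> bc_derivs r a b (c *\<^sub>R v) (c *\<^sub>R h)"
  using bc_derivs_add_scaleR[OF bc_derivs_zero] by simp

lemma bc_derivs_sum:
  assumes "finite A" "\<And>i. i \<in> A \<Longrightarrow> bc_derivs r a b (u i) (g i)"
  shows "bc_derivs r a b (\<Sum>i\<in>A. u i) (\<Sum>i\<in>A. g i)"
  using assms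
proof (induction A rule: finite_induct)
  case (insert i A)
  then show ?case using bc_derivs_add_scaleR[of r a b "u i" "g i" _ _ 1] by simp
qed (simp add: bc_derivs_zero)

lemma sine_mode_bc_derivs:
  assumes "a \<longleftrightarrow> even N" "b \<longleftrightarrow> even (q + N)"
  shows "bc_derivs r a b (sine_mode q N) ((real q * (pi / 2)) ^ r *\<^sub>R sine_mode q (N + r))"
  using assms
proof (induction r arbitrary: a b N)
  case 0
  then show ?case by (simp add: bc_derivs_0)
next
  case (Suc r)
  have "bc_derivs r (\<not> a) (\<not> b) (sine_mode q (Suc N)) ((real q * (pi / 2)) ^ r *\<^sub>R sine_mode q (Suc N + r))"
    by (rule Suc.IH) (use Suc.prems in auto)
  then have "bc_derivs r (\<not> a) (\<not> b) ((real q * (pi / 2)) *\<^sub>R sine_mode q (Suc N))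
      ((real q * (pi / 2)) *\<^sub>R (real q * (pi / 2)) ^ r *\<^sub>R sine_mode q (Suc N + r))"
    by (rule bc_derivs_scaleR)
  moreover have "bc_deriv a b (sine_mode q N) ((real q * (pi / 2)) *\<^sub>R sine_mode q (Suc N))"
    by (rule sine_mode_bc_deriv) (use Suc.prems in auto)
  ultimately show ?case unfolding bc_derivs_Suc by (auto simp: mult.assoc)
qed

lemma integral_cos_multiple:
  assumes "s \<noteq> 0"
  shows "((\<lambda>x. cos ((real_of_int s * x + real N) * pi)) has_integral 0) {0..1}"
proof -
  define G where "G x = sin ((real_of_int s * x + real N) * pi) / (real_of_int s * pi)" for x
  have "((\<lambda>x. cos ((real_of_int s * x + real N) * pi)) has_integral (G 1 - G 0)) {0..1}"
  proof (rule fundamental_theorem_of_calculus)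
    fix x
    show "(G has_vector_derivative cos ((real_of_int s * x + real N) * pi)) (at x within {0..1})"
      unfolding G_def[abs_def] has_real_derivative_iff_has_vector_derivative[symmetric]
      using assms by (auto intro!: derivative_eq_intros)
  qed simp
  moreover have "sin (real_of_int k * pi) = 0" for k by (simp add: sin_integer_2pi sin_zero_iff_int2)
  from this[of "s + int N"] this[of "int N"] have "G 1 = 0" "G 0 = 0" by (simp_all add: G_def)
  ultimately show ?thesis by simp
qed

text \<open>Equal parity makes \<open>(p - q) / 2\<close> and \<open>(p + q) / 2\<close> integers,
  so in the product formula each cosine of nonzero frequency has integral 0;
  \<open>p + q > 0\<close> keeps the second one from being constant.\<close>

lemma inner_sine_mode:
  assumes "even (p + q)" "p + q > 0"
  shows "inner (sine_mode p N) (sine_mode q N) = (if p = q then 1 / 2 else 0)"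
proof -
  define s t where "s = (int p - int q) div 2" and "t = (int p + int q) div 2"
  have st: "int p - int q = 2 * s" "int p + int q = 2 * t"
    using assms(1) by (auto simp: s_def t_def)
  have st': "real p - real q = 2 * of_int s" "real p + real q = 2 * of_int t"
    using arg_cong[OF st(1), of real_of_int] arg_cong[OF st(2), of real_of_int] by simp_all
  have t: "t \<noteq> 0" using assms(2) st by auto
  have prod: "sin ((real p * x + real N) * (pi / 2)) * sin ((real q * x + real N) * (pi / 2))
      = cos ((real_of_int s * x + real 0) * pi) / 2 - cos ((real_of_int t * x + real N) * pi) / 2" for x
  proof -
    have "(real p * x + real N) * (pi / 2) - (real q * x + real N) * (pi / 2) = (real p - real q) * x * (pi / 2)"
      by (simp add: algebra_simps)
    moreover have "(real p * x + real N) * (pi / 2) + (real q * x + real N) * (pi / 2)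
        = ((real p + real q) * x + 2 * real N) * (pi / 2)"
      by (simp add: algebra_simps)
    ultimately show ?thesis
      unfolding sin_times_sin by (simp only: st') (simp add: algebra_simps diff_divide_distrib)
  qed
  have S: "((\<lambda>x. cos ((real_of_int s * x + real 0) * pi)) has_integral (if p = q then 1 else 0)) {0..1}"
  proof (cases "p = q")
    case True
    then have "s = 0" using st by simp
    then show ?thesis using True has_integral_const_real[of "1::real" 0 1] by simp
  next
    case False
    then have "s \<noteq> 0" using st by auto
    from integral_cos_multiple[OF this, of 0] show ?thesis using False by simp
  qed
  have "((\<lambda>x. sin ((real p * x + real N) * (pi / 2)) * sin ((real q * x + real N) * (pi / 2))) has_integral
      ((if p = q then 1 else 0) / 2 - 0 / 2)) {0..1}"
    unfolding prod by (intro has_integral_diff has_integral_divide S integral_cos_multiple t)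
  moreover have "square_integrable (\<lambda>x. sin ((real q * x + real N) * (pi / 2)))" for q
    by (intro square_integrable_continuous continuous_intros)
  ultimately show ?thesis
    by (simp add: sine_mode_def inner_abs_l2 integral_unique)
qed

lemma norm_sine_mode_0: "norm (sine_mode 0 (Suc 0)) = 1"
proof -
  have "sine_mode 0 (Suc 0) = one_l2" by (simp add: sine_mode_def one_l2_def)
  then show ?thesis using inner_one_one by (simp add: norm_eq_sqrt_inner)
qed

lemma sum_orthogonal_norm:
  fixes e :: "'i \<Rightarrow> 'a::real_inner"
  assumes "finite A" "\<And>i j. i \<in> A \<Longrightarrow> j \<in> A \<Longrightarrow> i \<noteq> j \<Longrightarrow> inner (e i) (e j) = 0"
  shows "(norm (\<Sum>i\<in>A. c i *\<^sub>R e i))\<^sup>2 = (\<Sum>i\<in>A. (c i)\<^sup>2 * (norm (e i))\<^sup>2)"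
proof -
  have "inner (c i *\<^sub>R e i) (\<Sum>j\<in>A. c j *\<^sub>R e j) = (c i)\<^sup>2 * (norm (e i))\<^sup>2" if i: "i \<in> A" for i
  proof -
    have "inner (c i *\<^sub>R e i) (\<Sum>j\<in>A. c j *\<^sub>R e j) = (\<Sum>j\<in>A. if j = i then (c i)\<^sup>2 * (norm (e i))\<^sup>2 else 0)"
      unfolding inner_sum_right using assms(2) i
      by (intro sum.cong) (auto simp: power2_norm_eq_inner, simp add: power2_eq_square)
    then show ?thesis using assms(1) i by simp
  qed
  then show ?thesis
    unfolding power2_norm_eq_inner[of "sum _ _"] by (simp add: inner_sum_left)
qed

text \<open>The orthogonal projection onto \<open>span B\<close> cannot be injective on a space of
  larger dimension; \<open>v\<close> is a vector in its kernel.\<close>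

lemma orthogonal_vector_exists:
  fixes B S :: "'a::real_inner set"
  assumes "finite B" "independent S" "finite S" "card B < card S"
  obtains v where "v \<in> span S" "v \<noteq> 0" "\<And>y. y \<in> span B \<Longrightarrow> inner v y = 0"
proof -
  obtain P where P: "linear P" "\<And>x. P x \<in> span B" "\<And>x y. y \<in> span B \<Longrightarrow> inner (x - P x) y = 0"
    by (rule finite_span_projection[OF assms(1)]) blast
  have "\<not> inj_on P (span S)"
  proof
    assume inj: "inj_on P (span S)"
    then have "independent (P ` S)" by (rule linear_independent_injective_image[OF P(1) assms(2)])
    then have "card (P ` S) \<le> card B"
      using independent_span_bound[OF assms(1), of "P ` S"] P(2) by blast
    moreover have "card (P ` S) = card S"
      using inj span_superset by (intro card_image) (rule inj_on_subset)
    ultimately show False using assms(4) by simp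
  qed
  then obtain v where v: "v \<in> span S" "v \<noteq> 0" "P v = 0"
    using linear_inj_on_iff_eq_0[OF P(1) subspace_span] by blast
  then show thesis using that P(3)[of _ v] by simp
qed

text \<open>A Bernstein inequality: differentiation multiplies each coefficient by a frequency of at
  most \<open>m pi/2\<close>, and the modes stay orthogonal because only their common phase
  moves.\<close>

lemma extremal_function_exists:
  assumes m: "m = 2 * n + of_bool a + of_bool b" and r: "r \<ge> 1" and B: "finite B" "card B \<le> n"
  obtains v g where "bc_derivs r a b v g" "v \<noteq> 0" "\<And>y. y \<in> span B \<Longrightarrow> inner v y = 0"
    "norm g \<le> (real m * (pi / 2)) ^ r * norm v"
proof -
  \<comment> \<open>Sines if the function has to vanish at 0, cosines otherwise.\<close>
  define N where "N = (of_bool (\<not> a) :: nat)"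
  \<comment> \<open>The \<open>n + 1\<close> indices up to \<open>m\<close> with the parity of
    \<open>m\<close>. With both flags they start at 2, as the sine of frequency 0 is zero; with none
    they start at 0, the constant mode.\<close>
  define Q where "Q = (\<lambda>k. 2 * k + of_bool (a \<noteq> b) + 2 * of_bool (a \<and> b)) ` {..n}"
  have Q: "finite Q" "card Q = n + 1"
    unfolding Q_def by (auto simp: card_image inj_on_def)
  have Qm: "q \<le> m" "even (q + m)" "a \<Longrightarrow> q > 0" if "q \<in> Q" for q
    using that unfolding Q_def m by (auto; cases a; cases b; auto)+
  have ev: "even (p + q)" if "p \<in> Q" "q \<in> Q" for p q
    using Qm(2)[OF that(1)] Qm(2)[OF that(2)] by auto
  have orth: "inner (sine_mode p M) (sine_mode q M) = 0" if "p \<in> Q" "q \<in> Q" "p \<noteq> q" for p q M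
    using inner_sine_mode[OF ev[OF that(1,2)], of M] that(3) by auto
  have norm_pos: "(norm (sine_mode q M))\<^sup>2 = 1 / 2" if "q > 0" for q M
    using inner_sine_mode[of q q M] that by (simp add: power2_norm_eq_inner)
  have norm_N: "norm (sine_mode q N) > 0" if "q \<in> Q" for q
  proof (cases "q = 0")
    case True
    then show ?thesis using Qm(3)[OF that] norm_sine_mode_0 by (auto simp: N_def)
  next
    case False
    then show ?thesis using norm_pos[of q N] by (metis gr0I less_numeral_extra(3) norm_eq_zero norm_ge_zero order_less_le power_zero_numeral zero_neq_one divide_eq_0_iff zero_neq_numeral)
  qed
  have inj: "inj_on (\<lambda>q. sine_mode q N) Q"
  proof (rule inj_onI, rule ccontr)
    fix p q assume pq: "p \<in> Q" "q \<in> Q" "sine_mode p N = sine_mode q N" "p \<noteq> q"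
    then have "inner (sine_mode q N) (sine_mode q N) = 0" using orth[of p q N] by simp
    then show False using norm_N[OF pq(2)] by simp
  qed
  have ind: "independent ((\<lambda>q. sine_mode q N) ` Q)"
    using orth norm_N by (intro pairwise_orthogonal_independent) (auto simp: pairwise_def orthogonal_def)
  obtain v where v: "v \<in> span ((\<lambda>q. sine_mode q N) ` Q)" "v \<noteq> 0" "\<And>y. y \<in> span B \<Longrightarrow> inner v y = 0"
    using orthogonal_vector_exists[OF B(1) ind] Q B(2) card_image[OF inj] by auto
  obtain u where "v = (\<Sum>x\<in>(\<lambda>q. sine_mode q N) ` Q. u x *\<^sub>R x)"
    using v(1) Q(1) by (auto simp: span_finite)
  then obtain c where c: "v = (\<Sum>q\<in>Q. c q *\<^sub>R sine_mode q N)"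
    using sum.reindex[OF inj, of "\<lambda>x. u x *\<^sub>R x"] by auto
  define \<mu> where "\<mu> q = real q * (pi / 2)" for q
  define g where "g = (\<Sum>q\<in>Q. c q *\<^sub>R \<mu> q ^ r *\<^sub>R sine_mode q (N + r))"
  have vg: "bc_derivs r a b v g"
    unfolding c g_def \<mu>_def
  proof (intro bc_derivs_sum bc_derivs_scaleR sine_mode_bc_derivs Q(1))
    show "a \<longleftrightarrow> even N" by (simp add: N_def)
    fix q assume "q \<in> Q"
    from Qm(2)[OF this] show "b \<longleftrightarrow> even (q + N)" unfolding m N_def by (cases a; cases b) auto
  qed
  have "g = (\<Sum>q\<in>Q. (c q * \<mu> q ^ r) *\<^sub>R sine_mode q (N + r))" by (simp add: g_def)
  then have "(norm g)\<^sup>2 = (\<Sum>q\<in>Q. (c q * \<mu> q ^ r)\<^sup>2 * (norm (sine_mode q (N + r)))\<^sup>2)"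
    using sum_orthogonal_norm[OF Q(1), of "\<lambda>q. sine_mode q (N + r)"] orth by simp
  also have "\<dots> \<le> (\<Sum>q\<in>Q. (\<mu> m ^ r)\<^sup>2 * ((c q)\<^sup>2 * (norm (sine_mode q N))\<^sup>2))"
  proof (rule sum_mono)
    fix q assume q: "q \<in> Q"
    show "(c q * \<mu> q ^ r)\<^sup>2 * (norm (sine_mode q (N + r)))\<^sup>2 \<le> (\<mu> m ^ r)\<^sup>2 * ((c q)\<^sup>2 * (norm (sine_mode q N))\<^sup>2)"
    \<comment> \<open>The norm of the mode of frequency 0 depends on the phase, but its term in
      \<open>g\<close> carries the factor \<open>\<mu> q ^ r\<close>, which is 0 as
      \<open>r \<ge> 1\<close>.\<close>
    proof (cases "q = 0")
      case True
      then have "\<mu> q ^ r = 0" using r by (simp add: \<mu>_def)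
      then show ?thesis by (simp only: mult_zero_right) simp
    next
      case False
      have "\<mu> q \<le> \<mu> m" using Qm(1)[OF q] by (simp add: \<mu>_def mult_right_mono)
      then have "(\<mu> q ^ r)\<^sup>2 \<le> (\<mu> m ^ r)\<^sup>2" by (intro power_mono) (auto simp: \<mu>_def)
      then have "(\<mu> q ^ r)\<^sup>2 * (c q)\<^sup>2 \<le> (\<mu> m ^ r)\<^sup>2 * (c q)\<^sup>2" by (rule mult_right_mono) simp
      moreover have n2: "(norm (sine_mode q (N + r)))\<^sup>2 = 1 / 2" "(norm (sine_mode q N))\<^sup>2 = 1 / 2"
        using norm_pos False by auto
      ultimately show ?thesis unfolding n2 by (simp add: power_mult_distrib mult.commute)
    qed
  qed
  also have "\<dots> = (\<mu> m ^ r)\<^sup>2 * (norm v)\<^sup>2"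
    using sum_orthogonal_norm[OF Q(1), of "\<lambda>q. sine_mode q N" c] orth by (simp add: c sum_distrib_left)
  also have "\<dots> = (\<mu> m ^ r * norm v)\<^sup>2" by (simp add: power_mult_distrib)
  finally have "norm g \<le> \<mu> m ^ r * norm v"
    by (rule power2_le_imp_le) (simp add: \<mu>_def)
  then show thesis using that vg v by (simp add: \<mu>_def)
qed

section \<open>Dimension of the spline spaces and optimality\<close>

lemma norm_le_if_orthogonal:
  fixes v y :: "'a::real_inner"
  assumes "inner v y = 0"
  shows "norm v \<le> norm (v - y)"
proof (rule power2_le_imp_le)
  have "(norm (v - y))\<^sup>2 = (norm v)\<^sup>2 + (norm y)\<^sup>2"
    using assms by (simp add: power2_norm_eq_inner inner_diff_left inner_diff_right inner_commute)
  then show "(norm v)\<^sup>2 \<le> (norm (v - y))\<^sup>2" by simp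
qed simp

lemma finite_basis:
  assumes "finite B"
  obtains C where "finite C" "span C = span B" "card C = dim (span B)"
proof -
  obtain C where C: "C \<subseteq> span B" "independent C" "span B \<subseteq> span C" "card C = dim (span B)"
    by (rule basis_exists)
  have "finite C" using independent_span_bound[OF assms C(2,1)] by simp
  moreover have "span C = span B"
    using C(1,3) by (metis span_mono span_span subset_antisym)
  ultimately show thesis using that C(4) by blast
qed

text \<open>A space of dimension below \<open>n\<close> could not approximate as well as the splines do.\<close>

lemma splines_dim:
  assumes m: "m = 2 * n + of_bool a + of_bool b" and n: "n \<ge> 1"
  shows "splines d (uniform_knots m (even d \<longleftrightarrow> a)) a b \<in> subspaces_of_dim n"
proof -
  have m1: "m \<ge> 1" using m n by simp
  obtain B where B: "finite B" "card B \<le> n" "splines d (uniform_knots m (even d \<longleftrightarrow> a)) a b = span B"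
    and approx: "\<forall>w g. bc_deriv a b w g \<longrightarrow> (\<exists>y\<in>span B. norm (w - y) \<le> 2 / (real m * pi) * norm g)"
    using spline_spaces[OF m m1, of d] by (elim exE conjE)
  have "dim (span B) \<le> n" using dim_le_card[of "span B" B] B(1,2) by simp
  moreover have False if lt: "dim (span B) < n"
  proof -
    obtain C where C: "finite C" "span C = span B" "card C = dim (span B)" by (rule finite_basis[OF B(1)])
    \<comment> \<open>With \<open>n - 1\<close> in place of \<open>n\<close> the frequencies go up
      to \<open>m - 2\<close> only; the resulting factor \<open>(m - 2) / m < 1\<close> contradicts
      the approximation property.\<close>
    have m': "m - 2 = 2 * (n - 1) + of_bool a + of_bool b" using m n by simp
    obtain v g where v: "bc_derivs 1 a b v g" "v \<noteq> 0" "\<And>y. y \<in> span C \<Longrightarrow> inner v y = 0"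
      "norm g \<le> (real (m - 2) * (pi / 2)) ^ 1 * norm v"
    proof (rule extremal_function_exists[OF m' order_refl C(1)])
      show "card C \<le> n - 1" using C(3) lt by simp
    qed blast
    have "bc_deriv a b v g"
      using v(1) by (simp only: One_nat_def bc_derivs_Suc bc_derivs_0) blast
    then obtain y where y: "y \<in> span B" "norm (v - y) \<le> 2 / (real m * pi) * norm g"
      using approx by blast
    have "norm v \<le> norm (v - y)" by (rule norm_le_if_orthogonal) (use v(3) y(1) C(2) in simp)
    also have "\<dots> \<le> 2 / (real m * pi) * ((real (m - 2) * (pi / 2)) ^ 1 * norm v)"
      using y(2) v(4) by (meson mult_left_mono divide_nonneg_nonneg mult_nonneg_nonneg of_nat_0_le_iff order_trans pi_ge_zero zero_le_numeral)
    also have "\<dots> = real (m - 2) / real m * norm v" by simp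
    also have "\<dots> < 1 * norm v"
      using m n v(2) by (intro mult_strict_right_mono) (auto simp: field_simps)
    finally show False by simp
  qed
  ultimately have "dim (span B) = n" by force
  then show ?thesis unfolding subspaces_of_dim_def B(3) using B(1) by auto
qed

theorem theorem2:
  fixes r n d i :: nat
  assumes "r \<ge> 1" and "n \<ge> 1" and "i \<in> {0, 1, 2}" and "d \<ge> r - 1"
  shows "optimal_subspace n (fun_class r i) (spline_space n d i)"
proof -
  define a b where "a \<longleftrightarrow> i \<noteq> 1" and "b \<longleftrightarrow> i = 0"
  define m where "m = 2 * n + of_bool a + of_bool b"
  define \<sigma> where "\<sigma> = 2 / (real m * pi)"
  have m1: "m \<ge> 1" and \<sigma>: "\<sigma> > 0" using assms(2) by (simp_all add: m_def \<sigma>_def)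
  define S where "S = splines d (uniform_knots m (even d \<longleftrightarrow> a)) a b"
  have space: "spline_space n d i = S"
    using knots_eq_uniform_knots[OF assms(2,3), of d]
    by (simp add: spline_space_eq S_def a_def b_def m_def)
  have fc: "u \<in> fun_class r i \<longleftrightarrow> (\<exists>g. bc_derivs r a b u g \<and> norm g \<le> 1)" for u
    by (simp only: fun_class_iff a_def b_def)
  have S: "S \<in> subspaces_of_dim n" unfolding S_def by (rule splines_dim[OF m_def assms(2)])
  have upper: "deviation (fun_class r i) S \<le> ennreal (\<sigma> ^ r)"
    unfolding deviation_def
  proof (rule SUP_least)
    fix u assume "u \<in> fun_class r i"
    then obtain g where g: "bc_derivs r a b u g" "norm g \<le> 1" using fc by blast
    have "r \<le> Suc d" using assms(4) by simp
    from splines_approximation[OF m_def m1 g(1) this]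
    obtain y where y: "y \<in> S" "norm (u - y) \<le> \<sigma> ^ r * norm g" unfolding S_def \<sigma>_def by blast
    have "\<sigma> ^ r * norm g \<le> \<sigma> ^ r" using g(2) \<sigma> by (simp add: mult_left_le)
    then show "(INF v\<in>S. ennreal (norm (u - v))) \<le> ennreal (\<sigma> ^ r)"
      using y by (intro INF_lower2[OF y(1)] ennreal_leI) simp
  qed
  have lower: "ennreal (\<sigma> ^ r) \<le> deviation (fun_class r i) X" if X: "X \<in> subspaces_of_dim n" for X
  proof -
    obtain B where B: "finite B" "span B = X" "dim X = n" using X by (auto simp: subspaces_of_dim_def)
    obtain C where C: "finite C" "span C = X" "card C = n" using finite_basis[OF B(1)] B by metis
    obtain v g where v: "bc_derivs r a b v g" "v \<noteq> 0" "\<And>y. y \<in> X \<Longrightarrow> inner v y = 0"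
      "norm g \<le> (real m * (pi / 2)) ^ r * norm v"
      using extremal_function_exists[OF m_def assms(1) C(1)] C by auto
    \<comment> \<open>The scaling gives \<open>k *\<^sub>R v\<close> the norm
      \<open>\<sigma> ^ r\<close>; its derivative \<open>k *\<^sub>R g\<close> then has norm at most
      1, because \<open>\<sigma>\<close> is the reciprocal of the top frequency.\<close>
    define k where "k = \<sigma> ^ r / norm v"
    have k: "k > 0" "k * norm v = \<sigma> ^ r" using \<sigma> v(2) by (simp_all add: k_def)
    have "\<sigma> * (real m * (pi / 2)) = 1" using m1 by (simp add: \<sigma>_def)
    then have "\<sigma> ^ r * (real m * (pi / 2)) ^ r = 1" by (simp only: power_mult_distrib[symmetric] power_one)
    then have one: "k * ((real m * (pi / 2)) ^ r * norm v) = 1"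
      using k(2) by (metis mult.assoc mult.commute)
    have "norm (k *\<^sub>R g) \<le> k * ((real m * (pi / 2)) ^ r * norm v)"
      using v(4) k(1) by (simp add: mult_left_mono)
    then have "k *\<^sub>R v \<in> fun_class r i"
      unfolding fc using bc_derivs_scaleR[OF v(1), of k] one by auto
    moreover have "ennreal (\<sigma> ^ r) \<le> (INF y\<in>X. ennreal (norm (k *\<^sub>R v - y)))"
    proof (rule INF_greatest)
      fix y assume "y \<in> X"
      then have "norm (k *\<^sub>R v) \<le> norm (k *\<^sub>R v - y)" by (intro norm_le_if_orthogonal) (simp add: v(3))
      then show "ennreal (\<sigma> ^ r) \<le> ennreal (norm (k *\<^sub>R v - y))"
        using k by (intro ennreal_leI) simp
    qed
    ultimately show ?thesis unfolding deviation_def by (rule SUP_upper2)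
  qed
  have "kolmogorov_width n (fun_class r i) \<le> deviation (fun_class r i) S"
    unfolding kolmogorov_width_def using S by (rule INF_lower)
  moreover have "ennreal (\<sigma> ^ r) \<le> kolmogorov_width n (fun_class r i)"
    unfolding kolmogorov_width_def using lower by (rule INF_greatest)
  ultimately show ?thesis
    unfolding optimal_subspace_def space using S upper by (simp add: order_antisym)
qed

end
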